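(* Fix $\rho\in(0,1)$. For every $n$ and every total permutation-invariant function $f:\{0,1\}^n\times\{0,1\}^n\to\{0,1\}$, $$\mathrm{ISR}_\rho(f)\le \mathrm{poly}(\mathrm{R}(f))+O(\log\log n),$$ and furthermore $$\mathrm{ISR}^{\text{1-way}}_\rho(f)\le \mathrm{poly}(\mathrm{R}^{\text{1-way}}(f))+O(\log\log n),$$ where the polynomials and the constants in $O(\cdot)$ do not depend on $n$ or $f$.
   Context: A function $f:\{0,1\}^n\times\{0,1\}^n\to\{0,1\}$ is permutation-invariant if $f(\mathbf{x}^\pi,\mathbf{y}^\pi)=f(\mathbf{x},\mathbf{y})$ for all $\mathbf{x},\mathbf{y}$ and every bijection $\pi$ of $\{1,\dots,n\}$, where $x^\pi_i=x_{\pi(i)}$. $\mathrm{R}(f)$ is the minimum worst-case communication of a two-way protocol with public (perfectly shared) randomness computing $f$ correctly with probability at least $2/3$ on every input; $\mathrm{R}^{\text{1-way}}(f)$ is the same with only protocols in which Alice sends a single message to Bob, who outputs. $\mathrm{ISR}_\rho(f)$ (resp. $\mathrm{ISR}^{\text{1-way}}_\rho(f)$) is defined in the same way, except that instead of public randomness Alice gets bits $r_1,r_2,\dots$ and Bob gets $s_1,s_2,\dots$, where the pairs $(r_i,s_i)$ are i.i.d. with $\Pr[r_i=s_i=1]=\Pr[r_i=s_i=0]=(1+\rho)/4$ and $\Pr[r_i=1,s_i=0]=\Pr[r_i=0,s_i=1]=(1-\rho)/4$ (so $r_i,s_i$ are uniform and $\rho$-correlated). *)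

theory Defs
  imports
    "HOL-Probability.Probability"
    "HOL-Combinatorics.Permutations"
    "HOL-Computational_Algebra.Polynomial"
    "HOL-Library.Landau_Symbols"
begin

section \<open>Protocols\<close>

text \<open>
  Points of \<open>{0,1}^n\<close> are Boolean lists of length \<open>n\<close>, with coordinates indexed from 0.
  A random string is an infinite sequence of bits.
\<close>

type_synonym bits = "nat \<Rightarrow> bool"

text \<open>
  A protocol is a binary tree. Each bit that a player sends, and the output announced by a player
  at a leaf, is a function of that player's own input and random string; the transcript so far is
  the position in the tree. The output is not counted as communication.
\<close>

datatype protocol =
    Alice_Outputs "bool list \<Rightarrow> bits \<Rightarrow> bool"
  | Bob_Outputs "bool list \<Rightarrow> bits \<Rightarrow> bool"
  | Alice_Sends "bool list \<Rightarrow> bits \<Rightarrow> bool" protocol protocol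
  | Bob_Sends "bool list \<Rightarrow> bits \<Rightarrow> bool" protocol protocol

fun run :: "protocol \<Rightarrow> bool list \<Rightarrow> bool list \<Rightarrow> bits \<Rightarrow> bits \<Rightarrow> bool" where
  "run (Alice_Outputs h) x y r s = h x r"
| "run (Bob_Outputs h) x y r s = h y s"
| "run (Alice_Sends h P Q) x y r s = (if h x r then run P x y r s else run Q x y r s)"
| "run (Bob_Sends h P Q) x y r s = (if h y s then run P x y r s else run Q x y r s)"

fun cost :: "protocol \<Rightarrow> nat" where
  "cost (Alice_Outputs h) = 0"
| "cost (Bob_Outputs h) = 0"
| "cost (Alice_Sends h P Q) = Suc (max (cost P) (cost Q))"
| "cost (Bob_Sends h P Q) = Suc (max (cost P) (cost Q))"

text \<open>
  A single message from Alice is a sequence of bits sent with no bit from Bob in between.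
\<close>

fun one_way :: "protocol \<Rightarrow> bool" where
  "one_way (Alice_Outputs h) \<longleftrightarrow> False"
| "one_way (Bob_Outputs h) \<longleftrightarrow> True"
| "one_way (Alice_Sends h P Q) \<longleftrightarrow> one_way P \<and> one_way Q"
| "one_way (Bob_Sends h P Q) \<longleftrightarrow> False"

section \<open>Randomness\<close>

definition bits_space :: "bits measure" where
  "bits_space = (\<Pi>\<^sub>M i\<in>UNIV. count_space UNIV)"

fun measurable_protocol :: "protocol \<Rightarrow> bool" where
  "measurable_protocol (Alice_Outputs h) \<longleftrightarrow> (\<forall>x. Measurable.pred bits_space (h x))"
| "measurable_protocol (Bob_Outputs h) \<longleftrightarrow> (\<forall>y. Measurable.pred bits_space (h y))"
| "measurable_protocol (Alice_Sends h P Q) \<longleftrightarrow>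
     (\<forall>x. Measurable.pred bits_space (h x)) \<and> measurable_protocol P \<and> measurable_protocol Q"
| "measurable_protocol (Bob_Sends h P Q) \<longleftrightarrow>
     (\<forall>y. Measurable.pred bits_space (h y)) \<and> measurable_protocol P \<and> measurable_protocol Q"

text \<open>
  A source of randomness is the joint distribution of Alice's and Bob's random strings.
\<close>

definition public_randomness :: "(bits \<times> bits) measure" where
  "public_randomness =
     distr (\<Pi>\<^sub>M i\<in>UNIV. measure_pmf (bernoulli_pmf (1/2))) (bits_space \<Otimes>\<^sub>M bits_space) (\<lambda>r. (r, r))"

definition correlated_pair :: "real \<Rightarrow> (bool \<times> bool) pmf" where
  "correlated_pair \<rho> = embed_pmf (\<lambda>(a, b). if a = b then (1 + \<rho>) / 4 else (1 - \<rho>) / 4)"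

lemma pmf_correlated_pair:
  assumes "-1 \<le> \<rho>" "\<rho> \<le> 1"
  shows "pmf (correlated_pair \<rho>) (a, b) = (if a = b then (1 + \<rho>) / 4 else (1 - \<rho>) / 4)"
proof -
  let ?h = "\<lambda>(a::bool, b::bool). if a = b then (1 + \<rho>) / 4 else (1 - \<rho>) / 4"
  have nn: "0 \<le> ?h z" for z
    using assms by (auto split: prod.splits)
  have "(\<integral>\<^sup>+ z. ennreal (?h z) \<partial>count_space UNIV) = (\<Sum>z\<in>UNIV. ennreal (?h z))"
    by (simp add: nn_integral_count_space_finite)
  also have "\<dots> = ennreal (\<Sum>z\<in>UNIV. ?h z)"
    using nn by (intro sum_ennreal) auto
  also have "(\<Sum>z\<in>UNIV. ?h z) = 1"
    by (simp add: UNIV_Times_UNIV[symmetric] UNIV_bool field_simps del: UNIV_Times_UNIV)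
  finally show ?thesis
    unfolding correlated_pair_def using nn by (subst pmf_embed_pmf) auto
qed

definition correlated_randomness :: "real \<Rightarrow> (bits \<times> bits) measure" where
  "correlated_randomness \<rho> =
     distr (\<Pi>\<^sub>M i\<in>UNIV. measure_pmf (correlated_pair \<rho>)) (bits_space \<Otimes>\<^sub>M bits_space)
       (\<lambda>z. (\<lambda>i. fst (z i), \<lambda>i. snd (z i)))"

lemma prob_space_public_randomness: "prob_space public_randomness"
proof -
  interpret product_prob_space "\<lambda>_. measure_pmf (bernoulli_pmf (1/2))" "UNIV :: nat set"
    by unfold_locales
  have "(\<lambda>r. r) \<in> (\<Pi>\<^sub>M i\<in>UNIV. measure_pmf (bernoulli_pmf (1/2))) \<rightarrow>\<^sub>M bits_space"
    unfolding bits_space_def by (rule measurable_ident_sets) (auto intro!: sets_PiM_cong)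
  then show ?thesis
    unfolding public_randomness_def by (intro prob_space_distr measurable_Pair)
qed

lemma prob_space_correlated_randomness: "prob_space (correlated_randomness \<rho>)"
proof -
  interpret product_prob_space "\<lambda>_. measure_pmf (correlated_pair \<rho>)" "UNIV :: nat set"
    by unfold_locales
  have "(\<lambda>z i. h (z i)) \<in> (\<Pi>\<^sub>M i\<in>UNIV. measure_pmf (correlated_pair \<rho>)) \<rightarrow>\<^sub>M bits_space"
    for h :: "bool \<times> bool \<Rightarrow> bool"
    unfolding bits_space_def
    by (rule measurable_PiM_single')
       (auto intro!: measurable_compose[OF measurable_component_singleton])
  then show ?thesis
    unfolding correlated_randomness_def by (intro prob_space_distr measurable_Pair)
qed

section \<open>Communication complexity\<close>

definition computes ::
    "(bits \<times> bits) measure \<Rightarrow> nat \<Rightarrow> (bool list \<Rightarrow> bool list \<Rightarrow> bool) \<Rightarrow> protocol \<Rightarrow> bool" where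
  "computes M n f P \<longleftrightarrow>
     (\<forall>x y. length x = n \<longrightarrow> length y = n \<longrightarrow>
        \<P>((r, s) in M. run P x y r s = f x y) \<ge> 2 / 3)"

text \<open>
  A function \<open>{0,1}^n \<times> {0,1}^n \<Rightarrow> {0,1}\<close> is given as a function on lists, only its values on
  lists of length \<open>n\<close> being relevant. The minima below are over nonempty sets of costs; see
  \<open>ex_one_way_protocol\<close>.
\<close>

definition R :: "nat \<Rightarrow> (bool list \<Rightarrow> bool list \<Rightarrow> bool) \<Rightarrow> nat" where
  "R n f = (LEAST c. \<exists>P. measurable_protocol P \<and> computes public_randomness n f P \<and> cost P = c)"

definition R_one_way :: "nat \<Rightarrow> (bool list \<Rightarrow> bool list \<Rightarrow> bool) \<Rightarrow> nat" where
  "R_one_way n f =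
     (LEAST c. \<exists>P. one_way P \<and> measurable_protocol P \<and> computes public_randomness n f P \<and>
        cost P = c)"

definition ISR :: "real \<Rightarrow> nat \<Rightarrow> (bool list \<Rightarrow> bool list \<Rightarrow> bool) \<Rightarrow> nat" where
  "ISR \<rho> n f =
     (LEAST c. \<exists>P. measurable_protocol P \<and> computes (correlated_randomness \<rho>) n f P \<and>
        cost P = c)"

definition ISR_one_way :: "real \<Rightarrow> nat \<Rightarrow> (bool list \<Rightarrow> bool list \<Rightarrow> bool) \<Rightarrow> nat" where
  "ISR_one_way \<rho> n f =
     (LEAST c. \<exists>P. one_way P \<and> measurable_protocol P \<and>
        computes (correlated_randomness \<rho>) n f P \<and> cost P = c)"

lemma ex_one_way_protocol:
  assumes "prob_space M"
  shows "\<exists>P. one_way P \<and> measurable_protocol P \<and> computes M n f P \<and> cost P = n"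
proof -
  define P where "P = rec_nat (\<lambda>u. Bob_Outputs (\<lambda>y s. f u y))
    (\<lambda>k Q u. Alice_Sends (\<lambda>x r. x ! length u) (Q (u @ [True])) (Q (u @ [False])))"
  have P0: "P 0 u = Bob_Outputs (\<lambda>y s. f u y)"
    and PS: "P (Suc k) u =
      Alice_Sends (\<lambda>x r. x ! length u) (P k (u @ [True])) (P k (u @ [False]))" for k u
    by (simp_all add: P_def)
  have wf: "one_way (P k u) \<and> measurable_protocol (P k u) \<and> cost (P k u) = k" for k u
    by (induction k arbitrary: u) (auto simp: P0 PS)
  have run: "run (P k u) (u @ v) y r s = f (u @ v) y" if "length v = k" for k u v y r s
    using that
  proof (induction k arbitrary: u v)
    case (Suc k)
    then obtain b w where v: "v = b # w" "length w = k"
      by (cases v) auto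
    show ?case
      using Suc.IH[of w "u @ [b]"] v by (cases b) (auto simp: PS)
  qed (simp add: P0)
  have "computes M n f (P n [])"
    using run[of _ n "[]"] prob_space.prob_space[OF assms]
    by (auto simp: computes_def case_prod_beta)
  with wf show ?thesis
    by blast
qed

section \<open>Permutation invariance\<close>

text \<open>
  \<open>permute_list \<pi> x\<close> is the list whose \<open>i\<close>-th entry is \<open>x ! \<pi> i\<close>.
\<close>

definition permutation_invariant :: "nat \<Rightarrow> (bool list \<Rightarrow> bool list \<Rightarrow> bool) \<Rightarrow> bool" where
  "permutation_invariant n f \<longleftrightarrow>
     (\<forall>\<pi> x y. \<pi> permutes {..<n} \<longrightarrow> length x = n \<longrightarrow> length y = n \<longrightarrow>
        f (permute_list \<pi> x) (permute_list \<pi> y) = f x y)"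

end

theory Submission
  imports Defs "HOL-Real_Asymp.Real_Asymp"
begin

text \<open>
  A permutation-invariant \<open>f\<close> depends only on the numbers of coordinates of the four types
  \<open>(1,1), (1,0), (0,1), (0,0)\<close>. Call a pair of neighbouring inputs of the same weights on which \<open>f\<close>
  differs a jump. A jump with three cells of size \<open>m\<close> contains a set disjointness instance: with
  blocks of three coordinates, the acceptance probability becomes a polynomial in a correlation
  parameter whose coefficients are at most \<open>2^k\<close> for a protocol of cost \<open>k\<close>; it is bounded on an
  interval but has derivative \<open>\<Omega>(m)\<close> at an end point, so \<open>m = O(k^3)\<close> by a Markov-type inequality.
  A jump with two large cells in a row contains an indexing instance, so that one of these cells is
  at most \<open>2^O(k)\<close>, and in the one-way case the same holds for columns with \<open>O(k)\<close>.

  Hence, unless \<open>f\<close> is constant on the pairs of weights at hand, either a player has an input of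
  weight \<open>poly(k)\<close> or \<open>n - poly(k)\<close>, and sends short signatures of its few elements made of the
  correlated bits; or the relevant Hamming distances (or their complements to \<open>n\<close>) are
  \<open>poly(k)\<close>, and the distance is estimated from the correlation of \<open>sin L\<close> and \<open>sin M\<close> for linear
  forms \<open>L\<close>, \<open>M\<close> in the correlated bits. If \<open>f\<close> is constant there, only the two weights matter, and
  \<open>O(log n)\<close> fixed random strings suffice for all \<open>(n + 1)^2\<close> pairs of weights; Alice picks three of
  them with \<open>O(log log n)\<close> private bits.
\<close>

section \<open>Permutation-invariant functions as functions of cell counts\<close>

text \<open>For fixed weights the pairs form a line parametrised by the number of common ones, and
  only the places where f changes along it matter. Every three cells of a jump contain a small one,
  so at most two are large. If both cells of a row are small, x has extreme weight; for a column, y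
  has; for a diagonal, the distance of x to y or to its complement is small. In a one-way protocol
  Bob cannot describe an extreme y, which is why columns need their own, linear, indexing bound: it
  turns a small column into an extreme x. The exponential bound for rows is harmless because it only
  limits the receiver's set: signatures need length logarithmic in the number of comparisons. In the
  distance case one coordinate shifts the normalised inner product by order 1/n, too little to
  detect; tensor powers of degree about n/D amplify this to order 1/D. Nobody knows in advance
  whether the weights are close, so Bob compares a signature of Alice's weight with the few weights
  that a near jump would allow, and falls back on the simulated public-coin protocol if none
  matches.\<close>

definition cell :: "bool \<Rightarrow> bool \<Rightarrow> bool list \<Rightarrow> bool list \<Rightarrow> nat" where
  "cell u v x y = count_list (zip x y) (u, v)"

abbreviation weight :: "bool list \<Rightarrow> nat" where
  "weight x \<equiv> count_list x True"

lemma cell_append: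
  assumes "length x = length y"
  shows "cell u v (x @ x') (y @ y') = cell u v x y + cell u v x' y'"
  using assms by (simp add: cell_def)

lemma count_list_replicate: "count_list (replicate n a) b = (if a = b then n else 0)"
  by (induction n) auto

lemma cell_replicate: "cell u v (replicate n a) (replicate n b) = (if a = u \<and> b = v then n else 0)"
  by (simp add: cell_def zip_replicate count_list_replicate)

lemma weight_eq_cells:
  assumes "length x = length y"
  shows "weight x = cell True True x y + cell True False x y"
    and "weight y = cell True True x y + cell False True x y"
    and "length x = cell True True x y + cell True False x y + cell False True x y + cell False False x y"
  using assms by (induction x y rule: list_induct2) (auto simp: cell_def)

lemma cell_eq_card:
  assumes "length x = n" "length y = n"
  shows "cell u v x y = card {i. i < n \<and> x ! i = u \<and> y ! i = v}"
  using assms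
  by (auto simp: cell_def count_list_eq_length_filter length_filter_conv_card intro!: arg_cong[where f=card])

lemma count_list_eq_card: "count_list x u = card {i. i < length x \<and> x ! i = u}"
  by (auto simp: count_list_eq_length_filter length_filter_conv_card intro!: arg_cong[where f=card])

lemma cell_map_Not:
  assumes "length x = length y"
  shows "cell u v (map Not x) y = cell (\<not> u) v x y"
    and "cell u v x (map Not y) = cell u (\<not> v) x y"
  using assms by (induction x y rule: list_induct2) (auto simp: cell_def)

text \<open>Length and weights turn the (1,1) count into all four counts. The lists of coordinate
  pairs are then equal as multisets, hence differ by a permutation of the coordinates.\<close>

lemma permutation_invariant_cong:
  assumes f: "permutation_invariant n f"
    and len: "length x = n" "length y = n" "length x' = n" "length y' = n"
    and w: "weight x = weight x'" "weight y = weight y'"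
    and c: "cell True True x y = cell True True x' y'"
  shows "f x y = f x' y'"
proof -
  have "cell u v x y = cell u v x' y'" for u v
    using weight_eq_cells[of x y] weight_eq_cells[of x' y'] len w c
    by (cases u; cases v) auto
  then have "count_list (zip x y) z = count_list (zip x' y') z" for z
    by (cases z) (simp add: cell_def)
  then have "mset (zip x y) = mset (zip x' y')"
    by (intro multiset_eqI) (simp add: count_mset)
  then obtain p where p: "p permutes {..<length (zip x' y')}"
      "permute_list p (zip x' y') = zip x y"
    using mset_eq_permutation by blast
  then have p': "p permutes {..<n}" using len by simp
  have "zip (permute_list p x') (permute_list p y') = zip x y"
    using p(2) permute_list_zip[OF p', of x' y'] len by simp
  then have "permute_list p x' = x" "permute_list p y' = y"
    using len by (metis length_permute_list map_fst_zip map_snd_zip)+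
  then show ?thesis
    using f p' len unfolding permutation_invariant_def by metis
qed

definition cells_val :: "(bool list \<Rightarrow> bool list \<Rightarrow> bool) \<Rightarrow> nat \<Rightarrow> nat \<Rightarrow> nat \<Rightarrow> nat \<Rightarrow> bool" where
  "cells_val f \<alpha> \<beta> \<gamma> \<delta> =
     f (replicate \<alpha> True @ replicate \<beta> True @ replicate \<gamma> False @ replicate \<delta> False)
       (replicate \<alpha> True @ replicate \<beta> False @ replicate \<gamma> True @ replicate \<delta> False)"

lemma cells_val_eq:
  assumes "permutation_invariant n f" "length x = n" "length y = n"
  shows "f x y = cells_val f (cell True True x y) (cell True False x y)
           (cell False True x y) (cell False False x y)"
  unfolding cells_val_def using assms weight_eq_cells[of x y]
  by (intro permutation_invariant_cong[OF assms(1)]) (auto simp: cell_append cell_replicate count_list_replicate)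

text \<open>The arguments count the coordinates on which the inputs are \<open>(1,1)\<close>, \<open>(1,0)\<close>, \<open>(0,1)\<close>,
  \<open>(0,0)\<close>, outside the two coordinates on which the neighbouring inputs differ.\<close>

definition jump :: "nat \<Rightarrow> (bool list \<Rightarrow> bool list \<Rightarrow> bool) \<Rightarrow> nat \<Rightarrow> nat \<Rightarrow> nat \<Rightarrow> nat \<Rightarrow> bool" where
  "jump n f \<alpha> \<beta> \<gamma> \<delta> \<longleftrightarrow> \<alpha> + \<beta> + \<gamma> + \<delta> + 2 = n \<and>
     cells_val f (Suc \<alpha>) \<beta> \<gamma> (Suc \<delta>) \<noteq> cells_val f \<alpha> (Suc \<beta>) (Suc \<gamma>) \<delta>"

lemma ex_step:
  fixes H :: "nat \<Rightarrow> bool"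
  assumes "c < c'" "H c \<noteq> H c'"
  shows "\<exists>i. c \<le> i \<and> i < c' \<and> H i \<noteq> H (Suc i)"
  using assms
proof (induction "c' - c" arbitrary: c')
  case (Suc d)
  then obtain e where e: "c' = Suc e" by (cases c') auto
  show ?case
  proof (cases "H e = H c'")
    case False
    then show ?thesis using Suc.prems e by (intro exI[of _ e]) auto
  next
    case True
    then have "c < e" "H c \<noteq> H e" using Suc.prems e by (auto simp: less_Suc_eq)
    moreover have "d = e - c" using Suc.hyps(2) e \<open>c < e\<close> by simp
    ultimately obtain i where "c \<le> i" "i < e" "H i \<noteq> H (Suc i)" using Suc.hyps(1)[of e] by blast
    then show ?thesis using e by (intro exI[of _ i]) simp
  qed
qed simp

text \<open>On the line of fixed weights the number of common ones determines the value, so two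
  different values force a change between consecutive numbers i and i + 1. The jump found has
  \<alpha> = i because its two differing coordinates are left out of the count.\<close>

lemma jump_between_aux:
  assumes f: "permutation_invariant n f"
    and len: "length x = n" "length y = n" "length x' = n" "length y' = n"
    and w: "weight x = weight x'" "weight y = weight y'"
    and ne: "f x y \<noteq> f x' y'" and c: "cell True True x y < cell True True x' y'"
  obtains \<alpha> \<beta> \<gamma> \<delta> where "jump n f \<alpha> \<beta> \<gamma> \<delta>" "\<alpha> + \<beta> + 1 = weight x" "\<alpha> + \<gamma> + 1 = weight y"
    "cell True True x y \<le> \<alpha>" "\<alpha> < cell True True x' y'"
proof -
  define a b where "a = weight x" and "b = weight y"
  \<comment> \<open>Truncated subtraction is exact for all counts that occur on this line.\<close>
  define H where "H c = cells_val f c (a - c) (b - c) (n + c - a - b)" for c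
  note cx = weight_eq_cells[of x y] and cx' = weight_eq_cells[of x' y']
  have 1: "f x y = H (cell True True x y)"
  proof -
    have "a - cell True True x y = cell True False x y" "b - cell True True x y = cell False True x y"
      "n + cell True True x y - a - b = cell False False x y"
      using cx len by (auto simp: a_def b_def)
    then show ?thesis unfolding H_def using cells_val_eq[OF f len(1,2)] by simp
  qed
  have 2: "f x' y' = H (cell True True x' y')"
  proof -
    have "a - cell True True x' y' = cell True False x' y'" "b - cell True True x' y' = cell False True x' y'"
      "n + cell True True x' y' - a - b = cell False False x' y'"
      using cx' len w by (auto simp: a_def b_def)
    then show ?thesis unfolding H_def using cells_val_eq[OF f len(3,4)] by simp
  qed
  obtain i where i: "cell True True x y \<le> i" "i < cell True True x' y'" "H i \<noteq> H (Suc i)"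
    using ex_step[OF c, of H] ne 1 2 by auto
  have ia: "Suc i \<le> a" "Suc i \<le> b" "a + b \<le> n + i"
    using i cx cx' len w by (auto simp: a_def b_def)
  then obtain \<beta> \<gamma> \<delta> where g: "a = Suc (i + \<beta>)" "b = Suc (i + \<gamma>)" "n + i = a + b + \<delta>"
    by (metis add_Suc le_Suc_ex)
  have eqs: "a - i = Suc \<beta>" "b - i = Suc \<gamma>" "n + i - a - b = \<delta>" "a - Suc i = \<beta>" "b - Suc i = \<gamma>"
    "n + Suc i - a - b = Suc \<delta>" "i + \<beta> + \<gamma> + \<delta> + 2 = n"
    using g by auto
  have "jump n f i \<beta> \<gamma> \<delta>"
    unfolding jump_def using i(3) eqs by (simp add: H_def)
  then show ?thesis using that i g unfolding a_def b_def by auto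
qed

lemma jump_between:
  assumes f: "permutation_invariant n f"
    and len: "length x = n" "length y = n" "length x' = n"
    and w: "weight x = weight x'"
    and ne: "f x y \<noteq> f x' y"
  obtains \<alpha> \<beta> \<gamma> \<delta> where "jump n f \<alpha> \<beta> \<gamma> \<delta>" "\<alpha> + \<beta> + 1 = weight x" "\<alpha> + \<gamma> + 1 = weight y"
    "min (cell True True x y) (cell True True x' y) \<le> \<alpha>"
    "\<alpha> < max (cell True True x y) (cell True True x' y)"
proof -
  have "cell True True x y \<noteq> cell True True x' y"
    using permutation_invariant_cong[OF f len(1,2,3,2) w refl] ne by auto
  then consider "cell True True x y < cell True True x' y" | "cell True True x' y < cell True True x y"
    by linarith
  then show ?thesis
  proof cases
    case 1
    then show ?thesis
      using jump_between_aux[OF f len(1,2,3,2) w refl ne 1] that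
      by (metis max.strict_coboundedI2 min.coboundedI1)
  next
    case 2
    then show ?thesis
      using jump_between_aux[OF f len(3,2,1,2) w[symmetric] refl ne[symmetric] 2] that w
      by (metis max.strict_coboundedI1 min.coboundedI2)
  qed
qed

section \<open>Relabelling and swapping the players\<close>

fun relabel :: "(bool list \<Rightarrow> bool list) \<Rightarrow> (bool list \<Rightarrow> bool list) \<Rightarrow> protocol \<Rightarrow> protocol" where
  "relabel \<phi> \<psi> (Alice_Outputs h) = Alice_Outputs (\<lambda>x. h (\<phi> x))"
| "relabel \<phi> \<psi> (Bob_Outputs h) = Bob_Outputs (\<lambda>y. h (\<psi> y))"
| "relabel \<phi> \<psi> (Alice_Sends h P Q) = Alice_Sends (\<lambda>x. h (\<phi> x)) (relabel \<phi> \<psi> P) (relabel \<phi> \<psi> Q)"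
| "relabel \<phi> \<psi> (Bob_Sends h P Q) = Bob_Sends (\<lambda>y. h (\<psi> y)) (relabel \<phi> \<psi> P) (relabel \<phi> \<psi> Q)"

lemma relabel_simps [simp]:
  "run (relabel \<phi> \<psi> P) x y r s = run P (\<phi> x) (\<psi> y) r s"
  "cost (relabel \<phi> \<psi> P) = cost P"
  "one_way (relabel \<phi> \<psi> P) = one_way P"
  by (induction P) auto

lemma measurable_relabel: "measurable_protocol P \<Longrightarrow> measurable_protocol (relabel \<phi> \<psi> P)"
  by (induction P) auto

fun swap_players :: "protocol \<Rightarrow> protocol" where
  "swap_players (Alice_Outputs h) = Bob_Outputs h"
| "swap_players (Bob_Outputs h) = Alice_Outputs h"
| "swap_players (Alice_Sends h P Q) = Bob_Sends h (swap_players P) (swap_players Q)"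
| "swap_players (Bob_Sends h P Q) = Alice_Sends h (swap_players P) (swap_players Q)"

lemma swap_players_simps [simp]:
  "run (swap_players P) x y r s = run P y x s r"
  "cost (swap_players P) = cost P"
  "measurable_protocol (swap_players P) = measurable_protocol P"
  by (induction P) auto

section \<open>Public randomness\<close>

definition coins :: "bits measure" where
  "coins = (\<Pi>\<^sub>M i\<in>UNIV. measure_pmf (bernoulli_pmf (1/2)))"

lemma prob_space_coins: "prob_space coins"
proof -
  interpret product_prob_space "\<lambda>_. measure_pmf (bernoulli_pmf (1/2))" "UNIV :: nat set"
    by unfold_locales
  show ?thesis unfolding coins_def by unfold_locales
qed

lemma sets_coins [measurable_cong]: "sets coins = sets bits_space"
  unfolding coins_def bits_space_def by (intro sets_PiM_cong) auto

lemma space_bits_space [simp]: "space bits_space = UNIV"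
  by (simp add: bits_space_def space_PiM)

lemma space_coins [simp]: "space coins = UNIV"
  by (simp add: coins_def space_PiM)

lemma measurable_run:
  "measurable_protocol P \<Longrightarrow> Measurable.pred (bits_space \<Otimes>\<^sub>M bits_space) (\<lambda>z. run P x y (fst z) (snd z))"
proof (induction P)
  case (Alice_Outputs h)
  then have [measurable]: "Measurable.pred bits_space (h x)" by simp
  show ?case by simp
next
  case (Bob_Outputs h)
  then have [measurable]: "Measurable.pred bits_space (h y)" by simp
  show ?case by simp
next
  case (Alice_Sends h P Q)
  then have [measurable]: "Measurable.pred bits_space (h x)"
    "Measurable.pred (bits_space \<Otimes>\<^sub>M bits_space) (\<lambda>z. run P x y (fst z) (snd z))"
    "Measurable.pred (bits_space \<Otimes>\<^sub>M bits_space) (\<lambda>z. run Q x y (fst z) (snd z))" by simp_all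
  show ?case by simp
next
  case (Bob_Sends h P Q)
  then have [measurable]: "Measurable.pred bits_space (h y)"
    "Measurable.pred (bits_space \<Otimes>\<^sub>M bits_space) (\<lambda>z. run P x y (fst z) (snd z))"
    "Measurable.pred (bits_space \<Otimes>\<^sub>M bits_space) (\<lambda>z. run Q x y (fst z) (snd z))" by simp_all
  show ?case by simp
qed

lemma measurable_run_coins:
  assumes "measurable_protocol P"
  shows "Measurable.pred coins (\<lambda>r. run P x y r r)"
  using measurable_compose[OF measurable_Pair[OF measurable_ident measurable_ident] measurable_run[OF assms, of x y]]
  by (simp add: measurable_cong_sets[OF sets_coins refl])

definition accept :: "protocol \<Rightarrow> bool list \<Rightarrow> bool list \<Rightarrow> real" where
  "accept P x y = (\<integral>r. of_bool (run P x y r r) \<partial>coins)"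

lemma integrable_run:
  assumes "measurable_protocol P"
  shows "integrable coins (\<lambda>r. of_bool (run P x y r r) :: real)"
proof -
  interpret prob_space coins by (rule prob_space_coins)
  note [measurable] = measurable_run_coins[OF assms]
  show ?thesis by (rule integrable_const_bound[of _ 1]) auto
qed

lemma accept_eq:
  assumes "measurable_protocol P"
  shows "accept P x y = measure coins {r. run P x y r r}"
proof -
  interpret prob_space coins by (rule prob_space_coins)
  have "accept P x y = (\<integral>r. indicator {r. run P x y r r} r \<partial>coins)"
    unfolding accept_def by (intro Bochner_Integration.integral_cong) (auto simp: indicator_def)
  also have "\<dots> = measure coins {r. run P x y r r}"
    using measurable_run_coins[OF assms, of x y] by (simp add: pred_def)
  finally show ?thesis .
qed

lemma prob_public:
  assumes "measurable_protocol P"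
  shows "\<P>((r, s) in public_randomness. run P x y r s = v) = measure coins {r. run P x y r r = v}"
proof -
  have m: "(\<lambda>r. (r, r)) \<in> coins \<rightarrow>\<^sub>M bits_space \<Otimes>\<^sub>M bits_space"
    by (intro measurable_Pair) (simp_all add: measurable_cong_sets[OF sets_coins refl])
  have p: "Measurable.pred (bits_space \<Otimes>\<^sub>M bits_space) (\<lambda>z. run P x y (fst z) (snd z) = v)"
    using measurable_run[OF assms, of x y] by (cases v) auto
  show ?thesis
    unfolding public_randomness_def coins_def[symmetric]
    using p by (subst measure_distr[OF m])
      (auto simp: pred_def case_prod_unfold space_pair_measure intro!: arg_cong[where f="measure coins"])
qed

lemma accept_computes:
  assumes P: "measurable_protocol P" "computes public_randomness n f P"
    and len: "length x = n" "length y = n"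
  shows "f x y \<Longrightarrow> accept P x y \<ge> 2/3" "\<not> f x y \<Longrightarrow> accept P x y \<le> 1/3"
proof -
  interpret prob_space coins by (rule prob_space_coins)
  have c: "measure coins {r. run P x y r r = f x y} \<ge> 2/3"
    using P(2)[unfolded computes_def, rule_format, OF len] unfolding prob_public[OF P(1)] .
  show "f x y \<Longrightarrow> accept P x y \<ge> 2/3" using c by (simp add: accept_eq[OF P(1)])
  have "{r. run P x y r r} \<in> events"
    using measurable_run_coins[OF P(1), of x y] by (simp add: pred_def)
  then have "measure coins (UNIV - {r. run P x y r r}) = 1 - measure coins {r. run P x y r r}"
    using prob_compl by simp
  moreover have "UNIV - {r. run P x y r r} = {r. \<not> run P x y r r}" by auto
  ultimately show "\<not> f x y \<Longrightarrow> accept P x y \<le> 1/3" using c by (simp add: accept_eq[OF P(1)])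
qed

lemma accept_bounds: "measurable_protocol P \<Longrightarrow> 0 \<le> accept P x y \<and> accept P x y \<le> 1"
  using prob_space.prob_le_1[OF prob_space_coins] by (simp add: accept_eq)

text \<open>A protocol of cost \<open>c\<close> partitions the inputs into \<open>2^c\<close> rectangles, on each of which the
  output is a product of a function of \<open>x\<close> and a function of \<open>y\<close>.\<close>

lemma protocol_rectangle_bound:
  fixes N :: "(bool list \<Rightarrow> bool list \<Rightarrow> real) \<Rightarrow> real"
  assumes sub: "\<And>F G. N (\<lambda>x y. F x y + G x y) \<le> N F + N G"
    and rect: "\<And>F G. (\<And>x. 0 \<le> F x \<and> F x \<le> 1) \<Longrightarrow> (\<And>y. 0 \<le> G y \<and> G y \<le> 1) \<Longrightarrow>
      N (\<lambda>x y. F x * G y) \<le> \<eta>"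
    and F: "\<And>x. 0 \<le> F x \<and> F x \<le> 1" and G: "\<And>y. 0 \<le> G y \<and> G y \<le> 1" and \<eta>: "\<eta> \<ge> 0"
  shows "N (\<lambda>x y. F x * G y * of_bool (run P x y r s)) \<le> 2 ^ cost P * \<eta>"
  using F G
proof (induction P arbitrary: F G)
  case (Alice_Outputs h)
  have "N (\<lambda>x y. F x * G y * of_bool (run (Alice_Outputs h) x y r s)) =
      N (\<lambda>x y. (F x * of_bool (h x r)) * G y)"
    by (intro arg_cong[where f=N]) (auto intro!: ext)
  also have "\<dots> \<le> \<eta>" using Alice_Outputs by (intro rect) (auto intro: mult_le_one)
  finally show ?case by simp
next
  case (Bob_Outputs h)
  have "N (\<lambda>x y. F x * G y * of_bool (run (Bob_Outputs h) x y r s)) =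
      N (\<lambda>x y. F x * (G y * of_bool (h y s)))"
    by (intro arg_cong[where f=N]) (auto intro!: ext)
  also have "\<dots> \<le> \<eta>" using Bob_Outputs by (intro rect) (auto intro: mult_le_one)
  finally show ?case by simp
next
  case (Alice_Sends h P Q)
  let ?m = "max (cost P) (cost Q)"
  have "N (\<lambda>x y. F x * G y * of_bool (run (Alice_Sends h P Q) x y r s)) =
      N (\<lambda>x y. (F x * of_bool (h x r)) * G y * of_bool (run P x y r s) +
               (F x * of_bool (\<not> h x r)) * G y * of_bool (run Q x y r s))"
    by (intro arg_cong[where f=N]) (auto intro!: ext)
  also have "\<dots> \<le> 2 ^ cost P * \<eta> + 2 ^ cost Q * \<eta>"
    using Alice_Sends.prems
    by (intro order.trans[OF sub] add_mono Alice_Sends.IH) (auto intro: mult_le_one)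
  also have "\<dots> \<le> 2 ^ ?m * \<eta> + 2 ^ ?m * \<eta>"
    using \<eta> by (intro add_mono mult_right_mono power_increasing) auto
  finally show ?case by (simp add: algebra_simps)
next
  case (Bob_Sends h P Q)
  let ?m = "max (cost P) (cost Q)"
  have "N (\<lambda>x y. F x * G y * of_bool (run (Bob_Sends h P Q) x y r s)) =
      N (\<lambda>x y. F x * (G y * of_bool (h y s)) * of_bool (run P x y r s) +
               F x * (G y * of_bool (\<not> h y s)) * of_bool (run Q x y r s))"
    by (intro arg_cong[where f=N]) (auto intro!: ext)
  also have "\<dots> \<le> 2 ^ cost P * \<eta> + 2 ^ cost Q * \<eta>"
    using Bob_Sends.prems
    by (intro order.trans[OF sub] add_mono Bob_Sends.IH) (auto intro: mult_le_one)
  also have "\<dots> \<le> 2 ^ ?m * \<eta> + 2 ^ ?m * \<eta>"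
    using \<eta> by (intro add_mono mult_right_mono power_increasing) auto
  finally show ?case by (simp add: algebra_simps)
qed

corollary protocol_rectangle_bound':
  fixes N :: "(bool list \<Rightarrow> bool list \<Rightarrow> real) \<Rightarrow> real"
  assumes sub: "\<And>F G. N (\<lambda>x y. F x y + G x y) \<le> N F + N G"
    and rect: "\<And>F G. (\<And>x. 0 \<le> F x \<and> F x \<le> 1) \<Longrightarrow> (\<And>y. 0 \<le> G y \<and> G y \<le> 1) \<Longrightarrow>
      N (\<lambda>x y. F x * G y) \<le> \<eta>"
    and \<eta>: "\<eta> \<ge> 0"
  shows "N (\<lambda>x y. of_bool (run P x y r s)) \<le> 2 ^ cost P * \<eta>"
proof -
  have "N (\<lambda>x y. 1 * 1 * of_bool (run P x y r s)) \<le> 2 ^ cost P * \<eta>"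
    by (rule protocol_rectangle_bound[of N \<eta> "\<lambda>_. 1" "\<lambda>_. 1", OF sub rect _ _ \<eta>]) auto
  then show ?thesis by simp
qed

section \<open>A polynomial bounded on an interval has polynomially bounded derivative\<close>

text \<open>Even trigonometric polynomials of degree at most D: a Chebyshev expansion written in the
  angle variable.\<close>

definition cos_sum :: "nat \<Rightarrow> (real \<Rightarrow> real) \<Rightarrow> bool" where
  "cos_sum D F \<longleftrightarrow> (\<exists>c. \<forall>\<theta>. F \<theta> = (\<Sum>j\<le>D. c j * cos (real j * \<theta>)))"

lemma cos_sum_add: "cos_sum D F \<Longrightarrow> cos_sum D G \<Longrightarrow> cos_sum D (\<lambda>\<theta>. F \<theta> + G \<theta>)"
  unfolding cos_sum_def
proof clarify
  fix c d
  assume "\<forall>\<theta>. F \<theta> = (\<Sum>j\<le>D. c j * cos (real j * \<theta>))" "\<forall>\<theta>. G \<theta> = (\<Sum>j\<le>D. d j * cos (real j * \<theta>))"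
  then show "\<exists>e. \<forall>\<theta>. F \<theta> + G \<theta> = (\<Sum>j\<le>D. e j * cos (real j * \<theta>))"
    by (intro exI[of _ "\<lambda>j. c j + d j"]) (simp add: sum.distrib algebra_simps)
qed

lemma cos_sum_scale: "cos_sum D F \<Longrightarrow> cos_sum D (\<lambda>\<theta>. a * F \<theta>)"
  unfolding cos_sum_def
proof clarify
  fix c
  assume "\<forall>\<theta>. F \<theta> = (\<Sum>j\<le>D. c j * cos (real j * \<theta>))"
  then show "\<exists>e. \<forall>\<theta>. a * F \<theta> = (\<Sum>j\<le>D. e j * cos (real j * \<theta>))"
    by (intro exI[of _ "\<lambda>j. a * c j"]) (simp add: sum_distrib_left algebra_simps)
qed

lemma cos_sum_cos: "j \<le> D \<Longrightarrow> cos_sum D (\<lambda>\<theta>. cos (real j * \<theta>))"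
  unfolding cos_sum_def
  by (intro exI[of _ "\<lambda>i. if i = j then 1 else 0"]) (simp add: mult_delta_left)

lemma cos_sum_sum: "finite S \<Longrightarrow> (\<And>j. j \<in> S \<Longrightarrow> cos_sum D (F j)) \<Longrightarrow> cos_sum D (\<lambda>\<theta>. \<Sum>j\<in>S. F j \<theta>)"
proof (induction S rule: finite_induct)
  case empty
  show ?case unfolding cos_sum_def by (intro exI[of _ "\<lambda>_. 0"]) simp
qed (simp add: cos_sum_add)

text \<open>Product-to-sum: multiplying by cos \<theta> turns frequency j into j + 1 and j - 1; only
  j = 0 is special.\<close>

lemma cos_sum_times_cos:
  assumes "cos_sum D F"
  shows "cos_sum (Suc D) (\<lambda>\<theta>. cos \<theta> * F \<theta>)"
proof -
  obtain c where c: "F \<theta> = (\<Sum>j\<le>D. c j * cos (real j * \<theta>))" for \<theta>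
    using assms unfolding cos_sum_def by blast
  have "cos_sum (Suc D) (\<lambda>\<theta>. c j * (cos \<theta> * cos (real j * \<theta>)))" if "j \<le> D" for j
  proof (rule cos_sum_scale, cases j)
    case 0
    then show "cos_sum (Suc D) (\<lambda>\<theta>. cos \<theta> * cos (real j * \<theta>))"
      using cos_sum_cos[of 1 "Suc D"] by simp
  next
    case (Suc i)
    have "cos \<theta> * cos (real j * \<theta>) = 1/2 * cos (real (Suc j) * \<theta>) + 1/2 * cos (real i * \<theta>)" for \<theta> :: real
      using cos_times_cos[of "real j * \<theta>" \<theta>] Suc by (simp add: algebra_simps add_divide_distrib)
    then show "cos_sum (Suc D) (\<lambda>\<theta>. cos \<theta> * cos (real j * \<theta>))"
      using that Suc by (simp only:) (intro cos_sum_add cos_sum_scale cos_sum_cos; simp)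
  qed
  then have "cos_sum (Suc D) (\<lambda>\<theta>. \<Sum>j\<le>D. c j * (cos \<theta> * cos (real j * \<theta>)))"
    by (intro cos_sum_sum) auto
  then show ?thesis by (simp add: c sum_distrib_left mult_ac)
qed

lemma cos_sum_poly: "degree p \<le> D \<Longrightarrow> cos_sum D (\<lambda>\<theta>. poly p (cos \<theta>))"
proof (induction D arbitrary: p)
  case 0
  then obtain a where "p = [:a:]" using degree_eq_zeroE by blast
  then show ?case unfolding cos_sum_def by (intro exI[of _ "\<lambda>_. a"]) simp
next
  case (Suc D)
  obtain a q where p: "p = pCons a q" by (cases p)
  have "degree q \<le> D" using Suc.prems p by (cases "q = 0") auto
  then have "cos_sum (Suc D) (\<lambda>\<theta>. a * cos (real 0 * \<theta>) + cos \<theta> * poly q (cos \<theta>))"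
    by (intro cos_sum_add cos_sum_scale cos_sum_cos cos_sum_times_cos Suc.IH) auto
  then show ?case by (simp add: p)
qed

section \<open>Discrete orthogonality of cosines at equally spaced nodes\<close>

lemma sum_cos_nodes:
  assumes "0 < k" "k < N"
  shows "(\<Sum>l<N. cos (real k * (2 * pi * real l / real N))) = 0"
proof -
  define \<phi> where "\<phi> = 2 * pi * real k / real N"
  have \<phi>: "0 < \<phi>" "\<phi> < 2 * pi" using assms by (auto simp: \<phi>_def field_simps)
  \<comment> \<open>The half-angle lies strictly between 0 and pi, so cis \<phi> differs from 1 and
    the geometric sum applies.\<close>
  have "sin (\<phi> / 2) > 0" using \<phi> by (intro sin_gt_zero) auto
  then have "cos \<phi> \<noteq> 1" using cos_double_sin[of "\<phi> / 2"] by auto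
  then have ne: "cis \<phi> \<noteq> 1" by (metis cis.simps(1) one_complex.simps(1))
  have "real N * \<phi> = 2 * pi * real k" using assms by (simp add: \<phi>_def)
  then have "cis \<phi> ^ N = cis (2 * pi * real k)" by (subst Complex.DeMoivre) simp
  also have "\<dots> = 1" by (simp add: cis_multiple_2pi)
  finally have "(\<Sum>l<N. cis \<phi> ^ l) = 0" using geometric_sum[OF ne] by simp
  then have "Re (\<Sum>l<N. cis (real l * \<phi>)) = 0" by (simp add: Complex.DeMoivre)
  then show ?thesis by (simp add: \<phi>_def mult_ac)
qed

text \<open>The product splits into the frequencies |i - j| and i + j. Both are at most 2D, so with
  2D + 1 nodes only frequency 0 survives.\<close>

lemma sum_cos_cos_nodes:
  assumes "i \<le> D" "j \<le> D"
  shows "(\<Sum>l<2*D+1. cos (real j * (2 * pi * real l / real (2*D+1))) * cos (real i * (2 * pi * real l / real (2*D+1))))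
    = real (2*D+1) / 2 * (of_bool (i = j) + of_bool (i + j = 0))"
proof -
  define \<theta> where "\<theta> l = 2 * pi * real l / real (2*D+1)" for l
  have eq: "cos (real j * \<theta> l) * cos (real i * \<theta> l)
     = 1/2 * cos (real (max i j - min i j) * \<theta> l) + 1/2 * cos (real (i + j) * \<theta> l)" for l
  proof (cases "i \<le> j")
    case True
    then show ?thesis using cos_times_cos[of "real j * \<theta> l" "real i * \<theta> l"]
      by (simp add: algebra_simps add_divide_distrib of_nat_diff)
  next
    case False
    then show ?thesis using cos_times_cos[of "real i * \<theta> l" "real j * \<theta> l"]
      by (simp add: algebra_simps add_divide_distrib of_nat_diff)
  qed
  have 1: "(\<Sum>l<2*D+1. cos (real k * \<theta> l)) = real (2*D+1) * of_bool (k = 0)" if "k < 2*D+1" for k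
    using sum_cos_nodes[of k "2*D+1"] that by (cases "k = 0") (simp_all add: \<theta>_def)
  have "(\<Sum>l<2*D+1. cos (real j * \<theta> l) * cos (real i * \<theta> l)) =
     1/2 * (\<Sum>l<2*D+1. cos (real (max i j - min i j) * \<theta> l)) + 1/2 * (\<Sum>l<2*D+1. cos (real (i + j) * \<theta> l))"
    unfolding eq by (simp only: sum.distrib sum_distrib_left)
  also have "\<dots> = 1/2 * (real (2*D+1) * of_bool (max i j - min i j = 0)) + 1/2 * (real (2*D+1) * of_bool (i + j = 0))"
    using assms by (subst (1 2) 1) auto
  also have "(max i j - min i j = 0) = (i = j)" by (auto simp: max_def min_def)
  finally show ?thesis unfolding \<theta>_def by (simp add: algebra_simps)
qed

section \<open>A Markov-type inequality at the end point\<close>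

lemma abs_sin_multiple: "\<bar>sin (real j * \<theta>)\<bar> \<le> real j * \<bar>sin \<theta>\<bar>"
proof (induction j)
  case (Suc j)
  have "\<bar>sin (real (Suc j) * \<theta>)\<bar> = \<bar>sin (real j * \<theta>) * cos \<theta> + cos (real j * \<theta>) * sin \<theta>\<bar>"
    by (simp add: algebra_simps sin_add)
  also have "\<dots> \<le> \<bar>sin (real j * \<theta>)\<bar> * \<bar>cos \<theta>\<bar> + \<bar>cos (real j * \<theta>)\<bar> * \<bar>sin \<theta>\<bar>"
    by (rule order.trans[OF abs_triangle_ineq]) (simp add: abs_mult)
  also have "\<dots> \<le> \<bar>sin (real j * \<theta>)\<bar> * 1 + 1 * \<bar>sin \<theta>\<bar>"
    by (intro add_mono mult_mono) auto
  finally show ?case using Suc by (simp add: algebra_simps)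
qed simp

text \<open>A cubic substitute for Markov's quadratic bound: orthogonality at the nodes bounds every
  cosine coefficient by 2B, and differentiating in the angle produces j sin(jt) / sin t, which is at
  most j^2 in absolute value.\<close>

lemma weak_markov:
  fixes p :: "real poly"
  assumes deg: "degree p \<le> D" and B: "\<And>x. -1 \<le> x \<Longrightarrow> x \<le> 1 \<Longrightarrow> \<bar>poly p x\<bar> \<le> B"
  shows "\<bar>poly (pderiv p) 1\<bar> \<le> 2 * B * (real D + 1) ^ 3"
proof -
  obtain c where c: "poly p (cos \<theta>) = (\<Sum>j\<le>D. c j * cos (real j * \<theta>))" for \<theta>
    using cos_sum_poly[OF deg] unfolding cos_sum_def by blast
  define N where "N = 2*D+1"
  define \<theta> where "\<theta> l = 2 * pi * real l / real N" for l
  have N0: "real N > 0" by (simp add: N_def)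
  have B0: "B \<ge> 0" using B[of 0] by linarith
  have cb: "\<bar>c i\<bar> \<le> 2 * B" if i: "i \<le> D" for i
  proof -
    have "(\<Sum>l<N. poly p (cos (\<theta> l)) * cos (real i * \<theta> l)) =
        (\<Sum>l<N. \<Sum>j\<le>D. c j * (cos (real j * \<theta> l) * cos (real i * \<theta> l)))"
      unfolding c by (simp add: sum_distrib_right mult.assoc)
    also have "\<dots> = (\<Sum>j\<le>D. c j * (\<Sum>l<N. cos (real j * \<theta> l) * cos (real i * \<theta> l)))"
      by (subst sum.swap) (simp add: sum_distrib_left)
    also have "\<dots> = (\<Sum>j\<le>D. c j * (real N / 2 * (of_bool (i = j) + of_bool (i + j = 0))))"
      using i unfolding \<theta>_def N_def by (intro sum.cong refl arg_cong2[where f="(*)"] sum_cos_cos_nodes) auto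
    also have "\<dots> = (\<Sum>j\<le>D. if j = i then c i * (real N / 2 * (1 + of_bool (i = 0))) else 0)"
      by (intro sum.cong) auto
    also have "\<dots> = c i * (real N / 2 * (1 + of_bool (i = 0)))" using i by simp
    finally have eq: "c i * (real N / 2 * (1 + of_bool (i = 0))) = (\<Sum>l<N. poly p (cos (\<theta> l)) * cos (real i * \<theta> l))"
      by simp
    have "\<bar>c i\<bar> * (real N / 2) \<le> \<bar>c i\<bar> * (real N / 2 * (1 + of_bool (i = 0)))"
      using N0 by (intro mult_left_mono) auto
    also have "\<dots> = \<bar>\<Sum>l<N. poly p (cos (\<theta> l)) * cos (real i * \<theta> l)\<bar>"
      unfolding eq[symmetric] using N0 by (simp add: abs_mult)
    also have "\<dots> \<le> (\<Sum>l<N. B * 1)"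
      by (intro order.trans[OF sum_abs] sum_mono, unfold abs_mult, intro mult_mono B B0) auto
    finally show ?thesis using N0 by (simp add: field_simps)
  qed
  define S where "S = (\<Sum>j\<le>D. \<bar>c j\<bar> * real j ^ 2)"
  have int: "\<bar>poly (pderiv p) (cos t)\<bar> \<le> S" if t: "0 < t" "t < pi" for t
  proof -
    have d1: "((\<lambda>t. poly p (cos t)) has_real_derivative (poly (pderiv p) (cos t) * - sin t)) (at t)"
      by (rule DERIV_chain2[OF poly_DERIV]) (auto intro!: derivative_eq_intros)
    have d2: "((\<lambda>t. \<Sum>j\<le>D. c j * cos (real j * t)) has_real_derivative (\<Sum>j\<le>D. c j * (- sin (real j * t) * real j))) (at t)"
      by (auto intro!: derivative_eq_intros sum.cong)
    have "poly (pderiv p) (cos t) * - sin t = (\<Sum>j\<le>D. c j * (- sin (real j * t) * real j))"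
      using DERIV_unique[OF d1] d2 unfolding c by blast
    then have "\<bar>poly (pderiv p) (cos t)\<bar> * \<bar>sin t\<bar> = \<bar>\<Sum>j\<le>D. c j * (- sin (real j * t) * real j)\<bar>"
      by (metis abs_minus_cancel abs_mult)
    also have "\<dots> \<le> (\<Sum>j\<le>D. \<bar>c j\<bar> * (real j * \<bar>sin t\<bar>) * real j)"
      by (intro order.trans[OF sum_abs] sum_mono)
         (unfold abs_mult abs_minus_cancel abs_of_nat mult.assoc[symmetric], intro mult_right_mono, unfold mult.assoc, intro mult_left_mono abs_sin_multiple, auto)
    also have "\<dots> = S * \<bar>sin t\<bar>" by (simp add: S_def sum_distrib_left sum_distrib_right power2_eq_square mult_ac)
    finally show ?thesis using sin_gt_zero[OF t] by simp
  qed
  \<comment> \<open>The substitution x = cos t is singular at t = 0, so the end point is reached as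
    a limit.\<close>
  have lim: "((\<lambda>t. \<bar>poly (pderiv p) (cos t)\<bar>) \<longlongrightarrow> \<bar>poly (pderiv p) (cos 0)\<bar>) (at_right 0)"
    by (intro tendsto_intros)
  have ev: "eventually (\<lambda>t. \<bar>poly (pderiv p) (cos t)\<bar> \<le> S) (at_right 0)"
    unfolding eventually_at_right_field using int pi_gt_zero by blast
  have "\<bar>poly (pderiv p) 1\<bar> \<le> S"
    using tendsto_upperbound[OF lim ev] by simp
  also have "S \<le> (\<Sum>j\<le>D. 2 * B * (real D + 1) ^ 2)"
    unfolding S_def using cb B0 by (intro sum_mono mult_mono power_mono) auto
  also have "\<dots> = 2 * B * (real D + 1) ^ 3" by (simp add: power3_eq_cube power2_eq_square algebra_simps)
  finally show ?thesis .
qed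

section \<open>Cutting off the terms of high degree\<close>

lemma sum_arith_half_powers:
  "(\<Sum>s<n. (real k + 1 + real s) * (1/2) ^ s) = 2 * (real k + 2) - (2 * (real k + 2) + 2 * real n) * (1/2) ^ n"
proof (induction n)
  case (Suc n)
  show ?case unfolding sum.lessThan_Suc Suc.IH by (simp add: field_simps)
qed simp

lemma poly_eq_sum_lessThan:
  fixes p :: "real poly"
  assumes "degree p < N"
  shows "poly p x = (\<Sum>t<N. coeff p t * x ^ t)"
proof -
  have "(\<Sum>t<N. coeff p t * x ^ t) = (\<Sum>t\<le>degree p. coeff p t * x ^ t)"
    using assms by (intro sum.mono_neutral_right) (auto simp: coeff_eq_0)
  then show ?thesis by (simp add: poly_altdef)
qed

lemma sum_drop_zeros:
  fixes f :: "nat \<Rightarrow> 'a::comm_monoid_add"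
  assumes "\<And>t. t < k \<Longrightarrow> f t = 0"
  shows "(\<Sum>t<k + N. f t) = (\<Sum>s<N. f (s + k))"
proof -
  have "(\<Sum>t<k + N. f t) = (\<Sum>t\<in>{0 + k..<N + k}. f t)"
    using assms by (intro sum.mono_neutral_right) auto
  also have "\<dots> = (\<Sum>s\<in>{0..<N}. f (s + k))" by (rule sum.shift_bounds_nat_ivl)
  finally show ?thesis by (simp add: atLeast0LessThan)
qed

text \<open>On \<open>[-1/2, 1/2]\<close> the terms of degree above \<open>k\<close> are negligible, so the bound of
  \<open>weak_markov\<close> for degree \<open>k\<close> applies.\<close>

lemma derivative_bound_from_coeffs:
  fixes p :: "real poly"
  assumes co: "\<And>t. \<bar>coeff p t\<bar> \<le> 2 ^ k" and
    bd: "\<And>x. \<bar>x\<bar> \<le> 1/2 \<Longrightarrow> \<bar>poly p x\<bar> \<le> 1"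
  shows "\<bar>poly (pderiv p) (-1/2)\<bar> \<le> 12 * (real k + 1) ^ 3"
proof -
  define q where "q = poly_cutoff (Suc k) p"
  define r where "r = p - q"
  have cq: "coeff q t = (if t \<le> k then coeff p t else 0)" for t
    unfolding q_def by (simp add: coeff_poly_cutoff less_Suc_eq_le)
  have cr: "coeff r t = (if t \<le> k then 0 else coeff p t)" for t by (simp add: r_def cq)
  define N where "N = Suc (degree r)"
  have r1: "\<bar>poly r x\<bar> \<le> 1" if x: "\<bar>x\<bar> \<le> 1/2" for x
  proof -
    have "poly r x = (\<Sum>t<Suc k + N. coeff r t * x ^ t)"
      by (rule poly_eq_sum_lessThan) (simp add: N_def)
    also have "\<dots> = (\<Sum>s<N. coeff r (s + Suc k) * x ^ (s + Suc k))"
      by (rule sum_drop_zeros) (simp add: cr)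
    also have "\<bar>\<dots>\<bar> \<le> (\<Sum>s<N. 2 ^ k * (1/2) ^ (s + Suc k))"
      using x by (intro order.trans[OF sum_abs] sum_mono)
        (auto simp: abs_mult power_abs cr simp del: power_Suc intro!: mult_mono co power_mono)
    also have "\<dots> = (\<Sum>s<N. (1/2) ^ Suc s)"
      by (intro sum.cong) (auto simp: power_add power_divide)
    also have "\<dots> = 1 - (1/2) ^ N"
      by (induction N) (auto simp: field_simps)
    also have "\<dots> \<le> 1" by simp
    finally show ?thesis .
  qed
  have r2: "\<bar>poly (pderiv r) x\<bar> \<le> 2 * (real k + 2)" if x: "\<bar>x\<bar> \<le> 1/2" for x
  proof -
    have dg: "degree (pderiv r) < k + N"
      by (simp add: degree_pderiv N_def)
    have "poly (pderiv r) x = (\<Sum>t<k + N. coeff (pderiv r) t * x ^ t)"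
      by (rule poly_eq_sum_lessThan[OF dg])
    also have "\<dots> = (\<Sum>s<N. coeff (pderiv r) (s + k) * x ^ (s + k))"
      by (rule sum_drop_zeros) (simp add: cr coeff_pderiv)
    also have "\<bar>\<dots>\<bar> \<le> (\<Sum>s<N. ((real k + 1 + real s) * 2 ^ k) * (1/2) ^ (s + k))"
      using x by (intro order.trans[OF sum_abs] sum_mono)
        (auto simp: abs_mult power_abs coeff_pderiv cr simp del: power_Suc intro!: mult_mono co power_mono)
    also have "\<dots> = (\<Sum>s<N. (real k + 1 + real s) * (1/2) ^ s)"
      by (intro sum.cong) (auto simp: power_add power_divide)
    also have "\<dots> \<le> 2 * (real k + 2)"
      unfolding sum_arith_half_powers by simp
    finally show ?thesis .
  qed
  \<comment> \<open>The substitution x to -x/2 maps [-1, 1] onto [-1/2, 1/2] and the end point 1 to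
    -1/2. The bound 2 is 1 for p plus 1 for the tail; the inner derivative -1/2 doubles the
    resulting 4 (k + 1)^3, and the tail adds at most another 4 (k + 1)^3.\<close>
  define p' where "p' = pcompose q [:0, -1/2:]"
  have "degree q \<le> k" by (rule degree_le) (simp add: cq)
  then have deg: "degree p' \<le> k" unfolding p'_def by (simp add: degree_pcompose)
  have "\<bar>poly p' x\<bar> \<le> 2" if "-1 \<le> x" "x \<le> 1" for x
  proof -
    have h: "\<bar>- (x / 2)\<bar> \<le> 1/2" using that by auto
    have "poly p' x = poly p (- (x/2)) - poly r (- (x/2))"
      by (simp add: p'_def poly_pcompose r_def)
    then show ?thesis using bd[OF h] r1[OF h] by linarith
  qed
  from weak_markov[OF deg this]
  have "\<bar>poly (pderiv p') 1\<bar> \<le> 4 * (real k + 1) ^ 3" by simp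
  moreover have "poly (pderiv p') 1 = poly (pderiv q) (-1/2) * (-1/2)"
    unfolding p'_def by (simp add: pderiv_pcompose poly_pcompose pderiv_pCons)
  ultimately have "\<bar>poly (pderiv q) (-1/2)\<bar> \<le> 8 * (real k + 1) ^ 3" by (simp add: abs_mult)
  moreover have "poly (pderiv p) (-1/2) = poly (pderiv q) (-1/2) + poly (pderiv r) (-1/2)"
    by (simp add: r_def pderiv_diff)
  moreover have "\<bar>poly (pderiv r) (-1/2)\<bar> \<le> 2 * (real k + 2)" by (rule r2) simp
  moreover have "2 * (real k + 2) \<le> 4 * (real k + 1) ^ 3"
  proof -
    have "real k + 1 \<le> (real k + 1) ^ 3" by (rule self_le_power) auto
    then show ?thesis by simp
  qed
  ultimately show ?thesis by linarith
qed

section \<open>Lower bound from set disjointness\<close>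

text \<open>In each of \<open>m\<close> blocks the players hold symbols from \<open>{0,1,2}\<close>; \<open>kern i j\<close> is the
  conditional probability of \<open>j\<close> given \<open>i\<close> when both are uniform and have correlation \<open>\<lambda>\<close>. It is
  supported on \<open>i \<noteq> j\<close> at \<open>\<lambda> = -1/2\<close>.\<close>

definition kern :: "nat \<Rightarrow> nat \<Rightarrow> real poly" where
  "kern i j = (if i = j then [:1/3, 2/3:] else [:1/3, -1/3:])"

text \<open>The expectation of M over m independent pairs of symbols of correlation \<lambda>, kept
  as a polynomial in \<lambda>. The factor 1/3 is the uniform law of the first player's
  symbol.\<close>

fun corr_poly :: "nat \<Rightarrow> (nat list \<Rightarrow> nat list \<Rightarrow> real) \<Rightarrow> real poly" where
  "corr_poly 0 M = [:M [] []:]"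
| "corr_poly (Suc m) M =
     (\<Sum>i<3. \<Sum>j<3. smult (1/3) (kern i j * corr_poly m (\<lambda>u v. M (i # u) (j # v))))"

fun avg :: "nat \<Rightarrow> (nat list \<Rightarrow> real) \<Rightarrow> real" where
  "avg 0 F = F []"
| "avg (Suc m) F = (\<Sum>i<3. avg m (\<lambda>u. F (i # u))) / 3"

lemma corr_poly_add: "corr_poly m (\<lambda>u v. M u v + M' u v) = corr_poly m M + corr_poly m M'"
  by (induction m arbitrary: M M') (simp_all add: sum.distrib algebra_simps smult_add_right)

lemma smult_sum_right: "smult c (\<Sum>i\<in>S. p i) = (\<Sum>i\<in>S. smult c (p i))" for c :: real
  by (induction S rule: infinite_finite_induct) (simp_all add: smult_add_right)

lemma sum_lessThan_3: "(\<Sum>i<3. h i) = h 0 + h 1 + h 2" for h :: "nat \<Rightarrow> 'a::comm_monoid_add"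
  by (simp add: numeral_3_eq_3 numeral_2_eq_2 add.assoc)

lemma corr_poly_scale: "corr_poly m (\<lambda>u v. c * M u v) = smult c (corr_poly m M)"
proof (induction m arbitrary: M)
  case (Suc m)
  show ?case unfolding corr_poly.simps Suc.IH by (simp add: smult_sum_right mult_ac)
qed simp

lemma corr_poly_sum:
  "finite S \<Longrightarrow> corr_poly m (\<lambda>u v. \<Sum>s\<in>S. c s * M s u v) = (\<Sum>s\<in>S. smult (c s) (corr_poly m (M s)))"
proof (induction S rule: finite_induct)
  case empty
  show ?case using corr_poly_scale[of m 0 "\<lambda>_ _. 0"] by simp
qed (simp add: corr_poly_add corr_poly_scale)

lemma avg_add: "avg m (\<lambda>u. F u + G u) = avg m F + avg m G"
  by (induction m arbitrary: F G) (simp_all add: sum.distrib add_divide_distrib)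

lemma avg_scale: "avg m (\<lambda>u. c * F u) = c * avg m F"
  by (induction m arbitrary: F) (simp_all add: sum_distrib_left)

lemma avg_sum: "finite S \<Longrightarrow> avg m (\<lambda>u. \<Sum>s\<in>S. F s u) = (\<Sum>s\<in>S. avg m (F s))"
proof (induction S rule: finite_induct)
  case empty
  show ?case using avg_scale[of m 0 "\<lambda>_. 0"] by simp
qed (simp add: avg_add)

lemma avg_le: "(\<And>u. F u \<le> 1) \<Longrightarrow> avg m F \<le> 1"
proof (induction m arbitrary: F)
  case (Suc m)
  have "(\<Sum>i<3. avg m (\<lambda>u. F (i # u))) \<le> (\<Sum>i<3::nat. 1)"
    using Suc by (intro sum_mono) auto
  then show ?case by simp
qed simp

text \<open>Law of total variance for a uniform symbol, averaged over the rest of the word.\<close>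

lemma avg_variance:
  "avg m (\<lambda>u. ((F 0 u + F 1 u + F 2 u) / 3)\<^sup>2) + (\<Sum>i<3. avg m (\<lambda>u. (F i u - (F 0 u + F 1 u + F 2 u) / 3)\<^sup>2)) / 3
     = (\<Sum>i<(3::nat). avg m (\<lambda>u. (F i u)\<^sup>2)) / 3" for F :: "nat \<Rightarrow> nat list \<Rightarrow> real"
proof -
  have "avg m (\<lambda>u. 3 * (((F 0 u + F 1 u + F 2 u) / 3)\<^sup>2) + (\<Sum>i<3. (F i u - (F 0 u + F 1 u + F 2 u) / 3)\<^sup>2))
    = avg m (\<lambda>u. \<Sum>i<(3::nat). (F i u)\<^sup>2)"
    by (intro arg_cong[where f="avg m"] ext) (simp add: sum_lessThan_3 power2_eq_square field_simps)
  then show ?thesis by (simp add: avg_add avg_scale avg_sum)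
qed

text \<open>Splitting each factor into its mean over the first symbol and the deviations from the mean
  diagonalizes the kernel: the deviations are multiplied by \<open>\<lambda>\<close>.\<close>

lemma coeff_corr_poly_product:
  "\<bar>coeff (corr_poly m (\<lambda>u v. F u * G v)) t\<bar> \<le> (avg m (\<lambda>u. (F u)\<^sup>2) + avg m (\<lambda>v. (G v)\<^sup>2)) / 2"
proof (induction m arbitrary: F G t)
  case 0
  have "\<bar>F [] * G []\<bar> \<le> ((F [])\<^sup>2 + (G [])\<^sup>2) / 2"
    using zero_le_power2[of "F [] - G []"] zero_le_power2[of "F [] + G []"]
    by (auto simp: power2_eq_square algebra_simps abs_le_iff)
  then show ?case by (cases t) auto
next
  case (Suc m)
  define f g where "f = (\<lambda>(i::nat) u. F (i # u))" and "g = (\<lambda>(i::nat) u. G (i # u))"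
  define f' g' where "f' u = (f 0 u + f 1 u + f 2 u) / 3" and "g' u = (g 0 u + g 1 u + g 2 u) / 3" for u
  define w where "w i j = corr_poly m (\<lambda>u v. f i u * g j v)" for i j
  note ss = sum_lessThan_3
  have w0: "poly (corr_poly m (\<lambda>u v. f' u * g' v)) x = (\<Sum>i<3. \<Sum>j<3. poly (w i j) x) / 9" for x
  proof -
    have "(\<lambda>u v. f' u * g' v) = (\<lambda>u v. \<Sum>i<3. 1 * (\<Sum>j<3. 1/9 * (f i u * g j v)))"
      unfolding f'_def g'_def by (simp add: ss algebra_simps add_divide_distrib)
    then have "corr_poly m (\<lambda>u v. f' u * g' v) = (\<Sum>i<3. \<Sum>j<3. smult (1/9) (w i j))"
      by (simp only: corr_poly_sum finite_lessThan w_def smult_1_left)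
    then show ?thesis by (simp add: poly_sum sum_divide_distrib)
  qed
  have w1: "poly (corr_poly m (\<lambda>u v. (f i u - f' u) * (g i v - g' v))) x = poly (w i i) x
      - (\<Sum>j<3. poly (w i j) x) / 3 - (\<Sum>j<3. poly (w j i) x) / 3 + (\<Sum>i<3. \<Sum>j<3. poly (w i j) x) / 9" for i x
  proof -
    have "(\<lambda>u v. (f i u - f' u) * (g i v - g' v)) = (\<lambda>u v. f i u * g i v + ((\<Sum>j<3. (-1/3) * (f i u * g j v))
       + ((\<Sum>j<3. (-1/3) * (f j u * g i v)) + f' u * g' v)))"
      unfolding f'_def g'_def by (simp add: ss algebra_simps add_divide_distrib)
    then show ?thesis
      by (simp only: corr_poly_add corr_poly_sum finite_lessThan poly_add w0 w_def[symmetric] poly_sum poly_smult)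
         (simp add: sum_divide_distrib sum_negf)
  qed
  \<comment> \<open>Mixed terms drop out because the deviations sum to zero. The polynomial identity
    is checked pointwise.\<close>
  have "corr_poly (Suc m) (\<lambda>u v. F u * G v) = corr_poly m (\<lambda>u v. f' u * g' v) +
     pCons 0 (smult (1/3) (\<Sum>i<3. corr_poly m (\<lambda>u v. (f i u - f' u) * (g i v - g' v))))" (is "?l = ?r")
  proof -
    have "poly ?l x = poly ?r x" for x
    proof -
      have "poly ?l x = (\<Sum>i<3. \<Sum>j<3. 1/3 * (poly (kern i j) x * poly (w i j) x))"
        by (simp add: poly_sum w_def f_def g_def)
      also have "\<dots> = poly ?r x"
        unfolding poly_add poly_pCons poly_smult poly_sum w0 w1
        by (simp add: ss kern_def) (simp add: field_simps)
      finally show ?thesis .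
    qed
    then show ?thesis by (intro poly_ext)
  qed
  then have "\<bar>coeff ?l t\<bar> \<le> \<bar>coeff (corr_poly m (\<lambda>u v. f' u * g' v)) t\<bar>
     + \<bar>coeff (pCons 0 (smult (1/3) (\<Sum>i<3. corr_poly m (\<lambda>u v. (f i u - f' u) * (g i v - g' v))))) t\<bar>"
    by (simp add: abs_triangle_ineq)
  \<comment> \<open>The bound is a mean of squared norms, not a product of norms, because squared
    norms add under the splitting; \<open>avg_variance\<close> then closes the induction without
    loss.\<close>
  also have "\<dots> \<le> (avg m (\<lambda>u. (f' u)\<^sup>2) + avg m (\<lambda>v. (g' v)\<^sup>2)) / 2 +
     (\<Sum>i<3. (avg m (\<lambda>u. (f i u - f' u)\<^sup>2) + avg m (\<lambda>v. (g i v - g' v)\<^sup>2)) / 2) / 3"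
  proof (intro add_mono Suc.IH)
    have nn: "0 \<le> (avg m (\<lambda>u. (f i u - f' u)\<^sup>2) + avg m (\<lambda>v. (g i v - g' v)\<^sup>2)) / 2" for i
      using Suc.IH[of "\<lambda>u. f i u - f' u" "\<lambda>v. g i v - g' v" 0] by linarith
    show "\<bar>coeff (pCons 0 (smult (1/3) (\<Sum>i<3. corr_poly m (\<lambda>u v. (f i u - f' u) * (g i v - g' v))))) t\<bar>
      \<le> (\<Sum>i<3. (avg m (\<lambda>u. (f i u - f' u)\<^sup>2) + avg m (\<lambda>v. (g i v - g' v)\<^sup>2)) / 2) / 3"
    proof (cases t)
      case 0
      then show ?thesis by (auto intro!: divide_nonneg_nonneg sum_nonneg nn)
    next
      case (Suc s)
      have "\<bar>\<Sum>i<3. coeff (corr_poly m (\<lambda>u v. (f i u - f' u) * (g i v - g' v))) s\<bar> \<le>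
         (\<Sum>i<3. (avg m (\<lambda>u. (f i u - f' u)\<^sup>2) + avg m (\<lambda>v. (g i v - g' v)\<^sup>2)) / 2)"
        by (intro order.trans[OF sum_abs] sum_mono Suc.IH)
      then show ?thesis using Suc by (simp add: coeff_sum)
    qed
  qed
  also have "\<dots> = (avg (Suc m) (\<lambda>u. (F u)\<^sup>2) + avg (Suc m) (\<lambda>v. (G v)\<^sup>2)) / 2"
    using avg_variance[of m f] avg_variance[of m g]
    unfolding f'_def[symmetric] g'_def[symmetric]
    by (simp add: f_def g_def ss field_simps)
  finally show ?case .
qed

text \<open>On this interval the kernel is stochastic: its entries are nonnegative and its rows sum
  to 1.\<close>

lemma corr_poly_bounds:
  assumes "-1/2 \<le> x" "x \<le> 1/2" "\<And>u v. 0 \<le> M u v \<and> M u v \<le> 1"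
  shows "0 \<le> poly (corr_poly m M) x \<and> poly (corr_poly m M) x \<le> 1"
  using assms(3)
proof (induction m arbitrary: M)
  case (Suc m)
  have k: "0 \<le> poly (kern i j) x" for i j using assms(1,2) by (auto simp: kern_def)
  have "(\<Sum>i<3. \<Sum>j<3. 1/3 * (poly (kern i j) x * poly (corr_poly m (\<lambda>u v. M (i # u) (j # v))) x))
     \<le> (\<Sum>i<3. \<Sum>j<3. 1/3 * (poly (kern i j) x * 1))"
    using Suc k by (intro sum_mono mult_left_mono) auto
  also have "\<dots> = 1" by (simp add: kern_def sum_lessThan_3 field_simps)
  finally have "poly (corr_poly (Suc m) M) x \<le> 1" by (simp add: poly_sum)
  moreover have "0 \<le> poly (corr_poly (Suc m) M) x"
    using Suc k by (auto simp: poly_sum intro!: sum_nonneg mult_nonneg_nonneg)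
  ultimately show ?case by simp
qed simp

section \<open>Value and derivative at \<lambda> = -1/2, where the symbols never agree\<close>

fun agreements :: "nat list \<Rightarrow> nat list \<Rightarrow> nat" where
  "agreements (i # u) (j # v) = of_bool (i = j) + agreements u v"
| "agreements _ _ = 0"

definition words :: "nat \<Rightarrow> nat list set" where
  "words m = {u. length u = m \<and> set u \<subseteq> {..<3}}"

lemma Nil_in_words: "[] \<in> words 0" by (simp add: words_def)
lemma Cons_in_words: "i < 3 \<Longrightarrow> u \<in> words m \<Longrightarrow> i # u \<in> words (Suc m)" by (simp add: words_def)

definition off_diagonal :: "(nat \<times> nat) set" where
  "off_diagonal = {(i, j). i < 3 \<and> j < 3 \<and> i \<noteq> j}"

lemma card_off_diagonal: "card off_diagonal = 6"
proof -
  have eq: "off_diagonal = {(0,1),(0,2),(1,0),(1,2),(2,0),(2,1::nat)}" by (auto simp: off_diagonal_def)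
  show ?thesis unfolding eq by simp
qed

lemma kern_at_disjoint:
  "poly (kern i j) (-1/2) = (if i = j then 0 else 1/2)"
  "poly (pderiv (kern i j)) x = (if i = j then 2/3 else -1/3)"
  by (simp_all add: kern_def pderiv_pCons)

text \<open>At -1/2 every unequal pair of symbols has weight 1/3 * 1/2 = 1/6 and equal symbols have
  weight 0. Differentiating the kernel of the leading block gives 2/9 on equal and -1/9 on unequal
  symbols; the rest is the product rule.\<close>

lemma corr_poly_at_disjoint:
  "poly (corr_poly (Suc m) M) (-1/2) =
     (\<Sum>(i,j)\<in>off_diagonal. poly (corr_poly m (\<lambda>u v. M (i # u) (j # v))) (-1/2)) / 6"
  "poly (pderiv (corr_poly (Suc m) M)) (-1/2) =
     2/9 * (\<Sum>i<3. poly (corr_poly m (\<lambda>u v. M (i # u) (i # v))) (-1/2))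
     - (\<Sum>(i,j)\<in>off_diagonal. poly (corr_poly m (\<lambda>u v. M (i # u) (j # v))) (-1/2)) / 9
     + (\<Sum>(i,j)\<in>off_diagonal. poly (pderiv (corr_poly m (\<lambda>u v. M (i # u) (j # v)))) (-1/2)) / 6"
proof -
  have S: "off_diagonal = {(0,1),(0,2),(1,0),(1,2),(2,0),(2,1::nat)}"
    by (auto simp: off_diagonal_def)
  show "poly (corr_poly (Suc m) M) (-1/2) =
     (\<Sum>(i,j)\<in>off_diagonal. poly (corr_poly m (\<lambda>u v. M (i # u) (j # v))) (-1/2)) / 6"
    unfolding S
    by (simp add: poly_sum kern_at_disjoint[simplified] sum_lessThan_3)
  show "poly (pderiv (corr_poly (Suc m) M)) (-1/2) =
     2/9 * (\<Sum>i<3. poly (corr_poly m (\<lambda>u v. M (i # u) (i # v))) (-1/2))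
     - (\<Sum>(i,j)\<in>off_diagonal. poly (corr_poly m (\<lambda>u v. M (i # u) (j # v))) (-1/2)) / 9
     + (\<Sum>(i,j)\<in>off_diagonal. poly (pderiv (corr_poly m (\<lambda>u v. M (i # u) (j # v)))) (-1/2)) / 6"
    unfolding S
    by (simp add: sum_lessThan_3 kern_at_disjoint[simplified] pderiv_add pderiv_smult pderiv_mult field_simps)
qed

lemma corr_poly_disjoint_le:
  assumes "\<And>u v. u \<in> words m \<Longrightarrow> v \<in> words m \<Longrightarrow> agreements u v = 0 \<Longrightarrow> M u v \<le> c"
  shows "poly (corr_poly m M) (-1/2) \<le> c"
  using assms
proof (induction m arbitrary: M)
  case (Suc m)
  have "(\<Sum>(i,j)\<in>off_diagonal. poly (corr_poly m (\<lambda>u v. M (i # u) (j # v))) (-1/2))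
    \<le> (\<Sum>(i,j)\<in>off_diagonal. c)"
    unfolding case_prod_unfold by (intro sum_mono Suc.IH Suc.prems) (auto simp: off_diagonal_def Cons_in_words)
  then show ?case unfolding corr_poly_at_disjoint by (simp add: card_off_diagonal case_prod_unfold)
qed (simp add: Nil_in_words)

lemma corr_poly_disjoint_ge:
  assumes "\<And>u v. u \<in> words m \<Longrightarrow> v \<in> words m \<Longrightarrow> agreements u v = 0 \<Longrightarrow> M u v \<ge> c"
  shows "poly (corr_poly m M) (-1/2) \<ge> c"
proof -
  have "poly (corr_poly m (\<lambda>u v. (-1) * M u v)) (-1/2) \<le> - c"
    using assms by (intro corr_poly_disjoint_le) auto
  then show ?thesis unfolding corr_poly_scale by simp
qed

text \<open>The derivative is a sum over blocks: each trades mass 2/3 on words without agreement for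
  mass 2/3 on words agreeing in just that block. Hence only words with at most one agreement
  enter.\<close>

lemma corr_poly_deriv_ge:
  assumes "\<And>u v. u \<in> words m \<Longrightarrow> v \<in> words m \<Longrightarrow> agreements u v = 0 \<Longrightarrow> M u v \<le> c\<^sub>0"
    and "\<And>u v. u \<in> words m \<Longrightarrow> v \<in> words m \<Longrightarrow> agreements u v = 1 \<Longrightarrow> M u v \<ge> c\<^sub>1"
  shows "poly (pderiv (corr_poly m M)) (-1/2) \<ge> 2/3 * (c\<^sub>1 - c\<^sub>0) * real m"
  using assms
proof (induction m arbitrary: M)
  case (Suc m)
  have "(\<Sum>i<3. poly (corr_poly m (\<lambda>u v. M (i # u) (i # v))) (-1/2)) \<ge> (\<Sum>i<3::nat. c\<^sub>1)"
    by (intro sum_mono corr_poly_disjoint_ge Suc.prems) (auto simp: Cons_in_words)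
  moreover have "(\<Sum>(i,j)\<in>off_diagonal. poly (corr_poly m (\<lambda>u v. M (i # u) (j # v))) (-1/2))
      \<le> (\<Sum>(i,j)\<in>off_diagonal. c\<^sub>0)"
    unfolding case_prod_unfold
    by (intro sum_mono corr_poly_disjoint_le Suc.prems) (auto simp: off_diagonal_def Cons_in_words)
  moreover have "(\<Sum>(i,j)\<in>off_diagonal. poly (pderiv (corr_poly m (\<lambda>u v. M (i # u) (j # v)))) (-1/2))
      \<ge> (\<Sum>(i,j)\<in>off_diagonal. 2/3 * (c\<^sub>1 - c\<^sub>0) * real m)"
    unfolding case_prod_unfold
    by (intro sum_mono Suc.IH Suc.prems) (auto simp: off_diagonal_def Cons_in_words)
  ultimately show ?case unfolding corr_poly_at_disjoint
    by (simp add: card_off_diagonal case_prod_unfold field_simps)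
qed simp

text \<open>A coefficient is a finite linear combination of values of M, so it commutes with
  averaging over the public coins.\<close>

lemma coeff_corr_poly_integral:
  assumes "\<And>u v. integrable N (\<lambda>r. M r u v)"
  shows "integrable N (\<lambda>r. coeff (corr_poly m (M r)) t) \<and>
    coeff (corr_poly m (\<lambda>u v. \<integral>r. M r u v \<partial>N)) t = (\<integral>r. coeff (corr_poly m (M r)) t \<partial>N)"
  using assms
proof (induction m arbitrary: M t)
  case 0
  then show ?case by (cases t) auto
next
  case (Suc m)
  let ?c = "\<lambda>M t i j. coeff (corr_poly m (\<lambda>u v. M (i # u) (j # v))) t"
  have eq: "coeff (corr_poly (Suc m) M) t =
    (\<Sum>i<3. \<Sum>j<3. 1/3 * (1/3 * ?c M t i j + (case t of 0 \<Rightarrow> 0 | Suc s \<Rightarrow> (if i = j then 2/3 else -1/3) * ?c M s i j)))" for M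
    unfolding corr_poly.simps coeff_sum by (intro sum.cong refl) (auto simp: kern_def split: nat.split)
  have IH: "integrable N (\<lambda>r. ?c (M r) t i j)"
      "?c (\<lambda>u v. \<integral>r. M r u v \<partial>N) t i j = (\<integral>r. ?c (M r) t i j \<partial>N)" for i j t
    using Suc.IH[of "\<lambda>r u v. M r (i # u) (j # v)" t] Suc.prems by auto
  show ?case unfolding eq
    by (cases t) (auto simp: IH Bochner_Integration.integral_sum)
qed

text \<open>Symbols become unit vectors on three coordinates. Unequal symbols occupy one coordinate
  of each type (1,0), (0,1), (0,0); equal ones occupy one of type (1,1) and two of type (0,0), as a
  step across a jump requires.\<close>

definition blocks :: "nat list \<Rightarrow> bool list" where
  "blocks u = concat (map (\<lambda>i. [i = 0, i = 1, i = 2]) u)"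

lemma blocks_simps [simp]: "blocks [] = []" "blocks (i # u) = [i = 0, i = 1, i = 2] @ blocks u"
  by (simp_all add: blocks_def)

lemma length_blocks [simp]: "length (blocks u) = 3 * length u"
  by (induction u) auto

lemma blocks_cells:
  assumes "u \<in> words m" "v \<in> words m"
  shows "cell True True (blocks u) (blocks v) = agreements u v"
    and "weight (blocks u) = m"
proof -
  have len: "length u = length v" "set u \<subseteq> {..<3}" "set v \<subseteq> {..<3}" "length u = m" using assms by (auto simp: words_def)
  show "cell True True (blocks u) (blocks v) = agreements u v"
    using len(1-3)
  proof (induction u v rule: list_induct2)
    case (Cons i u j v)
    have i: "i \<in> {0,1,2}" "j \<in> {0,1,2}" using Cons.prems by auto
    have "cell True True [i = 0, i = 1, i = 2] [j = 0, j = 1, j = 2] = of_bool (i = j)"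
      using i by (auto simp: cell_def)
    then show ?case using Cons by (simp del: append.simps add: cell_append)
  qed (simp add: cell_def)
  show "weight (blocks u) = m" using len(2,4)
  proof (induction u arbitrary: m)
    case (Cons i u)
    have i: "i \<in> {0,1,2}" using Cons.prems by auto
    have "weight [i = 0, i = 1, i = 2] = 1" using i by auto
    then show ?case using Cons by (simp del: append.simps count_list.simps)
  qed simp
qed

section \<open>Complexity classes closed under the symmetries\<close>

text \<open>The flag selects the one-way model, so that both claims run through the same lemmas.
  Complementing an input preserves the class for either flag; exchanging the players does so in the
  interactive model.\<close>

definition pub_cost :: "bool \<Rightarrow> nat \<Rightarrow> (bool list \<Rightarrow> bool list \<Rightarrow> bool) \<Rightarrow> nat \<Rightarrow> bool" where
  "pub_cost ow n f k \<longleftrightarrow> permutation_invariant n f \<and>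
     (\<exists>P. (ow \<longrightarrow> one_way P) \<and> measurable_protocol P \<and> computes public_randomness n f P \<and> cost P \<le> k)"

lemma permute_list_map_Not:
  "\<pi> permutes {..<length x} \<Longrightarrow> permute_list \<pi> (map Not x) = map Not (permute_list \<pi> x)"
  by (rule permute_list_map)

lemma computes_relabel:
  assumes "computes M n f P" "\<And>x. length (\<phi> x) = length x" "\<And>x. length (\<psi> x) = length x"
  shows "computes M n (\<lambda>x y. f (\<phi> x) (\<psi> y)) (relabel \<phi> \<psi> P)"
  using assms by (simp add: computes_def)

lemma pub_cost_Not_left:
  assumes "pub_cost ow n f k"
  shows "pub_cost ow n (\<lambda>x y. f (map Not x) y) k"
proof -
  have "permutation_invariant n (\<lambda>x y. f (map Not x) y)"
    using assms unfolding pub_cost_def permutation_invariant_def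
    by (metis length_map permute_list_map_Not)
  moreover obtain P where "ow \<longrightarrow> one_way P" "measurable_protocol P" "computes public_randomness n f P" "cost P \<le> k"
    using assms unfolding pub_cost_def by auto
  moreover have "computes public_randomness n (\<lambda>x y. f (map Not x) y) (relabel (map Not) (\<lambda>y. y) P)"
    by (rule computes_relabel[OF \<open>computes public_randomness n f P\<close>]) auto
  ultimately show ?thesis unfolding pub_cost_def
    by (intro conjI exI[of _ "relabel (map Not) (\<lambda>y. y) P"]) (auto simp: measurable_relabel)
qed

lemma pub_cost_Not_right:
  assumes "pub_cost ow n f k"
  shows "pub_cost ow n (\<lambda>x y. f x (map Not y)) k"
proof -
  have "permutation_invariant n (\<lambda>x y. f x (map Not y))"
    using assms unfolding pub_cost_def permutation_invariant_def
    by (metis length_map permute_list_map_Not)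
  moreover obtain P where "ow \<longrightarrow> one_way P" "measurable_protocol P" "computes public_randomness n f P" "cost P \<le> k"
    using assms unfolding pub_cost_def by auto
  moreover have "computes public_randomness n (\<lambda>x y. f x (map Not y)) (relabel (\<lambda>x. x) (map Not) P)"
    by (rule computes_relabel[OF \<open>computes public_randomness n f P\<close>]) auto
  ultimately show ?thesis unfolding pub_cost_def
    by (intro conjI exI[of _ "relabel (\<lambda>x. x) (map Not) P"]) (auto simp: measurable_relabel)
qed

lemma pub_cost_swap:
  assumes "pub_cost False n f k"
  shows "pub_cost False n (\<lambda>x y. f y x) k"
proof -
  have "permutation_invariant n (\<lambda>x y. f y x)"
    using assms unfolding pub_cost_def permutation_invariant_def by metis
  moreover obtain P where P: "measurable_protocol P" "computes public_randomness n f P" "cost P \<le> k"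
    using assms unfolding pub_cost_def by auto
  moreover have "computes public_randomness n (\<lambda>x y. f y x) (swap_players P)"
    using P(1,2) prob_public[of P] prob_public[of "swap_players P"] by (simp add: computes_def)
  ultimately show ?thesis unfolding pub_cost_def
    by (intro conjI exI[of _ "swap_players P"]) auto
qed

abbreviation left_input :: "nat \<Rightarrow> nat \<Rightarrow> nat \<Rightarrow> nat \<Rightarrow> bool list" where
  "left_input \<alpha> \<beta> \<gamma> \<delta> \<equiv> replicate \<alpha> True @ replicate \<beta> True @ replicate \<gamma> False @ replicate \<delta> False"

abbreviation right_input :: "nat \<Rightarrow> nat \<Rightarrow> nat \<Rightarrow> nat \<Rightarrow> bool list" where
  "right_input \<alpha> \<beta> \<gamma> \<delta> \<equiv> replicate \<alpha> True @ replicate \<beta> False @ replicate \<gamma> True @ replicate \<delta> False"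

lemma cells_inputs:
  "cell True True (left_input \<alpha> \<beta> \<gamma> \<delta>) (right_input \<alpha> \<beta> \<gamma> \<delta>) = \<alpha>"
  "cell True False (left_input \<alpha> \<beta> \<gamma> \<delta>) (right_input \<alpha> \<beta> \<gamma> \<delta>) = \<beta>"
  "cell False True (left_input \<alpha> \<beta> \<gamma> \<delta>) (right_input \<alpha> \<beta> \<gamma> \<delta>) = \<gamma>"
  "cell False False (left_input \<alpha> \<beta> \<gamma> \<delta>) (right_input \<alpha> \<beta> \<gamma> \<delta>) = \<delta>"
  by (simp_all add: cell_append cell_replicate)

lemma cells_val_eqI:
  assumes "permutation_invariant n f" "length x = n" "length y = n"
    "cell True True x y = \<alpha>" "cell True False x y = \<beta>" "cell False True x y = \<gamma>" "cell False False x y = \<delta>"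
  shows "f x y = cells_val f \<alpha> \<beta> \<gamma> \<delta>"
  using cells_val_eq[OF assms(1-3)] assms(4-) by simp

lemma cells_val_symmetries:
  assumes f: "permutation_invariant n f" and n: "\<alpha> + \<beta> + \<gamma> + \<delta> = n"
  shows "cells_val (\<lambda>x y. f (map Not x) y) \<gamma> \<delta> \<alpha> \<beta> = cells_val f \<alpha> \<beta> \<gamma> \<delta>"
    and "cells_val (\<lambda>x y. f x (map Not y)) \<beta> \<alpha> \<delta> \<gamma> = cells_val f \<alpha> \<beta> \<gamma> \<delta>"
    and "cells_val (\<lambda>x y. f y x) \<alpha> \<gamma> \<beta> \<delta> = cells_val f \<alpha> \<beta> \<gamma> \<delta>"
  unfolding cells_val_def[of "\<lambda>x y. f (map Not x) y"] cells_val_def[of "\<lambda>x y. f x (map Not y)"]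
    cells_val_def[of "\<lambda>x y. f y x"]
  by (rule cells_val_eqI[OF f]; use n in \<open>simp add: cell_map_Not cell_append cell_replicate map_replicate\<close>)+

text \<open>Complementing x exchanges the rows of the table of cells and, with them, the two sides
  of the jump.\<close>

lemma jump_Not_left:
  "permutation_invariant n f \<Longrightarrow> jump n f \<alpha> \<beta> \<gamma> \<delta> \<Longrightarrow> jump n (\<lambda>x y. f (map Not x) y) \<gamma> \<delta> \<alpha> \<beta>"
  unfolding jump_def
  using cells_val_symmetries(1)[of n f "Suc \<alpha>" \<beta> \<gamma> "Suc \<delta>"] cells_val_symmetries(1)[of n f \<alpha> "Suc \<beta>" "Suc \<gamma>" \<delta>]
  by auto

lemma jump_Not_right:
  "permutation_invariant n f \<Longrightarrow> jump n f \<alpha> \<beta> \<gamma> \<delta> \<Longrightarrow> jump n (\<lambda>x y. f x (map Not y)) \<beta> \<alpha> \<delta> \<gamma>"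
  unfolding jump_def
  using cells_val_symmetries(2)[of n f "Suc \<alpha>" \<beta> \<gamma> "Suc \<delta>"] cells_val_symmetries(2)[of n f \<alpha> "Suc \<beta>" "Suc \<gamma>" \<delta>]
  by auto

lemma jump_swap:
  "permutation_invariant n f \<Longrightarrow> jump n f \<alpha> \<beta> \<gamma> \<delta> \<Longrightarrow> jump n (\<lambda>x y. f y x) \<alpha> \<gamma> \<beta> \<delta>"
  unfolding jump_def
  using cells_val_symmetries(3)[of n f "Suc \<alpha>" \<beta> \<gamma> "Suc \<delta>"] cells_val_symmetries(3)[of n f \<alpha> "Suc \<beta>" "Suc \<gamma>" \<delta>]
  by auto

section \<open>Jumps need two small cells\<close>

text \<open>For fixed coins the acceptance matrix is a sum of at most 2^cost rectangles, each with
  coefficients at most 1; averaging over the coins preserves the bound.\<close>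

lemma coeff_corr_poly_accept:
  assumes P: "measurable_protocol P"
  shows "\<bar>coeff (corr_poly m (\<lambda>u v. accept P (E u) (E' v))) t\<bar> \<le> 2 ^ cost P"
proof -
  interpret prob_space coins by (rule prob_space_coins)
  let ?c = "\<lambda>F. coeff (corr_poly m (\<lambda>u v. F (E u) (E' v))) t"
  have 1: "\<bar>?c (\<lambda>x y. of_bool (run P x y r r))\<bar> \<le> 2 ^ cost P * 1" for r
  proof (rule protocol_rectangle_bound'[where N = "\<lambda>F. \<bar>?c F\<bar>"])
    fix F G :: "bool list \<Rightarrow> bool list \<Rightarrow> real"
    show "\<bar>?c (\<lambda>x y. F x y + G x y)\<bar> \<le> \<bar>?c F\<bar> + \<bar>?c G\<bar>"
      by (simp add: corr_poly_add)
  next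
    fix F G :: "bool list \<Rightarrow> real"
    assume F: "\<And>x. 0 \<le> F x \<and> F x \<le> 1" and G: "\<And>x. 0 \<le> G x \<and> G x \<le> 1"
    have "avg m (\<lambda>u. (F (E u))\<^sup>2) \<le> 1" "avg m (\<lambda>u. (G (E' u))\<^sup>2) \<le> 1"
      using F G by (auto intro!: avg_le power_le_one)
    then show "\<bar>?c (\<lambda>x y. F x * G y)\<bar> \<le> 1"
      using coeff_corr_poly_product[of m "\<lambda>u. F (E u)" "\<lambda>v. G (E' v)" t] by simp
  qed simp
  note int = coeff_corr_poly_integral[of coins "\<lambda>r u v. of_bool (run P (E u) (E' v) r r)" m t, OF integrable_run[OF P]]
  have "?c (accept P) = (\<integral>r. ?c (\<lambda>x y. of_bool (run P x y r r)) \<partial>coins)"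
    using int unfolding accept_def by simp
  also have "\<bar>\<dots>\<bar> \<le> (\<integral>r. \<bar>?c (\<lambda>x y. of_bool (run P x y r r))\<bar> \<partial>coins)"
    by (rule integral_abs_bound)
  also have "\<dots> \<le> (\<integral>r. 2 ^ cost P \<partial>coins)"
    using int 1 by (intro integral_mono) auto
  also have "\<dots> = 2 ^ cost P" using prob_space by simp
  finally show ?thesis .
qed

text \<open>The constant solves 2/9 * m \<le> 12 (k + 1)^3, the two estimates of the derivative at
  -1/2.\<close>

definition cells_bound :: "nat \<Rightarrow> nat" where
  "cells_bound k = 54 * (k + 1) ^ 3"

lemma disjointness_bound:
  assumes f: "pub_cost ow n f k" and j: "jump n f \<alpha> \<beta> \<gamma> \<delta>"
  shows "min \<beta> (min \<gamma> \<delta>) \<le> cells_bound k"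
proof -
  define m where "m = min \<beta> (min \<gamma> \<delta>)"
  have m: "m \<le> \<beta>" "m \<le> \<gamma>" "m \<le> \<delta>" by (auto simp: m_def)
  have pi: "permutation_invariant n f" using f by (simp add: pub_cost_def)
  obtain P where P: "measurable_protocol P" "computes public_randomness n f P" "cost P \<le> k"
    using f unfolding pub_cost_def by auto
  have n: "\<alpha> + \<beta> + \<gamma> + \<delta> + 2 = n" using j by (simp add: jump_def)
  \<comment> \<open>Blocks without agreement fill m coordinates of each of the types (1,0), (0,1),
    (0,0); the padding completes them to one side of the jump, and a single agreement leads to the
    other side.\<close>
  define E where "E u = blocks u @ left_input \<alpha> (\<beta> + 1 - m) (\<gamma> + 1 - m) (\<delta> - m)" for u
  define E' where "E' v = blocks v @ right_input \<alpha> (\<beta> + 1 - m) (\<gamma> + 1 - m) (\<delta> - m)" for v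
  have len: "length (E u) = n" "length (E' v) = n" if "u \<in> words m" "v \<in> words m" for u v
    using that m n by (simp_all add: E_def E'_def words_def)
  have val: "f (E u) (E' v) = cells_val f (agreements u v + \<alpha>) (Suc \<beta> - agreements u v) (Suc \<gamma> - agreements u v) (agreements u v + \<delta>)"
    if uv: "u \<in> words m" "v \<in> words m" and a: "agreements u v \<le> 1" for u v
  proof (rule cells_val_eqI[OF pi len[OF uv]])
    have lb: "length (blocks u) = length (blocks v)" using uv by (simp add: words_def)
    show 1: "cell True True (E u) (E' v) = agreements u v + \<alpha>"
      using blocks_cells(1)[OF uv] lb by (simp add: E_def E'_def cell_append cell_replicate)
    have w: "weight (E u) = \<alpha> + \<beta> + 1" "weight (E' v) = \<alpha> + \<gamma> + 1"
      using blocks_cells(2)[OF uv] blocks_cells(2)[OF uv(2,1)] m by (auto simp: E_def E'_def count_list_replicate)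
    note c = weight_eq_cells[of "E u" "E' v"]
    show "cell True False (E u) (E' v) = Suc \<beta> - agreements u v" using c len[OF uv] w 1 by simp
    show "cell False True (E u) (E' v) = Suc \<gamma> - agreements u v" using c len[OF uv] w 1 by simp
    show "cell False False (E u) (E' v) = agreements u v + \<delta>" using c len[OF uv] w 1 n a by linarith
  qed
  define p where "p = corr_poly m (\<lambda>u v. accept P (E u) (E' v))"
  have "\<bar>coeff p t\<bar> \<le> 2 ^ k" for t
    using coeff_corr_poly_accept[OF P(1), of m E E' t] power_increasing[OF P(3), of "2::real"] unfolding p_def by linarith
  moreover have "\<bar>poly p x\<bar> \<le> 1" if "\<bar>x\<bar> \<le> 1/2" for x
    using corr_poly_bounds[of x "\<lambda>u v. accept P (E u) (E' v)" m] accept_bounds[OF P(1)] that unfolding p_def by auto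
  ultimately have d: "\<bar>poly (pderiv p) (-1/2)\<bar> \<le> 12 * (real k + 1) ^ 3"
    by (rule derivative_bound_from_coeffs)
  note acc = accept_computes[OF P(1,2) len]
  \<comment> \<open>The factor 2/3 of \<open>corr_poly_deriv_ge\<close> times the acceptance gap
    1/3; a downward jump is treated by negating.\<close>
  have "2 / 9 * real m \<le> \<bar>poly (pderiv p) (-1/2)\<bar>"
  proof (cases "cells_val f (Suc \<alpha>) \<beta> \<gamma> (Suc \<delta>)")
    case True
    then have f0: "\<not> cells_val f \<alpha> (Suc \<beta>) (Suc \<gamma>) \<delta>" using j by (simp add: jump_def)
    have "2/3 * (2/3 - 1/3) * real m \<le> poly (pderiv p) (-1/2)"
      unfolding p_def using True f0 by (intro corr_poly_deriv_ge acc) (auto simp: val)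
    then show ?thesis by simp
  next
    case False
    then have f0: "cells_val f \<alpha> (Suc \<beta>) (Suc \<gamma>) \<delta>" using j by (simp add: jump_def)
    have "2/3 * (-1/3 - (-2/3)) * real m \<le>
        poly (pderiv (corr_poly m (\<lambda>u v. (-1) * accept P (E u) (E' v)))) (-1/2)"
    proof (intro corr_poly_deriv_ge)
      fix u v assume "u \<in> words m" "v \<in> words m" "agreements u v = 0"
      then show "(-1) * accept P (E u) (E' v) \<le> - 2 / 3" using acc(1)[of u v] f0 by (simp add: val)
    next
      fix u v assume "u \<in> words m" "v \<in> words m" "agreements u v = 1"
      then show "(-1) * accept P (E u) (E' v) \<ge> - 1 / 3" using acc(2)[of u v] False by (simp add: val)
    qed
    then show ?thesis unfolding corr_poly_scale p_def[symmetric] by (simp add: pderiv_minus)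
  qed
  with d have "real m \<le> 54 * (real k + 1) ^ 3" by linarith
  also have "\<dots> = real (cells_bound k)" by (simp add: cells_bound_def add.commute)
  finally show ?thesis by (simp add: m_def)
qed

text \<open>Complementing one or both inputs moves any three cells into the positions \<beta>,
  \<gamma>, \<delta>.\<close>

lemma jump_three_cells:
  assumes f: "pub_cost ow n f k" and j: "jump n f \<alpha> \<beta> \<gamma> \<delta>"
  shows "min \<beta> (min \<gamma> \<delta>) \<le> cells_bound k" "min \<delta> (min \<alpha> \<beta>) \<le> cells_bound k"
    "min \<alpha> (min \<delta> \<gamma>) \<le> cells_bound k" "min \<gamma> (min \<beta> \<alpha>) \<le> cells_bound k"
proof -
  have pi: "permutation_invariant n f" using f by (simp add: pub_cost_def)
  note fl = pub_cost_Not_left[OF f] and jl = jump_Not_left[OF pi j]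
  have pl: "permutation_invariant n (\<lambda>x y. f (map Not x) y)" using fl by (simp add: pub_cost_def)
  show "min \<beta> (min \<gamma> \<delta>) \<le> cells_bound k" by (rule disjointness_bound[OF f j])
  show "min \<delta> (min \<alpha> \<beta>) \<le> cells_bound k" by (rule disjointness_bound[OF fl jl])
  show "min \<alpha> (min \<delta> \<gamma>) \<le> cells_bound k"
    by (rule disjointness_bound[OF pub_cost_Not_right[OF f] jump_Not_right[OF pi j]])
  show "min \<gamma> (min \<beta> \<alpha>) \<le> cells_bound k"
    by (rule disjointness_bound[OF pub_cost_Not_right[OF fl] jump_Not_right[OF pl jl]])
qed

section \<open>Lower bounds from indexing\<close>

definition bit_sign :: "bool \<Rightarrow> real" where
  "bit_sign b = (if b then 1 else -1)"

definition cube :: "nat \<Rightarrow> bool list set" where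
  "cube N = {z. length z = N}"

lemma finite_cube [simp]: "finite (cube N)"
  unfolding cube_def using finite_lists_length_eq[of "UNIV :: bool set" N] by simp

lemma card_cube: "card (cube N) = 2 ^ N"
  unfolding cube_def using card_lists_length_eq[of "UNIV :: bool set" N] by (simp add: card_UNIV_bool)

lemma sum_cube_Suc: "(\<Sum>z\<in>cube (Suc N). F z) = (\<Sum>z\<in>cube N. F (True # z)) + (\<Sum>z\<in>cube N. F (False # z))"
  for F :: "bool list \<Rightarrow> 'a::comm_monoid_add"
proof -
  have eq: "cube (Suc N) = (#) True ` cube N \<union> (#) False ` cube N"
    by (auto simp: cube_def length_Suc_conv)
  show ?thesis unfolding eq
    by (subst sum.union_disjoint) (auto simp: sum.reindex)
qed

lemma sum_cube_prod:
  "(\<Sum>z\<in>cube N. \<Prod>i<N. (g i (z ! i) :: real)) = (\<Prod>i<N. g i True + g i False)"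
proof (induction N arbitrary: g)
  case 0
  then show ?case by (simp add: cube_def)
next
  case (Suc N)
  have eq: "(\<Prod>i<Suc N. g i ((b # z) ! i)) = g 0 b * (\<Prod>i<N. g (Suc i) (z ! i))" for b z
    by (simp only: prod.lessThan_Suc_shift) simp
  have "(\<Sum>z\<in>cube (Suc N). \<Prod>i<Suc N. g i (z ! i)) =
      (g 0 True + g 0 False) * (\<Sum>z\<in>cube N. \<Prod>i<N. g (Suc i) (z ! i))"
    unfolding sum_cube_Suc eq sum_distrib_left[symmetric] by (simp add: algebra_simps)
  also have "\<dots> = (\<Prod>i<Suc N. g i True + g i False)"
    unfolding Suc.IH[of "\<lambda>i. g (Suc i)"] prod.lessThan_Suc_shift by simp
  finally show ?case .
qed

lemma sum_cube_signs:
  assumes "i < N" "j < N"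
  shows "(\<Sum>z\<in>cube N. bit_sign (z ! i) * bit_sign (z ! j)) = (if i = j then 2 ^ N else 0)"
proof (cases "i = j")
  case True
  moreover have "bit_sign b * bit_sign b = 1" for b by (simp add: bit_sign_def)
  ultimately show ?thesis by (simp add: card_cube)
next
  case False
  define g where "g l b = (if l = i then bit_sign b else if l = j then bit_sign b else 1)" for l b
  have "(\<Prod>l<N. g l (z ! l)) = bit_sign (z ! i) * bit_sign (z ! j)" for z
  proof -
    have "(\<Prod>l<N. g l (z ! l)) = (\<Prod>l\<in>{i,j}. g l (z ! l))"
      using assms by (intro prod.mono_neutral_right) (auto simp: g_def)
    then show ?thesis using False by (simp add: g_def)
  qed
  then have "(\<Sum>z\<in>cube N. bit_sign (z ! i) * bit_sign (z ! j)) = (\<Prod>l<N. g l True + g l False)"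
    using sum_cube_prod[of g N] by simp
  also have "\<dots> = 0" using assms by (auto simp: g_def bit_sign_def intro!: bexI[of _ i])
  finally show ?thesis using False by simp
qed

text \<open>Discrepancy of the index matrix: by orthogonality of the signs the inner sum has mean
  square at most N over the cube, and Cauchy-Schwarz pairs it with G.\<close>

lemma index_rectangle:
  fixes F :: "nat \<Rightarrow> real" and G :: "bool list \<Rightarrow> real"
  assumes F: "\<And>i. \<bar>F i\<bar> \<le> 1" and G: "\<And>z. \<bar>G z\<bar> \<le> 1"
  shows "\<bar>\<Sum>z\<in>cube N. \<Sum>i<N. bit_sign (z ! i) * (F i * G z)\<bar> \<le> 2 ^ N * sqrt N"
proof -
  define X where "X z = (\<Sum>i<N. bit_sign (z ! i) * F i)" for z
  have "(\<Sum>z\<in>cube N. (X z)\<^sup>2) = (\<Sum>z\<in>cube N. \<Sum>i<N. \<Sum>j<N. F i * F j * (bit_sign (z ! i) * bit_sign (z ! j)))"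
    unfolding X_def power2_eq_square sum_product by (simp add: mult_ac)
  also have "\<dots> = (\<Sum>i<N. \<Sum>j<N. \<Sum>z\<in>cube N. F i * F j * (bit_sign (z ! i) * bit_sign (z ! j)))"
    by (subst sum.swap, rule sum.cong[OF refl], rule sum.swap)
  also have "\<dots> = (\<Sum>i<N. \<Sum>j<N. if j = i then F i * F i * 2 ^ N else 0)"
    unfolding sum_distrib_left[symmetric] by (intro sum.cong refl) (auto simp: sum_cube_signs)
  also have "\<dots> = (\<Sum>i<N. F i * F i * 2 ^ N)" by simp
  also have "\<dots> \<le> (\<Sum>i<N. 1 * 2 ^ N)"
  proof (intro sum_mono mult_right_mono)
    fix i show "F i * F i \<le> 1"
      using F[of i] by (metis abs_mult_self_eq abs_ge_zero mult_le_one)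
  qed simp
  finally have X: "(\<Sum>z\<in>cube N. (X z)\<^sup>2) \<le> real N * 2 ^ N" by simp
  have "(\<Sum>z\<in>cube N. (G z)\<^sup>2) \<le> (\<Sum>z\<in>cube N. 1)"
    using G by (intro sum_mono) (simp add: abs_square_le_1)
  then have G2: "(\<Sum>z\<in>cube N. (G z)\<^sup>2) \<le> 2 ^ N" by (simp add: card_cube)
  have "(\<Sum>z\<in>cube N. G z * X z)\<^sup>2 \<le> (\<Sum>z\<in>cube N. (G z)\<^sup>2) * (\<Sum>z\<in>cube N. (X z)\<^sup>2)"
    by (rule Cauchy_Schwarz_ineq_sum)
  also have "\<dots> \<le> 2 ^ N * (real N * 2 ^ N)"
    using X G2 by (intro mult_mono) (auto intro: sum_nonneg)
  also have "\<dots> = (2 ^ N * sqrt N)\<^sup>2" by (simp add: power_mult_distrib power2_eq_square)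
  finally have "\<bar>\<Sum>z\<in>cube N. G z * X z\<bar> \<le> 2 ^ N * sqrt N"
    by (simp only: abs_le_square_iff[symmetric]) simp
  moreover have "(\<Sum>z\<in>cube N. G z * X z) = (\<Sum>z\<in>cube N. \<Sum>i<N. bit_sign (z ! i) * (F i * G z))"
    by (simp add: X_def sum_distrib_left mult_ac)
  ultimately show ?thesis by simp
qed

text \<open>The signs are balanced over the cube, so the midpoint of the two thresholds cancels and
  every entry contributes half of their gap.\<close>

lemma index_advantage:
  fixes M :: "nat \<Rightarrow> bool list \<Rightarrow> real"
  assumes "\<And>i z. i < N \<Longrightarrow> z \<in> cube N \<Longrightarrow> z ! i \<Longrightarrow> M i z \<ge> c\<^sub>1"
    and "\<And>i z. i < N \<Longrightarrow> z \<in> cube N \<Longrightarrow> \<not> z ! i \<Longrightarrow> M i z \<le> c\<^sub>0"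
  shows "(c\<^sub>1 - c\<^sub>0) / 2 * (real N * 2 ^ N) \<le> (\<Sum>z\<in>cube N. \<Sum>i<N. bit_sign (z ! i) * M i z)"
proof -
  let ?a = "(c\<^sub>1 + c\<^sub>0) / 2" and ?b = "(c\<^sub>1 - c\<^sub>0) / 2"
  have pt: "bit_sign (z ! i) * M i z \<ge> bit_sign (z ! i) * ?a + ?b" if "i < N" "z \<in> cube N" for i z
    using assms[OF that] by (cases "z ! i") (auto simp: bit_sign_def field_simps)
  have one: "(\<Sum>z\<in>cube N. bit_sign (z ! i)) = 0" if "i < N" for i
  proof -
    define g where "g l b = (if l = i then bit_sign b else 1)" for l b
    have "(\<Prod>l<N. g l (z ! l)) = bit_sign (z ! i)" for z
      using that by (simp add: g_def prod.delta if_distrib[of "\<lambda>l. bit_sign l"] cong: if_cong)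
    then have "(\<Sum>z\<in>cube N. bit_sign (z ! i)) = (\<Prod>l<N. g l True + g l False)"
      using sum_cube_prod[of g N] by simp
    also have "\<dots> = 0" using that by (auto simp: g_def bit_sign_def intro!: bexI[of _ i])
    finally show ?thesis .
  qed
  have "(\<Sum>z\<in>cube N. \<Sum>i<N. bit_sign (z ! i) * ?a + ?b) = (\<Sum>i<N. \<Sum>z\<in>cube N. bit_sign (z ! i) * ?a + ?b)"
    by (rule sum.swap)
  also have "\<dots> = (\<Sum>i<N. 2 ^ N * ?b)"
  proof (intro sum.cong refl)
    fix i assume "i \<in> {..<N}"
    then show "(\<Sum>z\<in>cube N. bit_sign (z ! i) * ?a + ?b) = 2 ^ N * ?b"
      unfolding sum.distrib sum_distrib_right[symmetric] by (simp add: one card_cube)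
  qed
  finally have "?b * (real N * 2 ^ N) = (\<Sum>z\<in>cube N. \<Sum>i<N. bit_sign (z ! i) * ?a + ?b)" by simp
  also have "\<dots> \<le> (\<Sum>z\<in>cube N. \<Sum>i<N. bit_sign (z ! i) * M i z)"
    using pt by (intro sum_mono) auto
  finally show ?thesis .
qed

text \<open>Appending the complement of z makes the weight independent of z, and the unit vector at
  i meets the result exactly when bit i is set.\<close>

lemma index_pad:
  assumes z: "z \<in> cube N" and i: "i < N"
  defines "x \<equiv> map (\<lambda>l. l = i) [0..<N] @ replicate N False" and "y \<equiv> z @ map Not z"
  shows "cell True True x y = of_bool (z ! i)" "weight x = 1" "weight y = N" "length x = 2 * N" "length y = 2 * N"
proof -
  have len: "length z = N" using z by (simp add: cube_def)
  show l: "length x = 2 * N" "length y = 2 * N" using len by (auto simp: x_def y_def)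
  have "{l. l < 2 * N \<and> x ! l = True \<and> y ! l = True} = (if z ! i then {i} else {})"
    using i len by (auto simp: x_def y_def nth_append)
  then show "cell True True x y = of_bool (z ! i)"
    using cell_eq_card[OF l, of True True] by simp
  have "{l. l < length x \<and> x ! l = True} = {i}"
    using i len by (auto simp: x_def nth_append)
  then show "weight x = 1" by (simp add: count_list_eq_card)
  have "weight z + weight (map Not z) = length z" by (induction z) auto
  then show "weight y = N" using len by (simp add: y_def)
qed

text \<open>The gadget occupies N or N - 1 coordinates in each of the cells (0,1) and (0,0), so
  these two must be large; the indexed bit decides the side of the jump.\<close>

lemma index_inputs:
  assumes f: "permutation_invariant n f" and j: "jump n f \<alpha> \<beta> \<gamma> \<delta>"
    and N: "N \<le> \<gamma> + 1" "N \<le> \<delta> + 1" and N0: "0 < N"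
  obtains E E' where "\<And>i. i < N \<Longrightarrow> length (E i) = n" "\<And>z. z \<in> cube N \<Longrightarrow> length (E' z) = n"
    "\<And>i z. i < N \<Longrightarrow> z \<in> cube N \<Longrightarrow> f (E i) (E' z) = (cells_val f (Suc \<alpha>) \<beta> \<gamma> (Suc \<delta>) = z ! i)"
proof -
  define E where "E i = (map (\<lambda>l. l = i) [0..<N] @ replicate N False) @ left_input \<alpha> \<beta> (\<gamma> + 1 - N) (\<delta> + 1 - N)" for i
  define E' where "E' z = (z @ map Not z) @ right_input \<alpha> \<beta> (\<gamma> + 1 - N) (\<delta> + 1 - N)" for z
  have n: "\<alpha> + \<beta> + \<gamma> + \<delta> + 2 = n" using j by (simp add: jump_def)
  have l: "length (E i) = n" for i using N n by (simp add: E_def)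
  have l': "length (E' z) = n" if "z \<in> cube N" for z using that N n by (simp add: E'_def cube_def)
  have val: "f (E i) (E' z) = (cells_val f (Suc \<alpha>) \<beta> \<gamma> (Suc \<delta>) = z ! i)" if iz: "i < N" "z \<in> cube N" for i z
  proof -
    note p = index_pad[OF iz(2,1)]
    have 1: "cell True True (E i) (E' z) = of_bool (z ! i) + \<alpha>"
      unfolding E_def E'_def by (subst cell_append) (simp_all only: p cells_inputs)
    have w: "weight (E i) = 1 + (\<alpha> + \<beta>)" "weight (E' z) = N + (\<alpha> + (\<gamma> + 1 - N))"
      unfolding E_def E'_def count_list_append[of "_ @ _" "_ @ _ @ _"] p by (auto simp: count_list_replicate)
    note c = weight_eq_cells[of "E i" "E' z"]
    have "f (E i) (E' z) = (if z ! i then cells_val f (Suc \<alpha>) \<beta> \<gamma> (Suc \<delta>) else cells_val f \<alpha> (Suc \<beta>) (Suc \<gamma>) \<delta>)"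
    proof (cases "z ! i")
      case True
      have "f (E i) (E' z) = cells_val f (Suc \<alpha>) \<beta> \<gamma> (Suc \<delta>)"
      proof (rule cells_val_eqI[OF f l l'[OF iz(2)]])
        show 2: "cell True True (E i) (E' z) = Suc \<alpha>" using 1 True by simp
        show "cell True False (E i) (E' z) = \<beta>" "cell False True (E i) (E' z) = \<gamma>"
          "cell False False (E i) (E' z) = Suc \<delta>"
          using c 2 w N n l[of i] l'[OF iz(2)] by linarith+
      qed
      then show ?thesis using True by simp
    next
      case False
      have "f (E i) (E' z) = cells_val f \<alpha> (Suc \<beta>) (Suc \<gamma>) \<delta>"
      proof (rule cells_val_eqI[OF f l l'[OF iz(2)]])
        show 2: "cell True True (E i) (E' z) = \<alpha>" using 1 False by simp
        show "cell True False (E i) (E' z) = Suc \<beta>" "cell False True (E i) (E' z) = Suc \<gamma>"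
          "cell False False (E i) (E' z) = \<delta>"
          using c 2 w N n l[of i] l'[OF iz(2)] by linarith+
      qed
      then show ?thesis using False by simp
    qed
    then show ?thesis using j by (auto simp: jump_def)
  qed
  show ?thesis using that[of E E'] l l' val by blast
qed

section \<open>Interactive protocols: an exponential bound\<close>

definition index_bound :: "nat \<Rightarrow> nat" where
  "index_bound k = 36 * 4 ^ k"

text \<open>An advantage of N/6 per string stands against a discrepancy of sqrt N per string for
  each of at most 2^k rectangles. So sqrt N \<le> 6 * 2^k, whose square is
  \<open>index_bound\<close>.\<close>

lemma index_two_way:
  assumes f: "pub_cost ow n f k" and j: "jump n f \<alpha> \<beta> \<gamma> \<delta>"
  shows "min \<gamma> \<delta> \<le> index_bound k"
proof -
  interpret prob_space coins by (rule prob_space_coins)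
  define N where "N = min \<gamma> \<delta> + 1"
  have pi: "permutation_invariant n f" using f by (simp add: pub_cost_def)
  obtain P where P: "measurable_protocol P" "computes public_randomness n f P" "cost P \<le> k"
    using f unfolding pub_cost_def by auto
  obtain E E' where E: "\<And>i. i < N \<Longrightarrow> length (E i) = n" "\<And>z. z \<in> cube N \<Longrightarrow> length (E' z) = n"
    "\<And>i z. i < N \<Longrightarrow> z \<in> cube N \<Longrightarrow> f (E i) (E' z) = (cells_val f (Suc \<alpha>) \<beta> \<gamma> (Suc \<delta>) = z ! i)"
    using index_inputs[OF pi j, of N] by (auto simp: N_def)
  define v where "v = cells_val f (Suc \<alpha>) \<beta> \<gamma> (Suc \<delta>)"
  define L where "L F = (\<Sum>z\<in>cube N. \<Sum>i<N. bit_sign (z ! i) * F (E i) (E' z))" for F :: "bool list \<Rightarrow> bool list \<Rightarrow> real"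
  have L1: "\<bar>L (\<lambda>x y. of_bool (run P x y r r))\<bar> \<le> 2 ^ cost P * (2 ^ N * sqrt N)" for r
  proof (rule protocol_rectangle_bound'[where N = "\<lambda>F. \<bar>L F\<bar>"])
    fix F G :: "bool list \<Rightarrow> bool list \<Rightarrow> real"
    have "L (\<lambda>x y. F x y + G x y) = L F + L G" by (simp add: L_def distrib_left sum.distrib)
    then show "\<bar>L (\<lambda>x y. F x y + G x y)\<bar> \<le> \<bar>L F\<bar> + \<bar>L G\<bar>" by simp
  next
    fix F G :: "bool list \<Rightarrow> real"
    assume F: "\<And>x. 0 \<le> F x \<and> F x \<le> 1" and G: "\<And>x. 0 \<le> G x \<and> G x \<le> 1"
    then have "\<bar>F x\<bar> \<le> 1" "\<bar>G x\<bar> \<le> 1" for x by simp_all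
    then show "\<bar>L (\<lambda>x y. F x * G y)\<bar> \<le> 2 ^ N * sqrt N"
      unfolding L_def by (intro index_rectangle)
  qed simp
  have int: "integrable coins (\<lambda>r. L (\<lambda>x y. of_bool (run P x y r r)))"
    unfolding L_def by (intro Bochner_Integration.integrable_sum integrable_mult_right integrable_run P)
  have "L (accept P) = (\<integral>r. L (\<lambda>x y. of_bool (run P x y r r)) \<partial>coins)"
    unfolding L_def accept_def
    by (simp add: Bochner_Integration.integral_sum integrable_run[OF P(1)]
        del: sum_mult_of_bool_eq sum_of_bool_mult_eq)
  also have "\<bar>\<dots>\<bar> \<le> (\<integral>r. \<bar>L (\<lambda>x y. of_bool (run P x y r r))\<bar> \<partial>coins)"
    by (rule integral_abs_bound)
  also have "\<dots> \<le> (\<integral>r. 2 ^ cost P * (2 ^ N * sqrt N) \<partial>coins)"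
    using L1 int by (intro integral_mono) auto
  also have "\<dots> = 2 ^ cost P * (2 ^ N * sqrt N)" using prob_space by simp
  finally have up: "\<bar>L (accept P)\<bar> \<le> 2 ^ cost P * (2 ^ N * sqrt N)" .
  note acc = accept_computes[OF P(1,2) E(1,2)]
  have "1 / 6 * (real N * 2 ^ N) \<le> \<bar>L (accept P)\<bar>"
  proof (cases v)
    case True
    have "(2/3 - 1/3) / 2 * (real N * 2 ^ N) \<le> L (accept P)"
      unfolding L_def by (rule index_advantage) (use True acc E(3) in \<open>auto simp: v_def\<close>)
    then show ?thesis by simp
  next
    case False
    have "(-1/3 - (-2/3)) / 2 * (real N * 2 ^ N) \<le> (\<Sum>z\<in>cube N. \<Sum>i<N. bit_sign (z ! i) * (- accept P (E i) (E' z)))"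
    proof (rule index_advantage)
      fix i z assume iz: "i < N" "z \<in> cube N"
      show "-1/3 \<le> - accept P (E i) (E' z)" if "z ! i"
        using acc(2)[OF iz] E(3)[OF iz] that False by (simp add: v_def)
      show "- accept P (E i) (E' z) \<le> -2/3" if "\<not> z ! i"
        using acc(1)[OF iz] E(3)[OF iz] that False by (simp add: v_def)
    qed
    also have "\<dots> = - L (accept P)" by (simp add: L_def sum_negf)
    finally show ?thesis by simp
  qed
  with up have "1 / 6 * (real N * 2 ^ N) \<le> 2 ^ cost P * (2 ^ N * sqrt N)" by linarith
  then have "sqrt N * sqrt N \<le> (6 * 2 ^ cost P) * sqrt N" by simp
  then have "sqrt N \<le> 6 * 2 ^ cost P"
    using mult_right_le_imp_le[of "sqrt N" "sqrt N"] by (simp add: N_def)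
  also have "\<dots> \<le> 6 * 2 ^ k" using P(3) by (simp add: power_increasing)
  finally have "(sqrt N)\<^sup>2 \<le> (6 * 2 ^ k)\<^sup>2" by (intro power_mono) auto
  then have "real N \<le> 36 * (2 ^ k)\<^sup>2" by (simp add: power_mult_distrib)
  also have "(2 ^ k)\<^sup>2 = (4 ^ k :: real)" by (simp add: power2_eq_square power_mult_distrib[symmetric])
  finally have "real N \<le> real (index_bound k)" by (simp add: index_bound_def)
  then show ?thesis by (simp add: N_def)
qed

section \<open>One-way protocols: a linear bound\<close>

lemma exp_sum_bound:
  assumes s: "0 \<le> s" "s \<le> (1::real)" and m: "m \<in> {0, 1, -1 :: real}"
  shows "exp (s * m) + exp (s * - m) \<le> 2 * exp (s\<^sup>2)"
proof -
  have 1: "exp s \<le> 1 + s + s\<^sup>2" by (rule exp_bound) (use s in auto)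
  have "exp (-s) = 1 / exp s" by (simp add: exp_minus field_simps)
  also have "\<dots> \<le> 1 / (1 + s)" using exp_ge_add_one_self[of s] s by (intro divide_left_mono) auto
  also have "\<dots> \<le> 1 - s + s\<^sup>2"
  proof -
    have "(1 - s + s\<^sup>2) * (1 + s) = 1 + s ^ 3" by (simp add: algebra_simps power2_eq_square power3_eq_cube)
    then show ?thesis using s by (simp add: divide_le_eq)
  qed
  finally have 2: "exp (-s) \<le> 1 - s + s\<^sup>2" .
  have "exp s + exp (-s) \<le> (1 + s + s\<^sup>2) + (1 - s + s\<^sup>2)" by (rule add_mono[OF 1 2])
  also have "\<dots> = 2 * (1 + s\<^sup>2)" by simp
  also have "\<dots> \<le> 2 * exp (s\<^sup>2)" by (intro mult_left_mono exp_ge_add_one_self) simp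
  finally show ?thesis using m by auto
qed

text \<open>Alice's message selects one of \<open>2^c\<close> vectors of guesses.\<close>

lemma one_way_exp_moment:
  assumes "one_way P" and s: "0 \<le> s" "s \<le> (1::real)" and \<sigma>: "\<sigma> \<in> {1, -1 :: real}" and S: "S \<subseteq> cube N"
  shows "(\<Sum>z\<in>S. exp (s * (\<Sum>i<N. bit_sign (z ! i) * (\<sigma> * of_bool (run P (E' z) (E i) r r)))))
     \<le> 2 ^ cost P * (2 * exp (s\<^sup>2)) ^ N"
  using assms(1) S
proof (induction P arbitrary: S)
  case (Bob_Outputs h)
  have "(\<Sum>z\<in>S. exp (s * (\<Sum>i<N. bit_sign (z ! i) * (\<sigma> * of_bool (h (E i) r)))))
     \<le> (\<Sum>z\<in>cube N. exp (s * (\<Sum>i<N. bit_sign (z ! i) * (\<sigma> * of_bool (h (E i) r)))))"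
    by (rule sum_mono2[OF finite_cube Bob_Outputs.prems(2)]) simp
  also have "\<dots> = (\<Sum>z\<in>cube N. \<Prod>i<N. exp (s * (bit_sign (z ! i) * (\<sigma> * of_bool (h (E i) r)))))"
    by (simp add: sum_distrib_left exp_sum del: sum_mult_of_bool_eq sum_of_bool_mult_eq)
  also have "\<dots> = (\<Prod>i<N. exp (s * (bit_sign True * (\<sigma> * of_bool (h (E i) r)))) + exp (s * (bit_sign False * (\<sigma> * of_bool (h (E i) r)))))"
    by (rule sum_cube_prod[of "\<lambda>i b. exp (s * (bit_sign b * (\<sigma> * of_bool (h (E i) r))))"])
  also have "\<dots> \<le> (\<Prod>i<N. 2 * exp (s\<^sup>2))"
  proof (intro prod_mono conjI)
    fix i
    have "\<sigma> * of_bool (h (E i) r) \<in> {0, 1, -1}" using \<sigma> by auto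
    from exp_sum_bound[OF s this]
    show "exp (s * (bit_sign True * (\<sigma> * of_bool (h (E i) r)))) + exp (s * (bit_sign False * (\<sigma> * of_bool (h (E i) r)))) \<le> 2 * exp (s\<^sup>2)"
      by (simp add: bit_sign_def)
  qed (auto intro: add_nonneg_nonneg)
  finally show ?case by simp
next
  case (Alice_Sends h P Q)
  have fin: "finite S" by (rule finite_subset[OF Alice_Sends.prems(2) finite_cube])
  let ?X = "\<lambda>P z. exp (s * (\<Sum>i<N. bit_sign (z ! i) * (\<sigma> * of_bool (run P (E' z) (E i) r r))))"
  let ?m = "max (cost P) (cost Q)" and ?T = "(2 * exp (s\<^sup>2)) ^ N"
  have "S = {z\<in>S. h (E' z) r} \<union> {z\<in>S. \<not> h (E' z) r}" by auto
  then have "(\<Sum>z\<in>S. ?X (Alice_Sends h P Q) z) =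
     (\<Sum>z\<in>{z\<in>S. h (E' z) r} \<union> {z\<in>S. \<not> h (E' z) r}. ?X (Alice_Sends h P Q) z)"
    by (rule arg_cong)
  also have "\<dots> = (\<Sum>z\<in>{z\<in>S. h (E' z) r}. ?X (Alice_Sends h P Q) z) + (\<Sum>z\<in>{z\<in>S. \<not> h (E' z) r}. ?X (Alice_Sends h P Q) z)"
    using fin by (intro sum.union_disjoint) auto
  also have "\<dots> = (\<Sum>z\<in>{z\<in>S. h (E' z) r}. ?X P z) + (\<Sum>z\<in>{z\<in>S. \<not> h (E' z) r}. ?X Q z)"
    by (intro arg_cong2[where f="(+)"] sum.cong) auto
  also have "\<dots> \<le> 2 ^ cost P * ?T + 2 ^ cost Q * ?T"
    using Alice_Sends.prems by (intro add_mono Alice_Sends.IH) auto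
  also have "\<dots> \<le> 2 ^ ?m * ?T + 2 ^ ?m * ?T"
    by (intro add_mono mult_right_mono power_increasing) auto
  finally show ?case by (simp add: algebra_simps)
qed auto

text \<open>Jensen's inequality from the tangent of exp at the mean.\<close>

lemma jensen_exp_cube:
  "exp ((\<Sum>z\<in>cube N. X z) / 2 ^ N) \<le> (\<Sum>z\<in>cube N. exp (X z)) / (2 ^ N :: real)"
proof -
  define a where "a = (\<Sum>z\<in>cube N. X z) / 2 ^ N"
  have "exp a * (1 + (X z - a)) \<le> exp (X z)" for z
  proof -
    have "exp a * (1 + (X z - a)) \<le> exp a * exp (X z - a)"
      by (intro mult_left_mono exp_ge_add_one_self) auto
    then show ?thesis by (simp add: exp_add[symmetric])
  qed
  then have "(\<Sum>z\<in>cube N. exp a * (1 + (X z - a))) \<le> (\<Sum>z\<in>cube N. exp (X z))"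
    by (intro sum_mono)
  also have "(\<Sum>z\<in>cube N. exp a * (1 + (X z - a))) = exp a * (2 ^ N + ((\<Sum>z\<in>cube N. X z) - 2 ^ N * a))"
    by (simp add: sum_distrib_left[symmetric] sum.distrib sum_subtractf card_cube)
  also have "(\<Sum>z\<in>cube N. X z) - 2 ^ N * a = 0" by (simp add: a_def)
  finally show ?thesis by (simp add: a_def field_simps)
qed

text \<open>Here the sender holds the string and the receiver the index, so k bits offer only 2^k
  vectors of guesses. A union bound over them with exponential moments costs k instead of
  2^k.\<close>

lemma index_one_way:
  assumes f: "pub_cost True n f k" and j: "jump n f \<alpha> \<beta> \<gamma> \<delta>"
  shows "min \<beta> \<delta> \<le> 144 * k"
proof -
  interpret prob_space coins by (rule prob_space_coins)
  define N where "N = min \<beta> \<delta> + 1"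
  have pi: "permutation_invariant n f" using f by (simp add: pub_cost_def)
  then have pi': "permutation_invariant n (\<lambda>x y. f y x)" unfolding permutation_invariant_def by metis
  obtain P where P: "one_way P" "measurable_protocol P" "computes public_randomness n f P" "cost P \<le> k"
    using f unfolding pub_cost_def by auto
  define v where "v = cells_val (\<lambda>x y. f y x) (Suc \<alpha>) \<gamma> \<beta> (Suc \<delta>)"
  obtain E E' where E: "\<And>i. i < N \<Longrightarrow> length (E i) = n" "\<And>z. z \<in> cube N \<Longrightarrow> length (E' z) = n"
    "\<And>i z. i < N \<Longrightarrow> z \<in> cube N \<Longrightarrow> f (E' z) (E i) = (v = z ! i)"
    using index_inputs[OF pi' jump_swap[OF pi j], of N] by (auto simp: N_def v_def)
  define \<sigma> where "\<sigma> = bit_sign v"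
  have \<sigma>: "\<sigma> \<in> {1, -1}" by (simp add: \<sigma>_def bit_sign_def)
  define L where "L F = (\<Sum>z\<in>cube N. \<Sum>i<N. bit_sign (z ! i) * (\<sigma> * F (E' z) (E i)))" for F :: "bool list \<Rightarrow> bool list \<Rightarrow> real"
  have L1: "L (\<lambda>x y. of_bool (run P x y r r)) \<le> 2 ^ N * (12 * real k + real N / 12)" for r
  proof -
    define X where "X z = (\<Sum>i<N. bit_sign (z ! i) * (\<sigma> * of_bool (run P (E' z) (E i) r r)))" for z
    \<comment> \<open>For a scale s the mean correlation is at most k/s + sN. With s = 1/12 the term
      sN is half of the advantage N/6, and the other half gives N \<le> 144 k.\<close>
    have "exp ((\<Sum>z\<in>cube N. 1/12 * X z) / 2 ^ N) \<le> (\<Sum>z\<in>cube N. exp (1/12 * X z)) / 2 ^ N"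
      by (rule jensen_exp_cube)
    also have "\<dots> \<le> (2 ^ cost P * (2 * exp ((1/12)\<^sup>2)) ^ N) / 2 ^ N"
      unfolding X_def by (intro divide_right_mono one_way_exp_moment P(1) \<sigma>) auto
    also have "\<dots> = 2 ^ cost P * exp ((1/12)\<^sup>2) ^ N" by (simp add: power_mult_distrib)
    also have "\<dots> \<le> exp 1 ^ k * exp ((1/12)\<^sup>2) ^ N"
    proof (intro mult_right_mono)
      have "(2::real) ^ cost P \<le> 2 ^ k" using P(4) by (intro power_increasing) auto
      also have "\<dots> \<le> exp 1 ^ k" using exp_ge_add_one_self[of 1] by (intro power_mono) auto
      finally show "(2::real) ^ cost P \<le> exp 1 ^ k" .
    qed simp
    also have "\<dots> = exp (real k + real N / 144)"
      by (simp add: exp_of_nat_mult[symmetric] exp_add power2_eq_square)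
    finally have "(\<Sum>z\<in>cube N. 1/12 * X z) / 2 ^ N \<le> real k + real N / 144" by simp
    then have "(\<Sum>z\<in>cube N. X z) \<le> 2 ^ N * (12 * real k + real N / 12)"
      by (simp add: sum_distrib_left[symmetric] sum_divide_distrib[symmetric] field_simps)
    then show ?thesis by (simp only: L_def X_def)
  qed
  have int: "integrable coins (\<lambda>r. L (\<lambda>x y. of_bool (run P x y r r)))"
    unfolding L_def by (intro Bochner_Integration.integrable_sum integrable_mult_right integrable_run P)
  have "L (accept P) = (\<integral>r. L (\<lambda>x y. of_bool (run P x y r r)) \<partial>coins)"
    unfolding L_def accept_def
    by (simp add: Bochner_Integration.integral_sum integrable_run[OF P(2)]
        del: sum_mult_of_bool_eq sum_of_bool_mult_eq)
  also have "\<dots> \<le> (\<integral>r. 2 ^ N * (12 * real k + real N / 12) \<partial>coins)"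
    using L1 int by (intro integral_mono) auto
  also have "\<dots> = 2 ^ N * (12 * real k + real N / 12)" using prob_space by simp
  finally have up: "L (accept P) \<le> 2 ^ N * (12 * real k + real N / 12)" .
  note acc = accept_computes[OF P(2,3) E(2,1)]
  have "1 / 6 * (real N * 2 ^ N) \<le> L (accept P)"
  proof (cases v)
    case True
    have "(2/3 - 1/3) / 2 * (real N * 2 ^ N) \<le> L (accept P)"
      unfolding L_def by (rule index_advantage) (use True acc E(3) in \<open>auto simp: \<sigma>_def bit_sign_def\<close>)
    then show ?thesis by simp
  next
    case False
    have "(-1/3 - (-2/3)) / 2 * (real N * 2 ^ N) \<le> L (accept P)"
      unfolding L_def
    proof (rule index_advantage)
      fix i z assume iz: "i < N" "z \<in> cube N"
      show "-1/3 \<le> \<sigma> * accept P (E' z) (E i)" if "z ! i"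
        using acc(2)[OF iz(2,1)] E(3)[OF iz] that False by (simp add: \<sigma>_def bit_sign_def)
      show "\<sigma> * accept P (E' z) (E i) \<le> -2/3" if "\<not> z ! i"
        using acc(1)[OF iz(2,1)] E(3)[OF iz] that False by (simp add: \<sigma>_def bit_sign_def)
    qed
    then show ?thesis by simp
  qed
  with up have "1 / 6 * (real N * 2 ^ N) \<le> 2 ^ N * (12 * real k + real N / 12)" by (rule order.trans[rotated])
  moreover have "1 / 6 * (real N * 2 ^ N) = 2 ^ N * (real N / 6)" by simp
  ultimately have "2 ^ N * (real N / 6) \<le> 2 ^ N * (12 * real k + real N / 12)" by (simp only:)
  then have "real N / 6 \<le> 12 * real k + real N / 12" by (simp only: mult_le_cancel_left_pos[of "2 ^ N"] zero_less_power zero_less_numeral)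
  then have "real N \<le> real (144 * k)" by simp
  then show ?thesis by (simp add: N_def)
qed

lemma jump_rows:
  assumes f: "pub_cost ow n f k" and j: "jump n f \<alpha> \<beta> \<gamma> \<delta>"
  shows "min \<gamma> \<delta> \<le> index_bound k" "min \<alpha> \<beta> \<le> index_bound k"
proof -
  have pi: "permutation_invariant n f" using f by (simp add: pub_cost_def)
  show "min \<gamma> \<delta> \<le> index_bound k" by (rule index_two_way[OF f j])
  show "min \<alpha> \<beta> \<le> index_bound k"
    by (rule index_two_way[OF pub_cost_Not_left[OF f] jump_Not_left[OF pi j]])
qed

lemma jump_columns_one_way:
  assumes f: "pub_cost True n f k" and j: "jump n f \<alpha> \<beta> \<gamma> \<delta>"
  shows "min \<beta> \<delta> \<le> 144 * k" "min \<alpha> \<gamma> \<le> 144 * k"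
proof -
  have pi: "permutation_invariant n f" using f by (simp add: pub_cost_def)
  show "min \<beta> \<delta> \<le> 144 * k" by (rule index_one_way[OF f j])
  show "min \<alpha> \<gamma> \<le> 144 * k"
    by (rule index_one_way[OF pub_cost_Not_right[OF f] jump_Not_right[OF pi j]])
qed

section \<open>Functions of finitely many random bits\<close>

text \<open>All bits of the simulating protocols read finitely many random bits. This property is
  closed under the constructions below and yields measurability.\<close>

definition finitary :: "((nat \<Rightarrow> 'a) \<Rightarrow> 'b) \<Rightarrow> bool" where
  "finitary h \<longleftrightarrow> (\<exists>I. finite I \<and> (\<forall>z z'. (\<forall>i\<in>I. z i = z' i) \<longrightarrow> h z = h z'))"

lemma finitary_const [intro, simp]: "finitary (\<lambda>z. c)"
  unfolding finitary_def by (intro exI[of _ "{}"]) simp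

lemma finitary_coord [intro, simp]: "finitary (\<lambda>z. z i)"
  unfolding finitary_def by (intro exI[of _ "{i}"]) simp

lemma finitary_comp: "finitary h \<Longrightarrow> finitary (\<lambda>z. g (h z))"
  unfolding finitary_def by metis

lemma finitary_comp2:
  assumes "finitary h" "finitary k"
  shows "finitary (\<lambda>z. F (h z) (k z))"
proof -
  obtain I J where "finite I" "\<And>z z'. (\<forall>i\<in>I. z i = z' i) \<Longrightarrow> h z = h z'"
    "finite J" "\<And>z z'. (\<forall>i\<in>J. z i = z' i) \<Longrightarrow> k z = k z'"
    using assms unfolding finitary_def by metis
  then show ?thesis unfolding finitary_def
    by (intro exI[of _ "I \<union> J"]) (metis UnCI finite_UnI)
qed

lemma finitary_family:
  assumes "finite S" "\<And>j. j \<in> S \<Longrightarrow> finitary (h j)"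
    and cong: "\<And>z z'. (\<And>j. j \<in> S \<Longrightarrow> h j z = h j z') \<Longrightarrow> F z = F z'"
  shows "finitary F"
proof -
  obtain I where I: "\<And>j. j \<in> S \<Longrightarrow> finite (I j)" "\<And>j z z'. j \<in> S \<Longrightarrow> (\<forall>i\<in>I j. z i = z' i) \<Longrightarrow> h j z = h j z'"
    using assms(2) unfolding finitary_def by metis
  show ?thesis unfolding finitary_def
    using assms(1) I by (intro exI[of _ "\<Union>j\<in>S. I j"]) (auto intro!: cong)
qed

lemma finitary_card:
  assumes "finite S" "\<And>j. j \<in> S \<Longrightarrow> finitary (\<lambda>z. Q j z)"
  shows "finitary (\<lambda>z. card {j\<in>S. Q j z})"
  by (rule finitary_family[of S "\<lambda>j z. Q j z"]) (use assms in \<open>auto intro!: arg_cong[where f=card]\<close>)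

lemma finitary_sum:
  assumes "finite S" "\<And>j. j \<in> S \<Longrightarrow> finitary (\<lambda>z. Q j z)"
  shows "finitary (\<lambda>z. \<Sum>j\<in>S. Q j z)"
  by (rule finitary_family[of S "\<lambda>j z. Q j z"]) (use assms in \<open>auto intro!: sum.cong\<close>)

lemma finitary_bex:
  assumes "finite S" "\<And>j. j \<in> S \<Longrightarrow> finitary (\<lambda>z. Q j z)"
  shows "finitary (\<lambda>z. \<exists>j\<in>S. Q j z)"
  by (rule finitary_family[of S "\<lambda>j z. Q j z"]) (use assms in auto)

text \<open>The map factors through the restriction to a finite set of coordinates, where the
  product of countable discrete spaces is discrete.\<close>

lemma measurable_finitary:
  fixes h :: "(nat \<Rightarrow> 'a::countable) \<Rightarrow> 'b"
  assumes h: "finitary h" and M: "\<And>i. sets (M i) = UNIV" and N: "\<And>z. h z \<in> space N"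
  shows "h \<in> PiM UNIV M \<rightarrow>\<^sub>M N"
proof -
  obtain I where I: "finite I" "\<And>z z'. (\<forall>i\<in>I. z i = z' i) \<Longrightarrow> h z = h z'"
    using h unfolding finitary_def by metis
  have "sets (PiM I M) = sets (PiM I (\<lambda>_. count_space (UNIV :: 'a set)))"
    using M by (intro sets_PiM_cong) auto
  also have "PiM I (\<lambda>_. count_space (UNIV :: 'a set)) = count_space (PiE I (\<lambda>_. UNIV))"
    using I(1) by (intro count_space_PiM_finite) auto
  finally have s: "sets (PiM I M) = sets (count_space (PiE I (\<lambda>_. UNIV)))" .
  have "(\<lambda>z. restrict z I) \<in> PiM UNIV M \<rightarrow>\<^sub>M PiM I M" by (rule measurable_restrict_subset) auto
  moreover have "h \<in> PiM I M \<rightarrow>\<^sub>M N"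
    unfolding measurable_cong_sets[OF s refl] using N by simp
  ultimately have "(\<lambda>z. h (restrict z I)) \<in> PiM UNIV M \<rightarrow>\<^sub>M N" by (rule measurable_compose)
  moreover have "(\<lambda>z. h (restrict z I)) = h" by (auto intro!: ext I(2))
  ultimately show ?thesis by simp
qed

lemma measurable_finitary_bits: "finitary h \<Longrightarrow> Measurable.pred bits_space h"
  unfolding bits_space_def by (rule measurable_finitary) auto

section \<open>Correlated randomness\<close>

locale correlated =
  fixes \<rho> :: real
  assumes \<rho>: "0 < \<rho>" "\<rho> < 1"
begin

definition \<mu> :: "(nat \<Rightarrow> bool \<times> bool) measure" where
  "\<mu> = (\<Pi>\<^sub>M i\<in>UNIV. measure_pmf (correlated_pair \<rho>))"

sublocale product_prob_space "\<lambda>_. measure_pmf (correlated_pair \<rho>)" "UNIV :: nat set"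
  by unfold_locales

sublocale prob_space \<mu>
  unfolding \<mu>_def by unfold_locales

lemma space_\<mu> [simp]: "space \<mu> = UNIV"
  by (simp add: \<mu>_def space_PiM)

lemma measurable_\<mu>: "finitary h \<Longrightarrow> (\<And>z. h z \<in> space N) \<Longrightarrow> h \<in> \<mu> \<rightarrow>\<^sub>M N"
  unfolding \<mu>_def by (rule measurable_finitary) auto

lemma events_finitary: "finitary Q \<Longrightarrow> {z. Q z} \<in> events"
  using measurable_\<mu>[of Q "count_space UNIV"] by (simp add: pred_def)

lemma integrable_finitary:
  fixes h :: "_ \<Rightarrow> 'b::{banach, second_countable_topology}"
  assumes "finitary h" "\<And>z. norm (h z) \<le> B"
  shows "integrable \<mu> h"
  by (rule integrable_const_bound[of _ B]) (use assms measurable_\<mu>[of h borel] in auto)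

lemma indep_coords: "indep_vars (\<lambda>_. measure_pmf (correlated_pair \<rho>)) (\<lambda>i z. z i) UNIV"
proof (subst indep_vars_iff_distr_eq_PiM')
  show "distr \<mu> (\<Pi>\<^sub>M i\<in>UNIV. measure_pmf (correlated_pair \<rho>)) (\<lambda>x. \<lambda>i\<in>UNIV. x i) =
    (\<Pi>\<^sub>M i\<in>UNIV. distr \<mu> (measure_pmf (correlated_pair \<rho>)) (\<lambda>z. z i))"
    unfolding \<mu>_def by (subst PiM_component) (auto simp: restrict_UNIV distr_id2 intro!: distr_id[unfolded id_def])
qed (auto simp: \<mu>_def intro!: measurable_component_singleton)

text \<open>Locality suffices: every function of finitely many discrete coordinates is measurable,
  and disjoint sets of coordinates are independent.\<close>

lemma indep_blocks:
  assumes K: "\<And>j. j \<in> J \<Longrightarrow> finite (K j)" "disjoint_family_on K J"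
    and X: "\<And>j z z'. j \<in> J \<Longrightarrow> (\<And>i. i \<in> K j \<Longrightarrow> z i = z' i) \<Longrightarrow> X j z = X j z'"
  shows "indep_vars (\<lambda>_. borel) (\<lambda>j z. X j z :: 'b::topological_space) J"
proof -
  have "indep_vars (\<lambda>j. PiM (K j) (\<lambda>_. measure_pmf (correlated_pair \<rho>))) (\<lambda>j z. restrict (\<lambda>i. z i) (K j)) J"
    by (rule indep_vars_restrict[OF indep_coords _ K(2)]) auto
  then have "indep_vars (\<lambda>_. borel) (\<lambda>j z. X j (restrict (\<lambda>i. z i) (K j))) J"
  proof (rule indep_vars_compose2)
    fix j assume j: "j \<in> J"
    have "sets (PiM (K j) (\<lambda>_. measure_pmf (correlated_pair \<rho>))) = sets (PiM (K j) (\<lambda>_. count_space UNIV))"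
      by (intro sets_PiM_cong) auto
    also have "PiM (K j) (\<lambda>_. count_space (UNIV :: (bool \<times> bool) set)) = count_space (PiE (K j) (\<lambda>_. UNIV))"
      using K(1)[OF j] by (intro count_space_PiM_finite) auto
    finally have s: "sets (PiM (K j) (\<lambda>_. measure_pmf (correlated_pair \<rho>))) = sets (count_space (PiE (K j) (\<lambda>_. UNIV)))" .
    show "X j \<in> borel_measurable (PiM (K j) (\<lambda>_. measure_pmf (correlated_pair \<rho>)))"
      unfolding measurable_cong_sets[OF s refl] by simp
  qed
  moreover have "indep_vars (\<lambda>_. borel) (\<lambda>j z. X j (restrict (\<lambda>i. z i) (K j))) J = indep_vars (\<lambda>_. borel) X J"
    by (rule indep_vars_cong) (auto intro!: X)
  ultimately show ?thesis by simp
qed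

text \<open>The expectation under one correlated pair, over a general field since it serves for
  reals and for complex exponentials.\<close>

definition E\<^sub>2 :: "(bool \<Rightarrow> bool \<Rightarrow> 'b::{real_normed_field, banach, second_countable_topology}) \<Rightarrow> 'b" where
  "E\<^sub>2 g = of_real ((1 + \<rho>) / 4) * (g True True + g False False) + of_real ((1 - \<rho>) / 4) * (g True False + g False True)"

lemma expectation_coord:
  fixes g :: "bool \<times> bool \<Rightarrow> 'b::{real_normed_field, banach, second_countable_topology}"
  shows "(\<integral>z. g (z i) \<partial>\<mu>) = E\<^sub>2 (\<lambda>a b. g (a, b))"
proof -
  have "(\<integral>z. g (z i) \<partial>\<mu>) = (\<integral>w. g w \<partial>distr \<mu> (measure_pmf (correlated_pair \<rho>)) (\<lambda>z. z i))"
    unfolding \<mu>_def by (subst integral_distr) (auto intro!: measurable_component_singleton)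
  also have "\<dots> = (\<integral>w. g w \<partial>measure_pmf (correlated_pair \<rho>))"
    unfolding \<mu>_def by (subst PiM_component) auto
  also have "\<dots> = (\<Sum>w\<in>UNIV. pmf (correlated_pair \<rho>) w *\<^sub>R g w)"
    by (rule integral_measure_pmf) auto
  also have "\<dots> = E\<^sub>2 (\<lambda>a b. g (a, b))"
    unfolding E\<^sub>2_def UNIV_Times_UNIV[symmetric] UNIV_bool using \<rho>
    by (simp add: pmf_correlated_pair scaleR_conv_of_real algebra_simps add_divide_distrib diff_divide_distrib)
  finally show ?thesis .
qed

lemma expectation_prod:
  fixes g :: "nat \<Rightarrow> bool \<times> bool \<Rightarrow> 'b::{real_normed_field, banach, second_countable_topology}"
  assumes I: "finite I"
  shows "(\<integral>z. (\<Prod>i\<in>I. g i (z i)) \<partial>\<mu>) = (\<Prod>i\<in>I. E\<^sub>2 (\<lambda>a b. g i (a, b)))"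
proof -
  have "(\<integral>z. (\<Prod>i\<in>I. g i (z i)) \<partial>\<mu>) = (\<Prod>i\<in>I. \<integral>z. g i (z i) \<partial>\<mu>)"
  proof (rule indep_vars_lebesgue_integral[OF I])
    show "indep_vars (\<lambda>_. borel) (\<lambda>i z. g i (z i)) I"
      by (rule indep_blocks[of _ "\<lambda>i. {i}"]) (auto simp: disjoint_family_on_def)
    fix i assume "i \<in> I"
    show "integrable \<mu> (\<lambda>z. g i (z i))"
    proof (rule integrable_finitary)
      show "norm (g i (z i)) \<le> (\<Sum>w\<in>UNIV. norm (g i w))" for z :: "nat \<Rightarrow> bool \<times> bool"
        by (rule member_le_sum) auto
    qed (rule finitary_comp, simp)
  qed
  then show ?thesis by (simp add: expectation_coord)
qed

abbreviation alice_bits :: "(nat \<Rightarrow> bool \<times> bool) \<Rightarrow> bits" where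
  "alice_bits z \<equiv> (\<lambda>i. fst (z i))"

abbreviation bob_bits :: "(nat \<Rightarrow> bool \<times> bool) \<Rightarrow> bits" where
  "bob_bits z \<equiv> (\<lambda>i. snd (z i))"

lemma finitary_alice: "finitary h \<Longrightarrow> finitary (\<lambda>z. h (alice_bits z))"
  unfolding finitary_def by metis

lemma finitary_bob: "finitary h \<Longrightarrow> finitary (\<lambda>z. h (bob_bits z))"
  unfolding finitary_def by metis

text \<open>Correctness is phrased through a bad event so that union bounds apply directly.\<close>

lemma computes_correlatedI:
  assumes P: "measurable_protocol P"
    and bound: "\<And>x y. length x = n \<Longrightarrow> length y = n \<Longrightarrow>
      \<exists>B. B \<in> events \<and> measure \<mu> B \<le> 1/3 \<and> (\<forall>z. z \<notin> B \<longrightarrow> run P x y (alice_bits z) (bob_bits z) = f x y)"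
  shows "computes (correlated_randomness \<rho>) n f P"
  unfolding computes_def
proof clarify
  fix x y :: "bool list" assume n: "n = length x" and y: "length y = length x"
  have m: "(\<lambda>z. (alice_bits z, bob_bits z)) \<in> \<mu> \<rightarrow>\<^sub>M bits_space \<Otimes>\<^sub>M bits_space"
  proof -
    have "(\<lambda>z i. h (z i)) \<in> \<mu> \<rightarrow>\<^sub>M bits_space" for h :: "bool \<times> bool \<Rightarrow> bool"
      unfolding bits_space_def
      by (rule measurable_PiM_single') (auto intro!: measurable_\<mu>[OF finitary_comp[OF finitary_coord]])
    then show ?thesis by (intro measurable_Pair)
  qed
  have p: "Measurable.pred (bits_space \<Otimes>\<^sub>M bits_space) (\<lambda>z. run P x y (fst z) (snd z) = f x y)"
    using measurable_run[OF P, of x y] by (cases "f x y") auto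
  have eq: "\<P>((r, s) in correlated_randomness \<rho>. run P x y r s = f x y) =
      measure \<mu> {z. run P x y (alice_bits z) (bob_bits z) = f x y}"
    unfolding correlated_randomness_def \<mu>_def[symmetric]
    using p by (subst measure_distr[OF m])
      (auto simp: pred_def case_prod_unfold space_pair_measure intro!: arg_cong[where f="measure \<mu>"])
  obtain B where B: "B \<in> events" "measure \<mu> B \<le> 1/3" "\<And>z. z \<notin> B \<Longrightarrow> run P x y (alice_bits z) (bob_bits z) = f x y"
    using bound[of x y] n y by auto
  have ev: "{z. run P x y (alice_bits z) (bob_bits z) = f x y} \<in> events"
    using measurable_compose[OF m p] by (simp add: pred_def)
  have "2 / 3 \<le> measure \<mu> (space \<mu> - B)" using prob_compl[OF B(1)] B(2) by simp
  also have "\<dots> \<le> measure \<mu> {z. run P x y (alice_bits z) (bob_bits z) = f x y}"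
    using B ev by (intro finite_measure_mono) auto
  finally show "2 / 3 \<le> \<P>((r, s) in correlated_randomness \<rho>. run P x y r s = f x y)" by (simp only: eq)
qed

lemma prob_UN_le:
  assumes "finite S" "\<And>j. j \<in> S \<Longrightarrow> finitary (Q j)" "\<And>j. j \<in> S \<Longrightarrow> measure \<mu> {z. Q j z} \<le> c"
  shows "measure \<mu> {z. \<exists>j\<in>S. Q j z} \<le> real (card S) * c"
proof -
  have "{z. \<exists>j\<in>S. Q j z} = (\<Union>j\<in>S. {z. Q j z})" by auto
  also have "measure \<mu> \<dots> \<le> (\<Sum>j\<in>S. measure \<mu> {z. Q j z})"
    using assms events_finitary by (intro finite_measure_subadditive_finite) auto
  also have "\<dots> \<le> (\<Sum>j\<in>S. c)" using assms(3) by (rule sum_mono)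
  finally show ?thesis by simp
qed

section \<open>Signatures\<close>

text \<open>Element \<open>i\<close> is represented by the bits at positions \<open>sig_pos i j\<close>. These agree in a fraction
  \<open>(1 + \<rho>) / 2\<close> of the positions if both players look at the same element, and in a fraction
  \<open>1 / 2\<close> otherwise.\<close>

definition sig_pos :: "nat \<Rightarrow> nat \<Rightarrow> nat" where
  "sig_pos i j = prod_encode (i, j)"

lemma sig_pos_inj [simp]: "sig_pos i j = sig_pos i' j' \<longleftrightarrow> i = i' \<and> j = j'"
  by (simp add: sig_pos_def prod_encode_eq)

text \<open>The threshold lies halfway between the agreement rates 1/2 and (1 + \<rho>) / 2.\<close>

definition matches :: "nat \<Rightarrow> (nat \<Rightarrow> bool) \<Rightarrow> bits \<Rightarrow> nat \<Rightarrow> bool" where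
  "matches t a s i \<longleftrightarrow> real (card {j\<in>{..<t}. a j = s (sig_pos i j)}) \<ge> (1/2 + \<rho>/4) * real t"

lemma agreement_expectation:
  "(\<integral>z. of_bool (fst (z i) = snd (z i')) \<partial>\<mu>) = (if i = i' then (1 + \<rho>) / 2 else (1/2 :: real))"
proof (cases "i = i'")
  case True
  have "(\<integral>z. of_bool (fst (z i) = snd (z i)) \<partial>\<mu>) = E\<^sub>2 (\<lambda>a b. of_bool (a = b) :: real)"
    using expectation_coord[of "\<lambda>w. of_bool (fst w = snd w) :: real" i] by simp
  then show ?thesis using True by (simp add: E\<^sub>2_def)
next
  case False
  define g where "g j w = (if j = i then bit_sign (fst w) else bit_sign (snd w))" for j :: nat and w :: "bool \<times> bool"
  have pr: "(\<Prod>j\<in>{i, i'}. g j (z j)) = bit_sign (fst (z i)) * bit_sign (snd (z i'))" for z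
    using False by (simp add: g_def)
  have "(\<integral>z. (\<Prod>j\<in>{i, i'}. g j (z j)) \<partial>\<mu>) = (\<Prod>j\<in>{i, i'}. E\<^sub>2 (\<lambda>a b. g j (a, b)))"
    by (rule expectation_prod) simp
  also have "\<dots> = 0" using False by (simp add: g_def E\<^sub>2_def bit_sign_def)
  finally have 0: "(\<integral>z. bit_sign (fst (z i)) * bit_sign (snd (z i')) \<partial>\<mu>) = 0" by (simp only: pr)
  have int: "integrable \<mu> (\<lambda>z. bit_sign (fst (z i)) * bit_sign (snd (z i')))"
  proof (rule integrable_finitary[of _ 1])
    show "finitary (\<lambda>z. bit_sign (fst (z i)) * bit_sign (snd (z i')))"
      by (rule finitary_comp2; rule finitary_comp; simp)
  qed (simp add: bit_sign_def)
  have "of_bool (a = b) = 1/2 + 1/2 * (bit_sign a * bit_sign b)" for a b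
    by (simp add: bit_sign_def)
  then have "(\<integral>z. of_bool (fst (z i) = snd (z i')) \<partial>\<mu>) = (\<integral>z. 1/2 + 1/2 * (bit_sign (fst (z i)) * bit_sign (snd (z i'))) \<partial>\<mu>)"
    by (simp only:)
  also have "\<dots> = 1/2" using int 0 prob_space by (subst Bochner_Integration.integral_add) auto
  finally show ?thesis using False by simp
qed

lemma finitary_agree: "finitary (\<lambda>z. fst (z i) = snd (z i'))"
  by (rule finitary_comp2[where F = "\<lambda>u v. fst u = snd v", OF finitary_coord finitary_coord])

lemma finitary_matches_pair: "finitary (\<lambda>z. matches t (\<lambda>j. fst (z (sig_pos i j))) (bob_bits z) i')"
  unfolding matches_def
  by (rule finitary_comp[where g = "\<lambda>c. (1/2 + \<rho>/4) * real t \<le> real c"], rule finitary_card) (auto intro: finitary_agree)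

text \<open>Hoeffding's inequality with deviation \<rho> t / 4, the distance of the threshold from
  either mean: the exponent is -2 (\<rho> t / 4)^2 / t.\<close>

lemma signature_error:
  assumes t: "t > 0"
  shows "measure \<mu> {z. matches t (\<lambda>j. fst (z (sig_pos i j))) (bob_bits z) i' \<noteq> (i = i')} \<le> exp (- real t * \<rho>\<^sup>2 / 8)"
proof -
  define X where "X j z = (of_bool (fst (z (sig_pos i j)) = snd (z (sig_pos i' j))) :: real)" for j and z :: "nat \<Rightarrow> bool \<times> bool"
  have card: "real (card {j\<in>{..<t}. fst (z (sig_pos i j)) = snd (z (sig_pos i' j))}) = (\<Sum>j<t. X j z)" for z
    by (simp add: X_def sum_of_bool_eq Int_def)
  have ind: "indep_vars (\<lambda>_. borel) X {..<t}"
    by (rule indep_blocks[of _ "\<lambda>j. {sig_pos i j, sig_pos i' j}"]) (auto simp: disjoint_family_on_def X_def)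
  interpret H: Hoeffding_ineq \<mu> "{..<t}" X "\<lambda>_. 0" "\<lambda>_. 1" "\<Sum>j<t. expectation (X j)"
    by unfold_locales (auto simp: ind X_def)
  have mean: "(\<Sum>j<t. expectation (X j)) = real t * (if i = i' then (1 + \<rho>) / 2 else 1/2)"
    unfolding X_def by (simp add: agreement_expectation)
  have fin: "finitary (\<lambda>z. \<Sum>j<t. X j z)"
    unfolding X_def by (rule finitary_sum, simp, rule finitary_comp[where g = of_bool, OF finitary_agree])
  have e: "0 \<le> \<rho> / 4 * real t" using \<rho> by simp
  have s: "(\<Sum>j<t. (1 - 0)\<^sup>2) > (0::real)" using t by simp
  have ex: "exp (-2 * (\<rho> / 4 * real t)\<^sup>2 / (\<Sum>j<t. (1 - 0)\<^sup>2)) = exp (- real t * \<rho>\<^sup>2 / 8)"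
    using t by (simp add: power2_eq_square field_simps)
  show ?thesis
  proof (cases "i = i'")
    case True
    have "measure \<mu> {z. matches t (\<lambda>j. fst (z (sig_pos i j))) (bob_bits z) i' \<noteq> (i = i')}
      \<le> measure \<mu> {z\<in>space \<mu>. (\<Sum>j<t. X j z) \<le> (\<Sum>j<t. expectation (X j)) - \<rho> / 4 * real t}"
      unfolding matches_def card mean using True
      using events_finitary[OF finitary_comp[OF fin, of "\<lambda>v. v \<le> real t * ((1 + \<rho>) / 2) - \<rho> / 4 * real t"]]
      by (intro finite_measure_mono) (auto simp: field_simps)
    also have "\<dots> \<le> exp (- real t * \<rho>\<^sup>2 / 8)" using H.Hoeffding_ineq_le[OF e s] unfolding ex .
    finally show ?thesis .
  next
    case False
    have "measure \<mu> {z. matches t (\<lambda>j. fst (z (sig_pos i j))) (bob_bits z) i' \<noteq> (i = i')}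
      \<le> measure \<mu> {z\<in>space \<mu>. (\<Sum>j<t. X j z) \<ge> (\<Sum>j<t. expectation (X j)) + \<rho> / 4 * real t}"
      unfolding matches_def card mean using False
      using events_finitary[OF finitary_comp[OF fin, of "\<lambda>v. v \<ge> real t * (1 / 2) + \<rho> / 4 * real t"]]
      by (intro finite_measure_mono) (auto simp: field_simps)
    also have "\<dots> \<le> exp (- real t * \<rho>\<^sup>2 / 8)" using H.Hoeffding_ineq_ge[OF e s] unfolding ex .
    finally show ?thesis .
  qed
qed

end

section \<open>Estimating the Hamming distance\<close>

text \<open>Each of the k terms in the quotient of a^k - b^k by a - b is at least b^(k - 1).\<close>

lemma power_diff_lower:
  fixes a b :: real
  assumes "0 \<le> b" "b \<le> a"
  shows "real k * (a - b) * b ^ (k - 1) \<le> a ^ k - b ^ k"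
proof (induction k)
  case (Suc k)
  have "real k * (a - b) * b ^ (k - 1) * b = real k * (a - b) * b ^ k"
    by (cases k) auto
  moreover have "real k * (a - b) * b ^ (k - 1) * b \<le> (a ^ k - b ^ k) * a"
    using Suc assms by (intro mult_mono) (auto intro: power_mono)
  ultimately have "real k * (a - b) * b ^ k \<le> (a ^ k - b ^ k) * a" by (simp only:)
  then show ?case by (simp add: algebra_simps)
qed simp

text \<open>With this many factors the degree is odd, and the tuple correlation \<open>(1 - 2 \<Delta> / n) ^ tuple_len n D\<close>
  still changes by \<open>\<Omega>(1 / D)\<close> between neighbouring distances up to \<open>D\<close>.\<close>

definition tuple_len :: "nat \<Rightarrow> nat \<Rightarrow> nat" where
  "tuple_len n D = 2 * (n div (16 * (D + 2))) + 1"

lemma odd_tuple_len: "odd (tuple_len n D)"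
  by (simp add: tuple_len_def)

text \<open>The difference is at least 4 \<kappa> b^(\<kappa> - 1). The exponent is large enough for
  \<kappa> \<ge> n / (16 (D + 2)), yet small enough for b^(\<kappa> - 1) to keep 3/4 of n^(\<kappa>
  - 1).\<close>

lemma tuple_gap_near:
  assumes \<Delta>: "\<Delta> \<le> D" "\<Delta> + 2 \<le> n"
  defines "\<kappa> \<equiv> tuple_len n D"
  shows "(real n - 2 * real \<Delta>) ^ \<kappa> - (real n - 2 * real \<Delta> - 4) ^ \<kappa> \<ge> 3 / (16 * (real D + 2)) * real n ^ \<kappa>"
proof (cases "n div (16 * (D + 2)) = 0")
  case True
  \<comment> \<open>For small n a single factor is used, and the gap is exactly 4.\<close>
  then have "\<kappa> = 1" by (simp add: \<kappa>_def tuple_len_def)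
  moreover have "n < 16 * (D + 2)" using True by (simp add: div_eq_0_iff)
  then have "real n < real (16 * (D + 2))" by (simp only: of_nat_less_iff)
  then have "3 * real n \<le> 4 * (16 * (real D + 2))" by simp
  then have "3 / (16 * (real D + 2)) * real n \<le> 4" by (simp add: field_simps)
  ultimately show ?thesis by simp
next
  case False
  define d where "d = n div (16 * (D + 2))"
  have \<kappa>: "\<kappa> = 2 * d + 1" by (simp add: \<kappa>_def tuple_len_def d_def)
  have "n < d * (16 * (D + 2)) + 16 * (D + 2)"
    unfolding d_def using dividend_less_div_times[of "16 * (D + 2)" n] by simp
  then have "n \<le> \<kappa> * (16 * (D + 2))" using \<kappa> by (simp add: algebra_simps)
  then have "real n \<le> real (\<kappa> * (16 * (D + 2)))" by (rule of_nat_mono)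
  then have \<kappa>n: "real n / (16 * (real D + 2)) \<le> real \<kappa>" by (simp add: field_simps)
  have dn: "d * (16 * (D + 2)) \<le> n" unfolding d_def by (rule div_times_less_eq_dividend)
  have d1: "d \<ge> 1" using False by (simp add: d_def)
  then have "16 * (D + 2) \<le> n" using dn mult_le_mono1[of 1 d "16 * (D + 2)"] by linarith
  then have "real (16 * (D + 2)) \<le> real n" by (simp only: of_nat_le_iff)
  then have n16: "16 * (real D + 2) \<le> real n" by simp
  have "0 < 16 * (D + 2)" by simp
  then have n0: "real n > 0" using \<open>16 * (D + 2) \<le> n\<close> by linarith
  define a b where "a = real n - 2 * real \<Delta>" and "b = real n - 2 * real \<Delta> - 4"
  have "real \<Delta> \<le> real D" using \<Delta> by simp
  then have b: "real n - 2 * (real D + 2) \<le> b" "b \<le> a" by (simp_all add: a_def b_def)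
  have D0: "real D \<ge> 0" by simp
  have "0 \<le> real n - 2 * (real D + 2)" using n16 D0 by argo
  then have b0: "0 \<le> b" using b(1) by (rule order.trans)
  have "real (d * (16 * (D + 2))) \<le> real n" using dn by (simp only: of_nat_le_iff)
  then have dn': "real d * (16 * (real D + 2)) \<le> real n" by (simp add: add.commute)
  define v where "v = 2 * (real D + 2) / real n"
  have v: "0 \<le> v" "v \<le> 1" using n16 n0 by (auto simp: v_def field_simps)
  have "real (2 * d) * v \<le> 1 / 4" using dn' n0 by (simp add: v_def field_simps)
  then have "3 / 4 \<le> 1 + real (2 * d) * (- v)" by simp
  also have "\<dots> \<le> (1 + - v) ^ (2 * d)" by (rule Bernoulli_inequality) (use v in simp)
  finally have "3 / 4 \<le> (1 - v) ^ (2 * d)" by simp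
  then have "3 / 4 * real n ^ (2 * d) \<le> (1 - v) ^ (2 * d) * real n ^ (2 * d)" by (intro mult_right_mono) auto
  also have "\<dots> = (real n - 2 * (real D + 2)) ^ (2 * d)"
    using n0 by (simp add: power_mult_distrib[symmetric] v_def left_diff_distrib)
  also have "\<dots> \<le> b ^ (2 * d)" using b(1) \<open>0 \<le> real n - 2 * (real D + 2)\<close> by (intro power_mono) auto
  finally have bp: "3 / 4 * real n ^ (2 * d) \<le> b ^ (\<kappa> - 1)" by (simp add: \<kappa>)
  have "3 / (16 * (real D + 2)) * real n ^ \<kappa> = 3 * (real n / (16 * (real D + 2))) * real n ^ (2 * d)"
    by (simp add: \<kappa>)
  also have "\<dots> \<le> 3 * real \<kappa> * real n ^ (2 * d)"
    using \<kappa>n by (intro mult_right_mono mult_left_mono) auto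
  also have "\<dots> = real \<kappa> * 4 * (3 / 4 * real n ^ (2 * d))" by simp
  also have "\<dots> \<le> real \<kappa> * 4 * b ^ (\<kappa> - 1)"
    using bp by (intro mult_left_mono) auto
  also have "\<dots> = real \<kappa> * (a - b) * b ^ (\<kappa> - 1)" by (simp add: a_def b_def)
  also have "\<dots> \<le> a ^ \<kappa> - b ^ \<kappa>" by (rule power_diff_lower[OF b0 b(2)])
  finally show ?thesis by (simp add: a_def b_def)
qed

text \<open>Reflecting \<Delta> to n - (\<Delta> + 2) negates both bases and exchanges them. An odd
  power is antisymmetric, so distances near n are separated as well as distances near 0; this is the
  reason for an odd degree.\<close>

lemma tuple_gap:
  assumes "\<Delta> \<le> D \<or> n - (\<Delta> + 2) \<le> D" "\<Delta> + 2 \<le> n"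
  defines "\<kappa> \<equiv> tuple_len n D"
  shows "(real n - 2 * real \<Delta>) ^ \<kappa> - (real n - 2 * real (\<Delta> + 2)) ^ \<kappa> \<ge> 3 / (16 * (real D + 2)) * real n ^ \<kappa>"
proof (cases "\<Delta> \<le> D")
  case True
  then show ?thesis using tuple_gap_near[of \<Delta> D n] assms(2) by (simp add: \<kappa>_def algebra_simps)
next
  case False
  then have le: "n - (\<Delta> + 2) \<le> D" using assms(1) by blast
  define a b where "a = real n - 2 * real \<Delta>" and "b = real n - 2 * real (\<Delta> + 2)"
  have eq: "real n - 2 * real (n - (\<Delta> + 2)) - 4 = - a" "real n - 2 * real (n - (\<Delta> + 2)) = - b"
    using assms(2) by (auto simp: of_nat_diff a_def b_def)
  have odd: "odd \<kappa>" by (simp add: \<kappa>_def odd_tuple_len)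
  have le2: "n - (\<Delta> + 2) + 2 \<le> n" using assms(2) by simp
  have "3 / (16 * (real D + 2)) * real n ^ \<kappa> \<le> (- b) ^ \<kappa> - (- a) ^ \<kappa>"
    using tuple_gap_near[OF le le2] unfolding eq(1) unfolding eq(2) \<kappa>_def[symmetric] .
  then show ?thesis unfolding power_minus_odd[OF odd] a_def b_def by simp
qed

section \<open>Tensor powers of sign vectors\<close>

definition tuples :: "nat \<Rightarrow> nat \<Rightarrow> nat list set" where
  "tuples n \<kappa> = {\<omega>. set \<omega> \<subseteq> {..<n} \<and> length \<omega> = \<kappa>}"

lemma finite_tuples [simp]: "finite (tuples n \<kappa>)"
  unfolding tuples_def by (rule finite_lists_length_eq) simp

lemma card_tuples: "card (tuples n \<kappa>) = n ^ \<kappa>"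
  unfolding tuples_def by (subst card_lists_length_eq) auto

text \<open>An entry of the \<kappa>-fold tensor power of the sign vector of x; inner products of
  tensor powers are powers of inner products.\<close>

definition tuple_sign :: "bool list \<Rightarrow> nat list \<Rightarrow> real" where
  "tuple_sign x \<omega> = (\<Prod>i\<leftarrow>\<omega>. bit_sign (x ! i))"

lemma tuple_sign_pm: "tuple_sign x \<omega> \<in> {1, -1}"
  by (induction \<omega>) (auto simp: tuple_sign_def bit_sign_def)

lemma sum_tuples_Suc: "(\<Sum>\<omega>\<in>tuples n (Suc \<kappa>). F \<omega>) = (\<Sum>i<n. \<Sum>\<omega>\<in>tuples n \<kappa>. F (i # \<omega>))"
  for F :: "nat list \<Rightarrow> 'a::comm_monoid_add"
proof -
  have eq: "tuples n (Suc \<kappa>) = (\<lambda>(i, \<omega>). i # \<omega>) ` ({..<n} \<times> tuples n \<kappa>)"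
    by (auto simp: tuples_def length_Suc_conv image_iff)
  show ?thesis unfolding eq
    by (subst sum.reindex) (auto simp: inj_on_def sum.cartesian_product case_prod_unfold)
qed

lemma sum_tuple_signs:
  "(\<Sum>\<omega>\<in>tuples n \<kappa>. tuple_sign x \<omega> * tuple_sign y \<omega>) = (\<Sum>i<n. bit_sign (x ! i) * bit_sign (y ! i)) ^ \<kappa>"
proof (induction \<kappa>)
  case 0
  have "tuples n 0 = {[]}" by (auto simp: tuples_def)
  then show ?case by (simp add: tuple_sign_def)
next
  case (Suc \<kappa>)
  have "(\<Sum>\<omega>\<in>tuples n (Suc \<kappa>). tuple_sign x \<omega> * tuple_sign y \<omega>) =
      (\<Sum>i<n. \<Sum>\<omega>\<in>tuples n \<kappa>. (bit_sign (x ! i) * bit_sign (y ! i)) * (tuple_sign x \<omega> * tuple_sign y \<omega>))"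
    unfolding sum_tuples_Suc by (simp add: tuple_sign_def mult_ac)
  also have "\<dots> = (\<Sum>i<n. bit_sign (x ! i) * bit_sign (y ! i)) * (\<Sum>\<omega>\<in>tuples n \<kappa>. tuple_sign x \<omega> * tuple_sign y \<omega>)"
    by (simp add: sum_product)
  finally show ?case by (simp add: Suc.IH)
qed

definition hamming :: "bool list \<Rightarrow> bool list \<Rightarrow> nat" where
  "hamming x y = card {i. i < length x \<and> x ! i \<noteq> y ! i}"

lemma sum_bit_signs:
  "(\<Sum>i<length x. bit_sign (x ! i) * bit_sign (y ! i)) = real (length x) - 2 * real (hamming x y)"
proof -
  have "bit_sign (x ! i) * bit_sign (y ! i) = 1 - 2 * of_bool (x ! i \<noteq> y ! i)" for i
    by (simp add: bit_sign_def)
  then have "(\<Sum>i<length x. bit_sign (x ! i) * bit_sign (y ! i)) = (\<Sum>i<length x. 1 - 2 * of_bool (x ! i \<noteq> y ! i))"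
    by (simp only:)
  also have "\<dots> = real (length x) - 2 * (\<Sum>i<length x. of_bool (x ! i \<noteq> y ! i))"
    by (simp only: sum_subtractf sum_distrib_left) simp
  also have "(\<Sum>i<length x. of_bool (x ! i \<noteq> y ! i)) = real (hamming x y)"
    by (simp add: hamming_def sum_of_bool_eq Int_def)
  finally show ?thesis .
qed

lemma hamming_cells:
  assumes "length x = length y"
  shows "hamming x y + 2 * cell True True x y = weight x + weight y"
proof -
  have "{i. i < length x \<and> x ! i \<noteq> y ! i} =
      {i. i < length x \<and> x ! i = True \<and> y ! i = False} \<union> {i. i < length x \<and> x ! i = False \<and> y ! i = True}" by auto
  then have "hamming x y = cell True False x y + cell False True x y"
    unfolding hamming_def using assms
    by (simp only: cell_eq_card[of x "length x" y]) (subst card_Un_disjoint; auto)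
  then show ?thesis using weight_eq_cells[OF assms] by simp
qed

definition positive_tuples :: "nat \<Rightarrow> bool list \<Rightarrow> bool list \<Rightarrow> nat" where
  "positive_tuples \<kappa> x y = card {\<omega> \<in> tuples (length x) \<kappa>. tuple_sign x \<omega> = tuple_sign y \<omega>}"

text \<open>Both sides are the inner product of the tensor powers: agreeing minus disagreeing tuples
  on the left, a power of the original inner product on the right.\<close>

lemma positive_tuples_eq:
  "2 * real (positive_tuples \<kappa> x y) - real (length x) ^ \<kappa> = (real (length x) - 2 * real (hamming x y)) ^ \<kappa>"
proof -
  have "tuple_sign x \<omega> * tuple_sign y \<omega> = 2 * of_bool (tuple_sign x \<omega> = tuple_sign y \<omega>) - 1" for \<omega>
    using tuple_sign_pm[of x \<omega>] tuple_sign_pm[of y \<omega>] by auto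
  then have "(\<Sum>\<omega>\<in>tuples (length x) \<kappa>. tuple_sign x \<omega> * tuple_sign y \<omega>) =
      (\<Sum>\<omega>\<in>tuples (length x) \<kappa>. 2 * of_bool (tuple_sign x \<omega> = tuple_sign y \<omega>) - 1)"
    by (simp only:)
  also have "\<dots> = 2 * (\<Sum>\<omega>\<in>tuples (length x) \<kappa>. of_bool (tuple_sign x \<omega> = tuple_sign y \<omega>)) - real (card (tuples (length x) \<kappa>))"
    by (simp only: sum_subtractf sum_distrib_left) simp
  also have "(\<Sum>\<omega>\<in>tuples (length x) \<kappa>. of_bool (tuple_sign x \<omega> = tuple_sign y \<omega>)) = real (positive_tuples \<kappa> x y)"
    by (simp add: positive_tuples_def sum_of_bool_eq Int_def)
  finally show ?thesis unfolding sum_tuple_signs sum_bit_signs by (simp add: card_tuples)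
qed

lemma positive_tuples_le: "positive_tuples \<kappa> x y \<le> length x ^ \<kappa>"
  unfolding positive_tuples_def card_tuples[symmetric] by (rule card_mono) auto

text \<open>Scaled so that each of N independent signs damps the characteristic function by a factor
  1 - O(1/N): the product over all signs stays bounded below while a single sign still has an effect
  of order 1/N.\<close>

definition angle :: "nat \<Rightarrow> real" where
  "angle N = arccos (1 - 1 / (2 * real N)) / 2"

lemma cos_angle: "N > 0 \<Longrightarrow> cos (2 * angle N) = 1 - 1 / (2 * real N)"
  by (simp add: angle_def field_simps)

lemma cis_sum: "cis (\<Sum>i\<in>S. f i) = (\<Prod>i\<in>S. cis (f i))"
  by (induction S rule: infinite_finite_induct) (auto simp flip: cis_mult)

context correlated
begin

text \<open>The damping factors for one tuple. The exponent is 0 when the signed bits coincide and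
  twice the angle, up to sign, otherwise; the latter has probability (1 - \<rho>) / 2 when the tuple
  signs agree and (1 + \<rho>) / 2 when they do not.\<close>

definition \<open>factor_eq N = 1 - (1 - \<rho>) / 2 * (1 / (2 * real N))\<close>
definition \<open>factor_ne N = 1 - (1 + \<rho>) / 2 * (1 / (2 * real N))\<close>

text \<open>The expectation of the product of sines when \<open>p\<close> of the \<open>N\<close> tuple signs agree.\<close>

definition sine_mean :: "nat \<Rightarrow> nat \<Rightarrow> real" where
  "sine_mean N p = (factor_eq N ^ p * factor_ne N ^ (N - p) - factor_ne N ^ p * factor_eq N ^ (N - p)) / 2"

lemma factors:
  assumes "N > 0"
  shows "0 < factor_ne N" "factor_ne N \<le> factor_eq N" "factor_eq N - factor_ne N = \<rho> / (2 * real N)"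
    "1/2 \<le> factor_ne N ^ N" "factor_ne N \<le> 1"
proof -
  have N: "real N \<ge> 1" using assms by simp
  have lb: "1 - 1 / (2 * real N) \<le> factor_ne N" unfolding factor_ne_def using \<rho> N by (simp add: field_simps)
  moreover have "1 - 1 / (2 * real N) \<ge> 1/2" using N by (simp add: field_simps)
  ultimately show "0 < factor_ne N" by linarith
  show "factor_ne N \<le> factor_eq N" unfolding factor_ne_def factor_eq_def using \<rho> N by (simp add: field_simps)
  show "factor_ne N \<le> 1" unfolding factor_ne_def using \<rho> N by (simp add: field_simps)
  show "factor_eq N - factor_ne N = \<rho> / (2 * real N)" unfolding factor_ne_def factor_eq_def using N by (simp add: field_simps)
  have "1/2 = 1 + real N * (- (1 / (2 * real N)))" using N by (simp add: field_simps)
  also have "\<dots> \<le> (1 + - (1 / (2 * real N))) ^ N" by (rule Bernoulli_inequality) (use N in \<open>simp add: field_simps\<close>)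
  also have "\<dots> \<le> factor_ne N ^ N" using lb N by (intro power_mono) (auto simp: field_simps)
  finally show "1/2 \<le> factor_ne N ^ N" .
qed

text \<open>One more agreement replaces a smaller factor by a larger one in the minuend and
  conversely in the subtrahend, so both changes help. The common product is at least
  \<open>factor_ne N ^ N\<close>, hence at least 1/2, and 1/2 * 1/2 * \<rho> / (2N) is the
  gain.\<close>

lemma sine_mean_step:
  assumes "N > 0" "p < N"
  shows "sine_mean N p + \<rho> / (8 * real N) \<le> sine_mean N (Suc p)"
proof -
  define a b where "a = factor_eq N" and "b = factor_ne N"
  note F = factors[OF assms(1), folded a_def b_def]
  obtain q where q: "N - p = Suc q" "N - Suc p = q" using assms(2) by (metis Suc_diff_Suc)
  have "b ^ N \<le> b ^ (p + q)" using F q assms by (intro power_decreasing) auto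
  also have "\<dots> \<le> a ^ p * b ^ q" unfolding power_add using F by (intro mult_right_mono power_mono) auto
  finally have "1/2 \<le> a ^ p * b ^ q" using F(4) by linarith
  then have "1/2 * (\<rho> / (2 * real N)) \<le> a ^ p * b ^ q * (a - b)"
    unfolding F(3) using \<rho> by (intro mult_right_mono) auto
  moreover have "0 \<le> b ^ p * a ^ q * (a - b)" using F(1,2) by (intro mult_nonneg_nonneg zero_le_power) auto
  moreover have "sine_mean N (Suc p) - sine_mean N p = (a ^ p * b ^ q * (a - b) + b ^ p * a ^ q * (a - b)) / 2"
    unfolding sine_mean_def q a_def[symmetric] b_def[symmetric] by (simp add: field_simps)
  moreover have "\<rho> / (8 * real N) = 1/2 * (1/2 * (\<rho> / (2 * real N)))" by simp
  moreover have "u + 1/2 * c \<le> v" if "c \<le> X" "0 \<le> Y" "v - u = (X + Y) / 2" for c u v X Y :: real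
    using that by simp
  ultimately show ?thesis by metis
qed

lemma sine_mean_gap:
  assumes "N > 0" "p \<le> p'" "p' \<le> N"
  shows "sine_mean N p + real (p' - p) * (\<rho> / (8 * real N)) \<le> sine_mean N p'"
  using assms(2,3)
proof (induction p' rule: dec_induct)
  case (step m)
  then show ?case using sine_mean_step[OF assms(1), of m]
    by (simp add: Suc_diff_le distrib_right add_divide_distrib)
qed simp

section \<open>The sine statistic and its expectation\<close>

definition est_pos :: "nat \<Rightarrow> nat list \<Rightarrow> nat" where
  "est_pos j \<omega> = prod_encode (j, list_encode \<omega>)"

lemma est_pos_inj [simp]: "est_pos j \<omega> = est_pos j' \<omega>' \<longleftrightarrow> j = j' \<and> \<omega> = \<omega>'"
  by (simp add: est_pos_def prod_encode_eq list_encode_eq)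

text \<open>Boundedness makes Hoeffding's inequality applicable, and the mean of a product of two
  sines is available in closed form through characteristic functions, without Gaussian
  approximation.\<close>

definition sine_stat :: "nat \<Rightarrow> bool list \<Rightarrow> bits \<Rightarrow> nat \<Rightarrow> real" where
  "sine_stat \<kappa> x r j = sin (angle (length x ^ \<kappa>) *
     (\<Sum>\<omega>\<in>tuples (length x) \<kappa>. tuple_sign x \<omega> * bit_sign (r (est_pos j \<omega>))))"

lemma finitary_sine_stat: "finitary (\<lambda>r. sine_stat \<kappa> x r j)"
proof -
  have "finitary (\<lambda>r. \<Sum>\<omega>\<in>tuples (length x) \<kappa>. tuple_sign x \<omega> * bit_sign (r (est_pos j \<omega>)))"
    by (rule finitary_sum, simp, rule finitary_comp[where g = "\<lambda>b. tuple_sign x _ * bit_sign b", OF finitary_coord])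
  from finitary_comp[OF this, where g = "\<lambda>v. sin (angle (length x ^ \<kappa>) * v)"] show ?thesis
    unfolding sine_stat_def .
qed

lemma E2_cis:
  assumes N: "N > 0" and u: "u \<in> {1, -1}" and v: "v \<in> {1, -1 :: real}"
  shows "E\<^sub>2 (\<lambda>a b. cis (angle N * (u * bit_sign a - v * bit_sign b))) =
    of_real (if u = v then factor_eq N else factor_ne N)"
proof -
  have c: "cis (angle N * 2) + cis (- (angle N * 2)) = of_real (2 * (1 - 1 / (2 * real N)))"
    using cos_angle[OF N] by (simp add: complex_eq_iff mult.commute)
  have c': "cis (- (angle N * 2)) + cis (angle N * 2) = of_real (2 * (1 - 1 / (2 * real N)))"
    using c by (simp add: add.commute)
  consider "u = 1" "v = 1" | "u = 1" "v = -1" | "u = -1" "v = 1" | "u = -1" "v = -1" using u v by auto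
  then show ?thesis
    by cases (simp_all add: E\<^sub>2_def bit_sign_def factor_eq_def factor_ne_def c c' complex_eq_iff,
      simp_all add: field_simps N)
qed

text \<open>The complex exponential turns the linear forms into a product over tuples, each factor
  reading its own correlated pair. The sign e covers the difference (e = 1) and the sum (e = -1) of
  the two forms.\<close>

lemma expectation_cos_diff:
  fixes x y :: "bool list" and e :: real and \<kappa> j :: nat
  assumes len: "length x > 0" "length y = length x" and e: "e \<in> {1, -1 :: real}"
  defines "N \<equiv> length x ^ \<kappa>" and "p \<equiv> card {\<omega> \<in> tuples (length x) \<kappa>. tuple_sign x \<omega> = e * tuple_sign y \<omega>}"
  shows "(\<integral>z. cos (angle N * (\<Sum>\<omega>\<in>tuples (length x) \<kappa>. tuple_sign x \<omega> * bit_sign (fst (z (est_pos j \<omega>))))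
      - e * (angle N * (\<Sum>\<omega>\<in>tuples (length x) \<kappa>. tuple_sign y \<omega> * bit_sign (snd (z (est_pos j \<omega>)))))) \<partial>\<mu>)
     = factor_eq N ^ p * factor_ne N ^ (N - p)"
proof -
  define T where "T = tuples (length x) \<kappa>"
  have T: "finite T" "card T = N" by (simp_all add: T_def N_def card_tuples)
  have N0: "N > 0" using len by (simp add: N_def)
  define h where "h \<omega> w = cis (angle N * (tuple_sign x \<omega> * bit_sign (fst w) - e * tuple_sign y \<omega> * bit_sign (snd w)))"
    for \<omega> and w :: "bool \<times> bool"
  \<comment> \<open>The product formula is indexed by bit positions, so the tuple is decoded from
    its position.\<close>
  define g where "g i = h (list_decode (snd (prod_decode i)))" for i
  have g: "g (est_pos j \<omega>) = h \<omega>" for \<omega> by (simp add: g_def est_pos_def)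
  have inj: "inj_on (est_pos j) T" by (auto simp: inj_on_def)
  have cis_eq: "cis (angle N * (\<Sum>\<omega>\<in>T. tuple_sign x \<omega> * bit_sign (fst (z (est_pos j \<omega>))))
      - e * (angle N * (\<Sum>\<omega>\<in>T. tuple_sign y \<omega> * bit_sign (snd (z (est_pos j \<omega>)))))) = (\<Prod>i\<in>est_pos j ` T. g i (z i))" for z
  proof -
    have "angle N * (\<Sum>\<omega>\<in>T. tuple_sign x \<omega> * bit_sign (fst (z (est_pos j \<omega>))))
      - e * (angle N * (\<Sum>\<omega>\<in>T. tuple_sign y \<omega> * bit_sign (snd (z (est_pos j \<omega>))))) =
      (\<Sum>\<omega>\<in>T. angle N * (tuple_sign x \<omega> * bit_sign (fst (z (est_pos j \<omega>))) - e * tuple_sign y \<omega> * bit_sign (snd (z (est_pos j \<omega>)))))"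
      by (simp add: sum_distrib_left sum_subtractf right_diff_distrib mult_ac)
    then show ?thesis by (simp add: cis_sum h_def prod.reindex[OF inj] g)
  qed
  have "(\<integral>z. (\<Prod>i\<in>est_pos j ` T. g i (z i)) \<partial>\<mu>) = (\<Prod>i\<in>est_pos j ` T. E\<^sub>2 (\<lambda>a b. g i (a, b)))"
    by (rule expectation_prod) (simp add: T)
  also have "\<dots> = (\<Prod>\<omega>\<in>T. E\<^sub>2 (\<lambda>a b. h \<omega> (a, b)))" by (simp add: prod.reindex[OF inj] g)
  also have "\<dots> = (\<Prod>\<omega>\<in>T. of_real (if tuple_sign x \<omega> = e * tuple_sign y \<omega> then factor_eq N else factor_ne N))"
  proof (intro prod.cong refl)
    fix \<omega>
    have "e * tuple_sign y \<omega> \<in> {1, -1}" using e tuple_sign_pm[of y \<omega>] by auto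
    from E2_cis[OF N0 tuple_sign_pm this, of x \<omega>]
    show "E\<^sub>2 (\<lambda>a b. h \<omega> (a, b)) = of_real (if tuple_sign x \<omega> = e * tuple_sign y \<omega> then factor_eq N else factor_ne N)"
      by (simp add: h_def mult.assoc)
  qed
  also have "\<dots> = of_real (\<Prod>\<omega>\<in>T. if tuple_sign x \<omega> = e * tuple_sign y \<omega> then factor_eq N else factor_ne N)"
    by simp
  also have "(\<Prod>\<omega>\<in>T. if tuple_sign x \<omega> = e * tuple_sign y \<omega> then factor_eq N else factor_ne N) =
      factor_eq N ^ p * factor_ne N ^ (N - p)"
  proof -
    have "card (T \<inter> - {\<omega>. tuple_sign x \<omega> = e * tuple_sign y \<omega>}) = N - p"
    proof -
      have "T \<inter> - {\<omega>. tuple_sign x \<omega> = e * tuple_sign y \<omega>} = T - {\<omega> \<in> T. tuple_sign x \<omega> = e * tuple_sign y \<omega>}" by auto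
      then show ?thesis using T by (simp add: card_Diff_subset p_def T_def[symmetric])
    qed
    then show ?thesis using T by (simp add: prod.If_cases p_def T_def[symmetric] Int_def)
  qed
  finally have prod: "(\<integral>z. (\<Prod>i\<in>est_pos j ` T. g i (z i)) \<partial>\<mu>) = of_real (factor_eq N ^ p * factor_ne N ^ (N - p))" .
  have int: "integrable \<mu> (\<lambda>z. \<Prod>i\<in>est_pos j ` T. g i (z i))"
  proof (rule integrable_finitary)
    show "finitary (\<lambda>z. \<Prod>i\<in>est_pos j ` T. g i (z i))"
      unfolding finitary_def by (intro exI[of _ "est_pos j ` T"]) (auto simp: T intro!: prod.cong)
    show "norm (\<Prod>i\<in>est_pos j ` T. g i (z i)) \<le> 1" for z
      unfolding cis_eq[symmetric] by simp
  qed
  have "(\<integral>z. Re (\<Prod>i\<in>est_pos j ` T. g i (z i)) \<partial>\<mu>) = Re (of_real (factor_eq N ^ p * factor_ne N ^ (N - p)))"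
    unfolding prod[symmetric] using int by (rule integral_Re)
  then show ?thesis unfolding cis_eq[symmetric] T_def[symmetric] by simp
qed

text \<open>sin A sin B = (cos (A - B) - cos (A + B)) / 2, and in A + B the agreeing and the
  disagreeing tuples exchange roles.\<close>

lemma expectation_sine_product:
  assumes len: "length x > 0" "length y = length x"
  shows "(\<integral>z. sine_stat \<kappa> x (alice_bits z) j * sine_stat \<kappa> y (bob_bits z) j \<partial>\<mu>)
    = sine_mean (length x ^ \<kappa>) (positive_tuples \<kappa> x y)"
proof -
  define N where "N = length x ^ \<kappa>"
  define T where "T = tuples (length x) \<kappa>"
  define A where "A z = angle N * (\<Sum>\<omega>\<in>T. tuple_sign x \<omega> * bit_sign (fst (z (est_pos j \<omega>))))" for z :: "nat \<Rightarrow> bool \<times> bool"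
  define B where "B z = angle N * (\<Sum>\<omega>\<in>T. tuple_sign y \<omega> * bit_sign (snd (z (est_pos j \<omega>))))" for z :: "nat \<Rightarrow> bool \<times> bool"
  define p where "p = positive_tuples \<kappa> x y"
  have T: "finite T" "card T = N" by (simp_all add: T_def N_def card_tuples)
  have p: "p = card {\<omega> \<in> T. tuple_sign x \<omega> = tuple_sign y \<omega>}" by (simp add: p_def positive_tuples_def T_def)
  have ne: "card {\<omega> \<in> T. tuple_sign x \<omega> = -1 * tuple_sign y \<omega>} = N - p"
  proof -
    have "{\<omega> \<in> T. tuple_sign x \<omega> = -1 * tuple_sign y \<omega>} = T - {\<omega> \<in> T. tuple_sign x \<omega> = tuple_sign y \<omega>}"
    proof -
      have "(tuple_sign x \<omega> = -1 * tuple_sign y \<omega>) = (tuple_sign x \<omega> \<noteq> tuple_sign y \<omega>)" for \<omega>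
        using tuple_sign_pm[of x \<omega>] tuple_sign_pm[of y \<omega>] by auto
      then show ?thesis by auto
    qed
    then show ?thesis using T by (simp add: card_Diff_subset p)
  qed
  have pN: "p \<le> N" unfolding p_def N_def by (rule positive_tuples_le)
  have m: "(\<integral>z. cos (A z - 1 * B z) \<partial>\<mu>) = factor_eq N ^ p * factor_ne N ^ (N - p)"
    unfolding A_def B_def N_def T_def p by (subst expectation_cos_diff) (use len in auto)
  have pl: "(\<integral>z. cos (A z - (-1) * B z) \<partial>\<mu>) = factor_eq N ^ (N - p) * factor_ne N ^ (N - (N - p))"
    unfolding A_def B_def using expectation_cos_diff[OF len, of "-1" \<kappa> j] ne unfolding N_def T_def by simp
  have fin: "finitary A" "finitary B"
    unfolding A_def B_def
    by (rule finitary_comp[where g = "\<lambda>v. angle N * v"], rule finitary_sum[OF T(1)],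
        rule finitary_comp[where g = "\<lambda>w. tuple_sign x _ * bit_sign (fst w)", OF finitary_coord])
       (rule finitary_comp[where g = "\<lambda>v. angle N * v"], rule finitary_sum[OF T(1)],
        rule finitary_comp[where g = "\<lambda>w. tuple_sign y _ * bit_sign (snd w)", OF finitary_coord])
  have int: "integrable \<mu> (\<lambda>z. cos (A z - c * B z))" for c
    by (rule integrable_finitary[of _ 1], rule finitary_comp2[where F = "\<lambda>a b. cos (a - c * b)", OF fin]) simp
  have "(\<integral>z. sine_stat \<kappa> x (alice_bits z) j * sine_stat \<kappa> y (bob_bits z) j \<partial>\<mu>) = (\<integral>z. sin (A z) * sin (B z) \<partial>\<mu>)"
    by (simp add: sine_stat_def A_def B_def N_def T_def len)
  also have "\<dots> = (\<integral>z. (cos (A z - 1 * B z) - cos (A z - (-1) * B z)) / 2 \<partial>\<mu>)"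
    by (simp add: sin_times_sin)
  also have "\<dots> = ((\<integral>z. cos (A z - 1 * B z) \<partial>\<mu>) - (\<integral>z. cos (A z - (-1) * B z) \<partial>\<mu>)) / 2"
    using int[of 1] int[of "-1"] by simp
  also have "\<dots> = sine_mean N p" unfolding m pl sine_mean_def using pN by (simp add: mult.commute)
  finally show ?thesis by (simp add: N_def p_def)
qed

lemma sine_stat_bound: "\<bar>sine_stat \<kappa> x r j\<bar> \<le> 1"
  by (simp add: sine_stat_def)

text \<open>Hoeffding's inequality for J independent samples in an interval of length 2.\<close>

lemma estimate_error:
  assumes len: "length x > 0" "length y = length x" and \<epsilon>: "\<epsilon> > 0" and J: "J > 0"
  shows "measure \<mu> {z. \<bar>(\<Sum>j<J. sine_stat \<kappa> x (alice_bits z) j * sine_stat \<kappa> y (bob_bits z) j) / real J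
      - sine_mean (length x ^ \<kappa>) (positive_tuples \<kappa> x y)\<bar> \<ge> \<epsilon>} \<le> 2 * exp (- real J * \<epsilon>\<^sup>2 / 2)"
proof -
  define X where "X j z = sine_stat \<kappa> x (alice_bits z) j * sine_stat \<kappa> y (bob_bits z) j" for j z
  define m where "m = sine_mean (length x ^ \<kappa>) (positive_tuples \<kappa> x y)"
  have Xb: "\<bar>X j z\<bar> \<le> 1" for j z
    unfolding X_def abs_mult by (intro mult_le_one sine_stat_bound) auto
  have ind: "indep_vars (\<lambda>_. borel) X {..<J}"
    by (rule indep_blocks[of _ "\<lambda>j. est_pos j ` tuples (length x) \<kappa>"])
      (auto simp: disjoint_family_on_def X_def sine_stat_def len intro!: arg_cong2[where f="(*)"] arg_cong[where f=sin] sum.cong)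
  interpret H: Hoeffding_ineq \<mu> "{..<J}" X "\<lambda>_. -1" "\<lambda>_. 1" "\<Sum>j<J. expectation (X j)"
    using Xb by unfold_locales (auto simp: ind abs_le_iff)
  have mean: "(\<Sum>j<J. expectation (X j)) = real J * m"
    unfolding X_def by (simp add: expectation_sine_product[OF len] m_def)
  have s: "(\<Sum>j<J. (1 - (-1))\<^sup>2) = 4 * real J" by simp
  have "measure \<mu> {z\<in>space \<mu>. \<bar>(\<Sum>j<J. X j z) - real J * m\<bar> \<ge> real J * \<epsilon>} \<le> 2 * exp (-2 * (real J * \<epsilon>)\<^sup>2 / (4 * real J))"
    using H.Hoeffding_ineq_abs_ge[of "real J * \<epsilon>"] \<epsilon> J unfolding mean s by simp
  also have "-2 * (real J * \<epsilon>)\<^sup>2 / (4 * real J) = - real J * \<epsilon>\<^sup>2 / 2" using J by (simp add: power2_eq_square)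
  also have "{z\<in>space \<mu>. \<bar>(\<Sum>j<J. X j z) - real J * m\<bar> \<ge> real J * \<epsilon>} = {z. \<bar>(\<Sum>j<J. X j z) / real J - m\<bar> \<ge> \<epsilon>}"
  proof -
    have "\<bar>S / real J - m\<bar> * real J = \<bar>S - real J * m\<bar>" for S
      using J by (simp add: abs_mult_pos field_simps)
    then have "(real J * \<epsilon> \<le> \<bar>S - real J * m\<bar>) = (\<epsilon> \<le> \<bar>S / real J - m\<bar>)" for S
      using J by (metis mult.commute mult_le_cancel_right_pos of_nat_0_less_iff)
    then show ?thesis by simp
  qed
  finally show ?thesis by (simp add: X_def m_def)
qed

end

section \<open>Quantization of the sender's samples by threshold bits\<close>

definition quant :: "nat \<Rightarrow> (nat \<Rightarrow> bool) \<Rightarrow> real" where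
  "quant q b = -1 + 2 * real (card {i\<in>{..<q}. b i}) / real q"

text \<open>The number of thresholds below v is the floor of (v + 1) q / 2, so decoding rounds v
  down to a grid of width 2/q.\<close>

lemma quant_error:
  assumes v: "-1 \<le> v" "v \<le> 1" and q: "q > 0"
  shows "\<bar>quant q (\<lambda>i. v \<ge> -1 + 2 * (real i + 1) / real q) - v\<bar> \<le> 2 / real q"
proof -
  define w where "w = (v + 1) * real q / 2"
  have w: "0 \<le> w" using v by (simp add: w_def)
  have "(v + 1) * real q \<le> 2 * real q" using v by (intro mult_right_mono) auto
  then have w': "w \<le> real q" by (simp add: w_def)
  have "(v \<ge> -1 + 2 * (real i + 1) / real q) = (real i + 1 \<le> w)" for i
    using q by (simp add: w_def field_simps)
  then have "{i\<in>{..<q}. v \<ge> -1 + 2 * (real i + 1) / real q} = {i. i < q \<and> real i + 1 \<le> w}" by auto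
  also have "\<dots> = {..<nat \<lfloor>w\<rfloor>}"
  proof -
    have "(i < q \<and> real i + 1 \<le> w) = (i < nat \<lfloor>w\<rfloor>)" for i
    proof -
      have "(i < nat \<lfloor>w\<rfloor>) = (real (Suc i) \<le> w)"
        using w by (simp add: Suc_le_eq[symmetric] le_nat_iff le_floor_iff del: Suc_le_eq)
      then show ?thesis using w' by auto
    qed
    then show ?thesis by auto
  qed
  finally have "quant q (\<lambda>i. v \<ge> -1 + 2 * (real i + 1) / real q) = -1 + 2 * real (nat \<lfloor>w\<rfloor>) / real q"
    by (simp add: quant_def)
  moreover have "v = -1 + 2 * w / real q" using q by (simp add: w_def field_simps)
  ultimately have "quant q (\<lambda>i. v \<ge> -1 + 2 * (real i + 1) / real q) - v = 2 * (real (nat \<lfloor>w\<rfloor>) - w) / real q"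
    by (simp only: diff_divide_distrib right_diff_distrib)
  moreover have "\<bar>real (nat \<lfloor>w\<rfloor>) - w\<bar> \<le> 1" using w by linarith
  ultimately show ?thesis using q by (simp add: abs_mult divide_right_mono)
qed

section \<open>Few random strings suffice for a small set of inputs\<close>

text \<open>The strings are chosen one at a time so that the potential \<open>\<Sum>z. (21/20) ^ (errors on z)\<close>
  grows by a factor of at most \<open>61/60\<close> in each step.\<close>

lemma few_strings_list:
  fixes wrong :: "'r \<Rightarrow> 'z \<Rightarrow> bool"
  assumes M: "prob_space M" and Z: "finite Z"
    and meas: "\<And>z. z \<in> Z \<Longrightarrow> Measurable.pred M (\<lambda>r. wrong r z)"
    and err: "\<And>z. z \<in> Z \<Longrightarrow> measure M {r\<in>space M. wrong r z} \<le> 1/3"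
  shows "\<exists>rs. length rs = T \<and>
    (\<Sum>z\<in>Z. (21/20) ^ length (filter (\<lambda>r. wrong r z) rs)) \<le> real (card Z) * (61/60 :: real) ^ T"
proof (induction T)
  case (Suc T)
  interpret prob_space M by (rule M)
  obtain rs where rs: "length rs = T"
    "(\<Sum>z\<in>Z. (21/20) ^ length (filter (\<lambda>r. wrong r z) rs)) \<le> real (card Z) * (61/60 :: real) ^ T"
    using Suc by blast
  define W where "W z = (21/20 :: real) ^ length (filter (\<lambda>r. wrong r z) rs)" for z
  define F where "F r = (\<Sum>z\<in>Z. W z * (1 + 1/20 * indicator {r\<in>space M. wrong r z} r))" for r
  have ev: "{r\<in>space M. wrong r z} \<in> events" if "z \<in> Z" for z
    using meas[OF that] by (simp add: pred_def)
  have int: "integrable M (\<lambda>r. W z * (1 + 1/20 * indicator {r\<in>space M. wrong r z} r))" if "z \<in> Z" for z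
    using ev[OF that] by (intro integrable_mult_right Bochner_Integration.integrable_add) (auto simp: emeasure_eq_measure)
  have intF: "integrable M F" unfolding F_def by (rule Bochner_Integration.integrable_sum[OF int])
  have "expectation F = (\<Sum>z\<in>Z. \<integral>r. W z * (1 + 1/20 * indicator {r\<in>space M. wrong r z} r) \<partial>M)"
    unfolding F_def by (rule Bochner_Integration.integral_sum[OF int])
  also have "\<dots> = (\<Sum>z\<in>Z. W z * (1 + 1/20 * measure M {r\<in>space M. wrong r z}))"
  proof (intro sum.cong refl)
    fix z assume z: "z \<in> Z"
    have "(\<integral>r. 1 + 1/20 * indicator {r\<in>space M. wrong r z} r \<partial>M) = 1 + 1/20 * measure M {r\<in>space M. wrong r z}"
      using ev[OF z] prob_space by (subst Bochner_Integration.integral_add) (auto simp: emeasure_eq_measure)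
    then show "(\<integral>r. W z * (1 + 1/20 * indicator {r\<in>space M. wrong r z} r) \<partial>M) = W z * (1 + 1/20 * measure M {r\<in>space M. wrong r z})"
      by simp
  qed
  also have "\<dots> \<le> (\<Sum>z\<in>Z. W z * (61/60))"
  proof (intro sum_mono mult_left_mono)
    fix z assume "z \<in> Z"
    then show "1 + 1/20 * measure M {r\<in>space M. wrong r z} \<le> 61/60" using err[of z] by linarith
  qed (simp add: W_def)
  also have "\<dots> \<le> real (card Z) * (61/60) ^ Suc T"
    using rs(2) unfolding W_def[symmetric] sum_distrib_right[symmetric] by simp
  finally have E: "expectation F \<le> real (card Z) * (61/60) ^ Suc T" .
  have "\<exists>r\<in>space M. F r \<le> expectation F"
  proof (rule ccontr)
    assume "\<not> (\<exists>r\<in>space M. F r \<le> expectation F)"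
    then have "AE r in M. expectation F < F r" by (intro AE_I2) (simp add: not_le)
    then have "expectation F < expectation F" by (rule expectation_greater[OF intF])
    then show False by simp
  qed
  then obtain r where r: "r \<in> space M" "F r \<le> real (card Z) * (61/60) ^ Suc T" using E by fastforce
  have "(\<Sum>z\<in>Z. (21/20 :: real) ^ length (filter (\<lambda>r. wrong r z) (r # rs))) = F r"
    unfolding F_def W_def using r(1) by (intro sum.cong refl) (auto simp: indicator_def)
  then show ?case using r rs(1) by (intro exI[of _ "r # rs"]) simp
qed (intro exI[of _ "[]"], simp)

text \<open>More than a fraction 11/32 of wrong strings at a single point would already exceed the
  bound on the whole potential. The number of strings 2^w is a multiple of 32 as w \<ge> 5.\<close>

lemma few_strings:
  fixes wrong :: "'r \<Rightarrow> 'z \<Rightarrow> bool"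
  assumes M: "prob_space M" and Z: "finite Z"
    and meas: "\<And>z. z \<in> Z \<Longrightarrow> Measurable.pred M (\<lambda>r. wrong r z)"
    and err: "\<And>z. z \<in> Z \<Longrightarrow> measure M {r\<in>space M. wrong r z} \<le> 1/3"
    and w: "w \<ge> 5" and big: "real (card Z) \<le> (1007/1000) ^ (2 ^ (w - 5))"
  shows "\<exists>str. \<forall>z\<in>Z. real (card {v\<in>cube w. wrong (str v) z}) \<le> 11/32 * 2 ^ w"
proof -
  define L where "L = (2::nat) ^ (w - 5)"
  have "(2::nat) ^ w = 2 ^ (5 + (w - 5))" using w by simp
  then have T: "32 * L = 2 ^ w" unfolding power_add L_def by simp
  obtain rs where rs: "length rs = 32 * L"
    "(\<Sum>z\<in>Z. (21/20) ^ length (filter (\<lambda>r. wrong r z) rs)) \<le> real (card Z) * (61/60 :: real) ^ (32 * L)"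
    using few_strings_list[of M Z wrong "32 * L", OF M Z meas err] by auto
  have few: "length (filter (\<lambda>r. wrong r z) rs) \<le> 11 * L" if z: "z \<in> Z" for z
  proof (rule ccontr)
    assume "\<not> ?thesis"
    then have "(21/20::real) ^ (11 * L) < (21/20) ^ length (filter (\<lambda>r. wrong r z) rs)"
      by (intro power_strict_increasing) auto
    also have "\<dots> \<le> (\<Sum>z\<in>Z. (21/20) ^ length (filter (\<lambda>r. wrong r z) rs))"
      using z Z by (intro member_le_sum) auto
    also have "\<dots> \<le> real (card Z) * (61/60) ^ (32 * L)" by (rule rs(2))
    also have "\<dots> \<le> (1007/1000) ^ L * (61/60) ^ (32 * L)"
      using big by (intro mult_right_mono) (auto simp: L_def)
    also have "\<dots> = (1007/1000 * (61/60) ^ 32) ^ L" by (simp only: power_mult power_mult_distrib)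
    \<comment> \<open>Numerically 1.007 * (61/60)^32 is just below (21/20)^11. This fixes the
      fraction 11/32, slightly above 1/3, and the growth rate 1.007.\<close>
    also have "\<dots> \<le> ((21/20) ^ 11) ^ L" by (intro power_mono) (simp_all add: power_divide)
    also have "\<dots> = (21/20) ^ (11 * L)" by (simp only: power_mult)
    finally show False by simp
  qed
  obtain b where b: "bij_betw b (cube w) {..<32 * L}"
    using ex_bij_betw_finite_nat[OF finite_cube, of w] by (auto simp: card_cube T atLeast0LessThan)
  have "real (card {v\<in>cube w. wrong (rs ! b v) z}) \<le> 11/32 * 2 ^ w" if z: "z \<in> Z" for z
  proof -
    have "card {v\<in>cube w. wrong (rs ! b v) z} = card (b ` {v\<in>cube w. wrong (rs ! b v) z})"
      using b by (intro card_image[symmetric]) (auto simp: bij_betw_def inj_on_def)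
    also have "b ` {v\<in>cube w. wrong (rs ! b v) z} = {i. i < length rs \<and> wrong (rs ! i) z}"
    proof -
      have "{i. i < length rs \<and> wrong (rs ! i) z} = {i \<in> b ` cube w. wrong (rs ! i) z}"
        using b rs(1) by (simp add: bij_betw_def lessThan_def)
      then show ?thesis by auto
    qed
    also have "card \<dots> = length (filter (\<lambda>r. wrong r z) rs)" by (simp add: length_filter_conv_card)
    also have "\<dots> \<le> 11 * L" by (rule few[OF z])
    finally have "real (card {v\<in>cube w. wrong (rs ! b v) z}) \<le> real (11 * L)" by (rule of_nat_mono)
    also have "\<dots> = 11/32 * real (32 * L)" by simp
    also have "real (32 * L) = 2 ^ w" unfolding T by simp
    finally show ?thesis .
  qed
  then show ?thesis by (intro exI[of _ "\<lambda>v. rs ! b v"]) auto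
qed

section \<open>Choosing strings by private random words\<close>

lemma prod_of_bool_all: "finite A \<Longrightarrow> (\<Prod>i\<in>A. of_bool (P i)) = (of_bool (\<forall>i\<in>A. P i) :: real)"
  by (induction A rule: finite_induct) auto

lemma finitary_word: "finitary (\<lambda>z. map (\<lambda>l. fst (z (m + l))) [0..<w])"
  unfolding finitary_def by (intro exI[of _ "{m..<m + w}"]) auto

context correlated
begin

lemma prob_word:
  assumes v: "v \<in> cube w"
  shows "(\<integral>z. of_bool (map (\<lambda>l. fst (z (m + l))) [0..<w] = v) \<partial>\<mu>) = (1 / 2 ^ w :: real)"
proof -
  have len: "length v = w" using v by (simp add: cube_def)
  define g where "g i u = (of_bool (fst u = v ! (i - m)) :: real)" for i and u :: "bool \<times> bool"
  have "(of_bool (map (\<lambda>l. fst (z (m + l))) [0..<w] = v) :: real) = (\<Prod>i\<in>(+) m ` {..<w}. g i (z i))" for z :: "nat \<Rightarrow> bool \<times> bool"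
  proof -
    have "(map (\<lambda>l. fst (z (m + l))) [0..<w] = v) = (\<forall>l\<in>{..<w}. fst (z (m + l)) = v ! l)"
      using len by (auto simp: list_eq_iff_nth_eq)
    then show ?thesis by (simp add: prod.reindex g_def prod_of_bool_all)
  qed
  then have "(\<integral>z. of_bool (map (\<lambda>l. fst (z (m + l))) [0..<w] = v) \<partial>\<mu>) = (\<Prod>i\<in>(+) m ` {..<w}. E\<^sub>2 (\<lambda>a b. g i (a, b)))"
    by (simp add: expectation_prod)
  also have "\<dots> = (\<Prod>i\<in>(+) m ` {..<w}. 1 / 2)"
    by (intro prod.cong refl) (auto simp: g_def E\<^sub>2_def of_bool_def field_simps)
  also have "\<dots> = 1 / 2 ^ w" by (simp add: card_image power_divide)
  finally show ?thesis .
qed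

lemma prob_word_in:
  "(\<integral>z. of_bool (Q (map (\<lambda>l. fst (z (m + l))) [0..<w])) \<partial>\<mu>) = real (card {v\<in>cube w. Q v}) / 2 ^ w"
proof -
  have int: "integrable \<mu> (\<lambda>z. of_bool (map (\<lambda>l. fst (z (m + l))) [0..<w] = v) :: real)" for v
  proof (rule integrable_finitary[of _ 1])
    show "finitary (\<lambda>z. of_bool (map (\<lambda>l. fst (z (m + l))) [0..<w] = v) :: real)"
      by (rule finitary_comp[where g = "\<lambda>u. of_bool (u = v)", OF finitary_word])
  qed simp
  have "(of_bool (Q (map (\<lambda>l. fst (z (m + l))) [0..<w])) :: real) =
    (\<Sum>v\<in>{v\<in>cube w. Q v}. of_bool (map (\<lambda>l. fst (z (m + l))) [0..<w] = v))" for z :: "nat \<Rightarrow> bool \<times> bool"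
  proof -
    have "map (\<lambda>l. fst (z (m + l))) [0..<w] \<in> cube w" by (simp add: cube_def)
    then show ?thesis by (simp add: of_bool_def sum.delta)
  qed
  then have "(\<integral>z. (of_bool (Q (map (\<lambda>l. fst (z (m + l))) [0..<w])) :: real) \<partial>\<mu>) =
    (\<integral>z. (\<Sum>v\<in>{v\<in>cube w. Q v}. of_bool (map (\<lambda>l. fst (z (m + l))) [0..<w] = v)) \<partial>\<mu>)"
    by (simp only:)
  also have "\<dots> = (\<Sum>v\<in>{v\<in>cube w. Q v}. 1 / 2 ^ w)"
    by (subst Bochner_Integration.integral_sum[OF int]) (auto intro!: sum.cong simp: prob_word)
  finally show ?thesis by simp
qed

text \<open>One random string may err with probability 11/32, more than allowed. The majority of
  three errs with probability below 0.274, which leaves room for the other failures.\<close>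

definition majority :: "bool \<Rightarrow> bool \<Rightarrow> bool \<Rightarrow> bool" where
  "majority a b c \<longleftrightarrow> a \<and> b \<or> a \<and> c \<or> b \<and> c"

text \<open>The constant is \<open>3 p^2 - 2 p^3\<close> at \<open>p = 11/32\<close>.\<close>

lemma majority_error:
  fixes Q :: "bool list \<Rightarrow> bool"
  assumes Q: "real (card {v\<in>cube w. Q v}) \<le> 11/32 * 2 ^ w"
  defines "X \<equiv> \<lambda>k z. Q (map (\<lambda>l. fst (z (k * w + l))) [0..<w])"
  shows "measure \<mu> {z. majority (X 0 z) (X 1 z) (X 2 z)} \<le> 8954 / 32768"
proof -
  define p where "p = real (card {v\<in>cube w. Q v}) / 2 ^ w"
  have p: "0 \<le> p" "p \<le> 11/32" using Q by (auto simp: p_def field_simps)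
  define Y where "Y k z = (of_bool (X k z) :: real)" for k z
  have EY: "(\<integral>z. Y k z \<partial>\<mu>) = p" for k
    unfolding Y_def X_def p_def by (rule prob_word_in)
  have fin: "finitary (Y k)" for k
    unfolding Y_def X_def by (rule finitary_comp[where g = "\<lambda>u. of_bool (Q u)", OF finitary_word])
  have intY: "integrable \<mu> (Y k)" for k
    by (rule integrable_finitary[OF fin, of _ 1]) (simp add: Y_def)
  have prod: "integrable \<mu> (\<lambda>z. \<Prod>k\<in>S. Y k z) \<and> (\<integral>z. (\<Prod>k\<in>S. Y k z) \<partial>\<mu>) = p ^ card S" if "finite S" for S
  proof -
    have "indep_vars (\<lambda>_. borel) Y S"
    proof (rule indep_blocks[of _ "\<lambda>k. {k * w..<k * w + w}"])
      show "disjoint_family_on (\<lambda>k. {k * w..<k * w + w}) S"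
        unfolding disjoint_family_on_def
      proof (intro ballI impI)
        fix i j :: nat assume "i \<noteq> j"
        then have "i * w + w \<le> j * w \<or> j * w + w \<le> i * w"
          using mult_le_mono1[of "Suc i" j w] mult_le_mono1[of "Suc j" i w] by (cases "i < j") auto
        then show "{i * w..<i * w + w} \<inter> {j * w..<j * w + w} = {}" by auto
      qed
      show "Y k z = Y k z'" if "k \<in> S" "\<And>i. i \<in> {k * w..<k * w + w} \<Longrightarrow> z i = z' i" for k z z'
      proof -
        have "map (\<lambda>l. fst (z (k * w + l))) [0..<w] = map (\<lambda>l. fst (z' (k * w + l))) [0..<w]"
          using that(2) by auto
        then show ?thesis by (simp only: Y_def X_def)
      qed
    qed simp
    from indep_vars_lebesgue_integral[OF that this intY] indep_vars_integrable[OF that this intY]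
    show ?thesis by (simp add: EY)
  qed
  note pr = prod[of "{0, 1}", simplified] prod[of "{0, 2}", simplified] prod[of "{1, 2}", simplified]
    prod[of "{0, 1, 2}", simplified]
  have ev: "{z. majority (X 0 z) (X 1 z) (X 2 z)} \<in> events"
  proof (rule events_finitary)
    have *: "finitary (X k)" for k
      unfolding X_def by (rule finitary_comp[where g = Q, OF finitary_word])
    show "finitary (\<lambda>z. majority (X 0 z) (X 1 z) (X 2 z))"
      by (rule finitary_family[of "{0,1,2}" X]) (auto simp: *)
  qed
  have "measure \<mu> {z. majority (X 0 z) (X 1 z) (X 2 z)} = (\<integral>z. indicator {z. majority (X 0 z) (X 1 z) (X 2 z)} z \<partial>\<mu>)"
    using ev by simp
  also have "\<dots> = (\<integral>z. Y 0 z * Y 1 z + Y 0 z * Y 2 z + Y 1 z * Y 2 z - 2 * (Y 0 z * (Y 1 z * Y 2 z)) \<partial>\<mu>)"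
    by (intro Bochner_Integration.integral_cong) (auto simp: Y_def majority_def indicator_def)
  also have "\<dots> = p\<^sup>2 + p\<^sup>2 + p\<^sup>2 - 2 * p ^ 3"
    using pr by (simp add: numeral_2_eq_2 numeral_3_eq_3)
  also have "\<dots> = p\<^sup>2 * (3 - 2 * p)" by (simp add: power2_eq_square power3_eq_cube algebra_simps)
  also have "\<dots> \<le> 8954 / 32768"
  proof -
    \<comment> \<open>Monotonicity of 3 p^2 - 2 p^3: the difference of its values at 11/32 and at p,
      factored.\<close>
    have "0 \<le> (11/32 - p) * (3 * (11/32 + p) - 2 * ((11/32)\<^sup>2 + 11/32 * p + p\<^sup>2))"
    proof (rule mult_nonneg_nonneg)
      have "p\<^sup>2 \<le> (11/32)\<^sup>2" using p by (intro power_mono) auto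
      then show "0 \<le> 3 * (11/32 + p) - 2 * ((11/32)\<^sup>2 + 11/32 * p + p\<^sup>2)" using p by (simp add: power2_eq_square)
    qed (use p in simp)
    also have "\<dots> = (11/32)\<^sup>2 * (3 - 2 * (11/32)) - p\<^sup>2 * (3 - 2 * p)"
      by (simp add: power2_eq_square field_simps)
    finally show ?thesis by (simp add: power2_eq_square)
  qed
  finally show ?thesis .
qed

end

section \<open>Building protocols\<close>

text \<open>The output of the simulated protocol reaches the continuation as a function of Bob's input.\<close>

fun derand :: "bits \<Rightarrow> (bool list \<Rightarrow> bool list) \<Rightarrow> protocol \<Rightarrow> ((bool list \<Rightarrow> bool) \<Rightarrow> protocol) \<Rightarrow> protocol" where
  "derand r \<phi> (Alice_Outputs h) \<kappa> = Alice_Sends (\<lambda>x _. h (\<phi> x) r) (\<kappa> (\<lambda>_. True)) (\<kappa> (\<lambda>_. False))"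
| "derand r \<phi> (Bob_Outputs h) \<kappa> = \<kappa> (\<lambda>y. h (\<phi> y) r)"
| "derand r \<phi> (Alice_Sends h P Q) \<kappa> = Alice_Sends (\<lambda>x _. h (\<phi> x) r) (derand r \<phi> P \<kappa>) (derand r \<phi> Q \<kappa>)"
| "derand r \<phi> (Bob_Sends h P Q) \<kappa> = Bob_Sends (\<lambda>y _. h (\<phi> y) r) (derand r \<phi> P \<kappa>) (derand r \<phi> Q \<kappa>)"

lemma run_derand:
  "\<exists>h. run (derand r \<phi> P \<kappa>) x y r' s' = run (\<kappa> h) x y r' s' \<and> h y = run P (\<phi> x) (\<phi> y) r r"
  by (induction P) auto

text \<open>The extra bit is Alice announcing the output at a leaf of hers, so that Bob can continue
  with it.\<close>

lemma cost_derand: "(\<And>h. cost (\<kappa> h) \<le> c) \<Longrightarrow> cost (derand r \<phi> P \<kappa>) \<le> cost P + 1 + c"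
proof (induction P)
  case (Alice_Sends h P Q)
  then show ?case using le_max_iff_disj by (auto simp: le_max_iff_disj)
next
  case (Bob_Sends h P Q)
  then show ?case by (auto simp: le_max_iff_disj)
next
  case (Bob_Outputs h)
  then show ?case using le_SucI by (metis add.commute cost.simps(2) derand.simps(2) plus_1_eq_Suc add_0)
qed (auto simp: le_SucI)

lemma one_way_derand: "one_way P \<Longrightarrow> (\<And>h. one_way (\<kappa> h)) \<Longrightarrow> one_way (derand r \<phi> P \<kappa>)"
  by (induction P) auto

lemma measurable_derand: "(\<And>h. measurable_protocol (\<kappa> h)) \<Longrightarrow> measurable_protocol (derand r \<phi> P \<kappa>)"
  by (induction P) auto

text \<open>Queries outside \<open>qs\<close> reach the continuation as answered by \<open>False\<close>.\<close>

fun answers :: "'q list \<Rightarrow> (bool list \<Rightarrow> bits \<Rightarrow> 'q \<Rightarrow> bool) \<Rightarrow> (('q \<Rightarrow> bool) \<Rightarrow> protocol) \<Rightarrow> protocol" where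
  "answers [] m \<kappa> = \<kappa> (\<lambda>_. False)"
| "answers (q # qs) m \<kappa> = Alice_Sends (\<lambda>x r. m x r q)
     (answers qs m (\<lambda>g. \<kappa> (g(q := True)))) (answers qs m (\<lambda>g. \<kappa> (g(q := False))))"

lemma run_answers:
  "run (answers qs m \<kappa>) x y r s = run (\<kappa> (\<lambda>q. q \<in> set qs \<and> m x r q)) x y r s"
proof (induction qs arbitrary: \<kappa>)
  case (Cons q qs)
  have "(\<lambda>p. p \<in> set qs \<and> m x r p)(q := m x r q) = (\<lambda>p. p \<in> set (q # qs) \<and> m x r p)"
    by (auto simp: fun_eq_iff)
  then show ?case by (cases "m x r q") (simp_all add: Cons.IH)
qed simp

lemma cost_answers: "(\<And>g. cost (\<kappa> g) \<le> c) \<Longrightarrow> cost (answers qs m \<kappa>) \<le> length qs + c"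
  by (induction qs arbitrary: \<kappa>) auto

lemma one_way_answers: "(\<And>g. one_way (\<kappa> g)) \<Longrightarrow> one_way (answers qs m \<kappa>)"
  by (induction qs arbitrary: \<kappa>) auto

lemma measurable_answers:
  assumes "\<And>x q. finitary (\<lambda>r. m x r q)" "\<And>g. measurable_protocol (\<kappa> g)"
  shows "measurable_protocol (answers qs m \<kappa>)"
  using assms(2) by (induction qs arbitrary: \<kappa>) (auto intro!: measurable_finitary_bits assms(1))

fun bob_answers :: "'q list \<Rightarrow> (bool list \<Rightarrow> bits \<Rightarrow> 'q \<Rightarrow> bool) \<Rightarrow> (('q \<Rightarrow> bool) \<Rightarrow> protocol) \<Rightarrow> protocol" where
  "bob_answers [] m \<kappa> = \<kappa> (\<lambda>_. False)"
| "bob_answers (q # qs) m \<kappa> = Bob_Sends (\<lambda>y s. m y s q)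
     (bob_answers qs m (\<lambda>g. \<kappa> (g(q := True)))) (bob_answers qs m (\<lambda>g. \<kappa> (g(q := False))))"

lemma run_bob_answers:
  "run (bob_answers qs m \<kappa>) x y r s = run (\<kappa> (\<lambda>q. q \<in> set qs \<and> m y s q)) x y r s"
proof (induction qs arbitrary: \<kappa>)
  case (Cons q qs)
  have "(\<lambda>p. p \<in> set qs \<and> m y s p)(q := m y s q) = (\<lambda>p. p \<in> set (q # qs) \<and> m y s p)"
    by (auto simp: fun_eq_iff)
  then show ?case by (cases "m y s q") (simp_all add: Cons.IH)
qed simp

lemma cost_bob_answers: "(\<And>g. cost (\<kappa> g) \<le> c) \<Longrightarrow> cost (bob_answers qs m \<kappa>) \<le> length qs + c"
  by (induction qs arbitrary: \<kappa>) auto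

lemma measurable_bob_answers:
  assumes "\<And>x q. finitary (\<lambda>r. m x r q)" "\<And>g. measurable_protocol (\<kappa> g)"
  shows "measurable_protocol (bob_answers qs m \<kappa>)"
  using assms(2) by (induction qs arbitrary: \<kappa>) (auto intro!: measurable_finitary_bits assms(1))

section \<open>The simulating protocols\<close>

text \<open>The flag u says whether the input is complemented: \<open>pos False x\<close> is the set
  of ones, \<open>pos True x\<close> the set of zeros.\<close>

definition pos :: "bool \<Rightarrow> bool list \<Rightarrow> nat set" where
  "pos u x = {i. i < length x \<and> x ! i \<noteq> u}"

lemma finite_pos [simp]: "finite (pos u x)"
  by (simp add: pos_def)

lemma card_pos: "card (pos False x) = weight x" "card (pos True x) = length x - weight x"
proof -
  show 1: "card (pos False x) = weight x" by (simp add: pos_def count_list_eq_card)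
  have "card ({..<length x} - pos False x) = card {..<length x} - card (pos False x)"
    by (rule card_Diff_subset) (auto simp: pos_def)
  moreover have "{..<length x} - pos False x = pos True x" by (auto simp: pos_def)
  ultimately show "card (pos True x) = length x - weight x" by (simp add: 1)
qed

lemma weight_le_length: "weight x \<le> length x"
  by (rule count_le_length)

lemma card_pos_Int:
  assumes "length x = n" "length y = n"
  shows "card (pos u x \<inter> pos v y) = cell (\<not> u) (\<not> v) x y"
proof -
  have "pos u x \<inter> pos v y = {i. i < n \<and> x ! i = (\<not> u) \<and> y ! i = (\<not> v)}"
    using assms by (auto simp: pos_def)
  then show ?thesis by (simp add: cell_eq_card[OF assms])
qed

definition extreme :: "nat \<Rightarrow> bool list \<Rightarrow> bool" where
  "extreme W x \<longleftrightarrow> weight x \<le> W \<or> length x - weight x \<le> W"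

definition support :: "nat \<Rightarrow> bool list \<Rightarrow> nat set" where
  "support W x = pos (\<not> weight x \<le> W) x"

lemma finite_support [simp]: "finite (support W x)"
  by (simp add: support_def)

lemma card_support: "extreme W x \<Longrightarrow> card (support W x) \<le> W"
  by (cases "weight x \<le> W") (simp_all add: support_def extreme_def card_pos)

definition jump_at :: "nat \<Rightarrow> (bool list \<Rightarrow> bool list \<Rightarrow> bool) \<Rightarrow> bool list \<Rightarrow> bool list \<Rightarrow>
    nat \<Rightarrow> nat \<Rightarrow> nat \<Rightarrow> nat \<Rightarrow> bool" where
  "jump_at n f x y \<alpha> \<beta> \<gamma> \<delta> \<longleftrightarrow>
     jump n f \<alpha> \<beta> \<gamma> \<delta> \<and> \<alpha> + \<beta> + 1 = weight x \<and> \<alpha> + \<gamma> + 1 = weight y"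

lemma card_distinct_nth: "distinct xs \<Longrightarrow> card {l\<in>{..<length xs}. xs ! l \<in> A} = card (set xs \<inter> A)"
proof -
  assume d: "distinct xs"
  have "card {l\<in>{..<length xs}. xs ! l \<in> A} = length (filter (\<lambda>a. a \<in> A) xs)"
    by (simp add: length_filter_conv_card)
  also have "\<dots> = card (set (filter (\<lambda>a. a \<in> A) xs))" using d by (intro distinct_card[symmetric] distinct_filter)
  also have "set (filter (\<lambda>a. a \<in> A) xs) = set xs \<inter> A" by auto
  finally show ?thesis .
qed

text \<open>A message is the list of answers to a fixed list of yes/no questions, so its length does
  not depend on the input; slots beyond the support are answered False.\<close>

datatype query =
  Extreme | Flipped | Unary nat | Sig nat nat | WeightSig nat | Sine nat nat | Coin nat

definition canonical :: "nat \<Rightarrow> nat \<Rightarrow> bool list" where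
  "canonical n a = replicate a True @ replicate (n - a) False"

lemma canonical [simp]: "a \<le> n \<Longrightarrow> length (canonical n a) = n" "weight (canonical n a) = a"
  by (auto simp: canonical_def count_list_replicate)

text \<open>W bounds extreme weights, t is the signature length, B bounds the receiver's set, K the
  small cells of a near jump, \<kappa> is the tuple length, q the number of quantization levels, J
  the number of samples, and words of length w name the fixed strings \<open>str\<close>.\<close>

locale simulation = correlated +
  fixes n :: nat and f :: "bool list \<Rightarrow> bool list \<Rightarrow> bool" and P :: protocol
    and W t B K \<kappa> q J w :: nat and str :: "bool list \<Rightarrow> bits"
  assumes f: "permutation_invariant n f"
begin

fun reply :: "bool list \<Rightarrow> bits \<Rightarrow> query \<Rightarrow> bool" where
  "reply x r Extreme = extreme W x"
| "reply x r Flipped = (\<not> weight x \<le> W)"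
| "reply x r (Unary i) = (i < card (support W x))"
| "reply x r (Sig l j) = (l < card (support W x) \<and> r (sig_pos (sorted_list_of_set (support W x) ! l) j))"
| "reply x r (WeightSig j) = r (sig_pos (weight x) j)"
| "reply x r (Sine j i) = (sine_stat \<kappa> x r j \<ge> -1 + 2 * (real i + 1) / real q)"
| "reply x r (Coin i) = r i"

lemma finitary_reply: "finitary (\<lambda>r. reply x r p)"
proof (cases p)
  case (Sig l j)
  then show ?thesis
    using finitary_comp[OF finitary_coord, of "\<lambda>b. l < card (support W x) \<and> b" "sig_pos (sorted_list_of_set (support W x) ! l) j"] by simp
next
  case (Sine j i)
  then show ?thesis
    using finitary_comp[OF finitary_sine_stat, of "\<lambda>v. v \<ge> -1 + 2 * (real i + 1) / real q" \<kappa> x j] by simp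
qed auto

definition support_queries :: "query list" where
  "support_queries = [Extreme, Flipped] @ map Unary [0..<W] @ map (\<lambda>(l, j). Sig l j) (List.product [0..<W] [0..<t])"

definition all_queries :: "query list" where
  "all_queries = support_queries @ map WeightSig [0..<t] @
     map (\<lambda>(j, i). Sine j i) (List.product [0..<J] [0..<q]) @ map Coin [0..<3 * w]"

lemma length_queries:
  "length support_queries = 2 + W + W * t"
  "length all_queries = 2 + W + W * t + t + J * q + 3 * w"
  by (simp_all add: support_queries_def all_queries_def)

definition answered :: "query list \<Rightarrow> bool list \<Rightarrow> bits \<Rightarrow> query \<Rightarrow> bool" where
  "answered qs x r = (\<lambda>p. p \<in> set qs \<and> reply x r p)"

lemma answered_simps:
  assumes "set support_queries \<subseteq> set qs"
  shows "answered qs x r Extreme = extreme W x" "answered qs x r Flipped = (\<not> weight x \<le> W)"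
    "i < W \<Longrightarrow> answered qs x r (Unary i) = (i < card (support W x))"
    "l < W \<Longrightarrow> j < t \<Longrightarrow> answered qs x r (Sig l j) =
       (l < card (support W x) \<and> r (sig_pos (sorted_list_of_set (support W x) ! l) j))"
proof -
  have "Extreme \<in> set qs" "Flipped \<in> set qs" using assms by (auto simp: support_queries_def)
  then show "answered qs x r Extreme = extreme W x" "answered qs x r Flipped = (\<not> weight x \<le> W)"
    by (simp_all add: answered_def)
  show "answered qs x r (Unary i) = (i < card (support W x))" if "i < W"
  proof -
    have "Unary i \<in> set qs" using that assms by (auto simp: support_queries_def)
    then show ?thesis by (simp add: answered_def)
  qed
  show "answered qs x r (Sig l j) =
       (l < card (support W x) \<and> r (sig_pos (sorted_list_of_set (support W x) ! l) j))" if "l < W" "j < t"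
  proof -
    have "Sig l j \<in> set support_queries" using that by (auto simp: support_queries_def image_iff)
    then show ?thesis using assms by (auto simp: answered_def)
  qed
qed

lemma answered_all_simps:
  "j < t \<Longrightarrow> answered all_queries x r (WeightSig j) = r (sig_pos (weight x) j)"
  "j < J \<Longrightarrow> i < q \<Longrightarrow> answered all_queries x r (Sine j i) = (sine_stat \<kappa> x r j \<ge> -1 + 2 * (real i + 1) / real q)"
  "i < 3 * w \<Longrightarrow> answered all_queries x r (Coin i) = r i"
proof -
  show "answered all_queries x r (WeightSig j) = r (sig_pos (weight x) j)" if "j < t"
    using that by (auto simp: answered_def all_queries_def)
  show "answered all_queries x r (Sine j i) = (sine_stat \<kappa> x r j \<ge> -1 + 2 * (real i + 1) / real q)" if "j < J" "i < q"
  proof -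
    have "Sine j i \<in> set all_queries" using that by (auto simp: all_queries_def image_iff)
    then show ?thesis by (simp add: answered_def)
  qed
  show "answered all_queries x r (Coin i) = r i" if "i < 3 * w"
    using that by (auto simp: answered_def all_queries_def)
qed

lemma matches_cong: "(\<And>j. j < t \<Longrightarrow> a j = b j) \<Longrightarrow> matches t a s i = matches t b s i"
  unfolding matches_def by (intro arg_cong[where f="\<lambda>A. (1/2 + \<rho>/4) * real t \<le> real (card A)"]) auto

lemma finitary_matches: "finitary (\<lambda>s. matches t a s i)"
  unfolding matches_def
  by (rule finitary_comp[where g = "\<lambda>c. (1/2 + \<rho>/4) * real t \<le> real c"], rule finitary_card, simp,
      rule finitary_comp[where g = "\<lambda>b. a _ = b", OF finitary_coord])

text \<open>The receiver, holding \<open>y\<close> and \<open>s\<close>, evaluates \<open>F\<close> at some input consistent with what the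
  answers \<open>g\<close> reveal about a sender of extreme weight. If \<open>y\<close> is far from extreme then the
  intersection size is irrelevant.\<close>

definition small_flip :: "bool list \<Rightarrow> bool" where
  "small_flip y \<longleftrightarrow> \<not> weight y \<le> B"

definition support_count :: "(query \<Rightarrow> bool) \<Rightarrow> bool list \<Rightarrow> bits \<Rightarrow> nat" where
  "support_count g y s = card {l\<in>{..<W}. g (Unary l) \<and>
     (\<exists>i\<in>pos (small_flip y) y. matches t (\<lambda>j. g (Sig l j)) s i)}"

definition consistent :: "(query \<Rightarrow> bool) \<Rightarrow> bool list \<Rightarrow> nat \<Rightarrow> bool list \<Rightarrow> bool" where
  "consistent g y c X \<longleftrightarrow> length X = n \<and> card (pos (g Flipped) X) = card {i\<in>{..<W}. g (Unary i)} \<and>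
     (card (pos (small_flip y) y) \<le> B \<longrightarrow> card (pos (g Flipped) X \<inter> pos (small_flip y) y) = c)"

definition decode_extreme :: "(bool list \<Rightarrow> bool list \<Rightarrow> bool) \<Rightarrow> (query \<Rightarrow> bool) \<Rightarrow> bool list \<Rightarrow> bits \<Rightarrow> bool" where
  "decode_extreme F g y s = F (SOME X. consistent g y (support_count g y s) X) y"

lemma finitary_decode_extreme: "finitary (decode_extreme F g y)"
proof -
  have "finitary (\<lambda>s. g (Unary l) \<and> (\<exists>i\<in>pos (small_flip y) y. matches t (\<lambda>j. g (Sig l j)) s i))" for l
    by (rule finitary_comp[where g = "\<lambda>b. g (Unary l) \<and> b"], rule finitary_bex) (auto intro: finitary_matches)
  then have "finitary (support_count g y)"
    unfolding support_count_def by (intro finitary_card) auto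
  from finitary_comp[OF this, of "\<lambda>c. F (SOME X. consistent g y c X) y"]
  show ?thesis unfolding decode_extreme_def[abs_def] .
qed

text \<open>The true x is consistent, so the chosen X is too and has the same weight. If F differed
  on X and x there would be a jump, the receiver's side would be small, and the common intersection
  size would fix all cells, a contradiction. F is a parameter because the players may exchange
  roles.\<close>

lemma decode_extreme_correct:
  assumes F: "permutation_invariant n F" and len: "length x = n" "length y = n" and ext: "extreme W x"
    and qs: "set support_queries \<subseteq> set qs"
    and jumps: "\<And>\<alpha> \<beta> \<gamma> \<delta>. jump_at n F x y \<alpha> \<beta> \<gamma> \<delta> \<Longrightarrow> card (pos (small_flip y) y) \<le> B"
    and good: "card (pos (small_flip y) y) \<le> B \<Longrightarrow>
      (\<And>i i'. i \<in> support W x \<Longrightarrow> i' \<in> pos (small_flip y) y \<Longrightarrow>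
        matches t (\<lambda>j. r (sig_pos i j)) s i' \<longleftrightarrow> i = i')"
  shows "decode_extreme F (answered qs x r) y s = F x y"
proof -
  define g where "g = answered qs x r"
  define u where "u = (\<not> weight x \<le> W)"
  define v where "v = small_flip y"
  define a where "a = card (support W x)"
  define xs where "xs = sorted_list_of_set (support W x)"
  have a: "a \<le> W" using card_support[OF ext] by (simp add: a_def)
  have xs: "distinct xs" "set xs = support W x" "length xs = a" by (simp_all add: xs_def a_def)
  have gF: "g Flipped = u" by (simp add: g_def u_def answered_simps[OF qs])
  have gU: "g (Unary i) = (i < a)" if "i < W" for i
    using that by (simp add: g_def a_def answered_simps[OF qs])
  have sup: "support W x = pos u x" by (simp add: support_def u_def)
  have "{i\<in>{..<W}. g (Unary i)} = {..<a}" using gU a by auto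
  then have un: "card {i\<in>{..<W}. g (Unary i)} = a" by simp
  have cons: "consistent g y (support_count g y s) x"
    unfolding consistent_def gF un v_def[symmetric]
  proof (intro conjI impI len(1))
    show "card (pos u x) = a" by (simp add: a_def sup)
    assume sm: "card (pos v y) \<le> B"
    have m: "matches t (\<lambda>j. g (Sig l j)) s i' \<longleftrightarrow> xs ! l = i'" if "l < a" "i' \<in> pos v y" for l i'
    proof -
      have "matches t (\<lambda>j. g (Sig l j)) s i' = matches t (\<lambda>j. r (sig_pos (xs ! l) j)) s i'"
        using that a by (intro matches_cong) (auto simp: g_def answered_simps[OF qs] a_def xs_def)
      moreover have "xs ! l \<in> support W x" using that xs by (metis nth_mem)
      ultimately show ?thesis using good[folded v_def, OF sm _ that(2)] by simp
    qed
    have "{l\<in>{..<W}. g (Unary l) \<and> (\<exists>i\<in>pos v y. matches t (\<lambda>j. g (Sig l j)) s i)}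
       = {l\<in>{..<length xs}. xs ! l \<in> pos v y}"
      using gU a m xs(3) by auto
    then have "support_count g y s = card {l\<in>{..<length xs}. xs ! l \<in> pos v y}"
      by (simp add: support_count_def v_def)
    also have "\<dots> = card (pos u x \<inter> pos v y)"
      using card_distinct_nth[OF xs(1)] xs(2) by (simp add: sup)
    finally show "card (pos u x \<inter> pos v y) = support_count g y s" by simp
  qed
  define X where "X = (SOME X. consistent g y (support_count g y s) X)"
  have X: "consistent g y (support_count g y s) X" unfolding X_def using cons by (rule someI)
  have lX: "length X = n" using X by (simp add: consistent_def)
  have "card (pos u X) = card (pos u x)" using X cons unfolding consistent_def gF by simp
  then have wX: "weight X = weight x"
    using weight_le_length[of X] weight_le_length[of x] len lX by (cases u) (auto simp: card_pos)
  have "F X y = F x y"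
  proof (rule ccontr)
    assume ne: "F X y \<noteq> F x y"
    then obtain \<alpha> \<beta> \<gamma> \<delta> where "jump n F \<alpha> \<beta> \<gamma> \<delta>" "\<alpha> + \<beta> + 1 = weight x" "\<alpha> + \<gamma> + 1 = weight y"
      using jump_between[OF F len lX] wX by metis
    then have sm: "card (pos v y) \<le> B" using jumps by (auto simp: jump_at_def v_def)
    then have "card (pos u X \<inter> pos v y) = card (pos u x \<inter> pos v y)"
      using X cons unfolding consistent_def gF v_def[symmetric] by simp
    then have "cell (\<not> u) (\<not> v) X y = cell (\<not> u) (\<not> v) x y" by (simp add: card_pos_Int[OF lX len(2)] card_pos_Int[OF len])
    then have "cell True True X y = cell True True x y"
      using weight_eq_cells[of X y] weight_eq_cells[of x y] wX len lX by (cases u; cases v) auto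
    then show False using permutation_invariant_cong[OF F lX len(2) len wX refl] ne by simp
  qed
  then show ?thesis by (simp add: decode_extreme_def X_def g_def)
qed

section \<open>Senders of non-extreme weight: nearby weights and distance estimation\<close>

definition near_weights :: "bool list \<Rightarrow> nat set" where
  "near_weights y = {a. a \<le> weight y + K \<and> weight y \<le> a + K \<or> a + weight y \<le> n + K \<and> n \<le> a + weight y + K}"

lemma near_weights:
  shows "finite (near_weights y)" and "length y = n \<Longrightarrow> card (near_weights y) \<le> 4 * K + 2"
proof -
  have "near_weights y \<subseteq> {..weight y + K} \<union> {..n + K}" by (auto simp: near_weights_def)
  then show "finite (near_weights y)" by (rule finite_subset) auto
  assume "length y = n"
  then have "weight y \<le> n" using weight_le_length[of y] by simp
  then have "near_weights y \<subseteq> {weight y - K..weight y + K} \<union> {n - weight y - K..n - weight y + K}"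
    by (auto simp: near_weights_def)
  then have "card (near_weights y) \<le> card ({weight y - K..weight y + K} \<union> {n - weight y - K..n - weight y + K})"
    by (intro card_mono) auto
  also have "\<dots> \<le> card {weight y - K..weight y + K} + card {n - weight y - K..n - weight y + K}"
    by (rule card_Un_le)
  also have "\<dots> \<le> 4 * K + 2" by simp
  finally show "card (near_weights y) \<le> 4 * K + 2" .
qed

definition near_jump :: "nat \<Rightarrow> nat \<Rightarrow> nat \<Rightarrow> nat \<Rightarrow> bool" where
  "near_jump \<alpha> \<beta> \<gamma> \<delta> \<longleftrightarrow> \<beta> \<le> K \<and> \<gamma> \<le> K \<or> \<alpha> \<le> K \<and> \<delta> \<le> K"

text \<open>The weights differ by \<beta> - \<gamma>, and their sum differs from n by \<alpha> -
  \<delta>.\<close>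

lemma near_jump_weight:
  assumes "jump_at n f x y \<alpha> \<beta> \<gamma> \<delta>" "near_jump \<alpha> \<beta> \<gamma> \<delta>"
  shows "weight x \<in> near_weights y"
  using assms by (auto simp: jump_at_def jump_def near_jump_def near_weights_def)

text \<open>One third of the gap in \<open>mean_gap\<close>: 3 / (32 (2K + 2)) * N more agreeing
  tuples, each worth \<rho> / (8N).\<close>

definition tolerance :: real where
  "tolerance = \<rho> / (256 * (2 * real K + 2))"

abbreviation mean_at :: "bool list \<Rightarrow> bool list \<Rightarrow> real" where
  "mean_at x y \<equiv> sine_mean (n ^ \<kappa>) (positive_tuples \<kappa> x y)"

text \<open>Crossing the jump lowers the Hamming distance from at least \<beta> + \<gamma> + 2 to at
  most \<beta> + \<gamma>, a value within 2K of one of the ends, where \<open>tuple_gap\<close> with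
  D = 2K applies.\<close>

lemma mean_gap:
  assumes \<kappa>: "\<kappa> = tuple_len n (2 * K)" and len: "length x = n" "length x' = n" "length y = n"
    and w: "weight x' = weight x" and j: "jump_at n f x y \<alpha> \<beta> \<gamma> \<delta>" and nj: "near_jump \<alpha> \<beta> \<gamma> \<delta>"
    and c: "cell True True x y \<le> \<alpha>" "\<alpha> < cell True True x' y"
  shows "mean_at x y + 3 * tolerance \<le> mean_at x' y"
proof -
  define N where "N = n ^ \<kappa>"
  define p p' where "p = positive_tuples \<kappa> x y" and "p' = positive_tuples \<kappa> x' y"
  have J: "\<alpha> + \<beta> + \<gamma> + \<delta> + 2 = n" "\<alpha> + \<beta> + 1 = weight x" "\<alpha> + \<gamma> + 1 = weight y"
    using j by (auto simp: jump_at_def jump_def)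
  have n0: "n > 0" using J by simp
  then have N0: "N > 0" by (simp add: N_def)
  have h: "hamming x' y \<le> \<beta> + \<gamma>" "\<beta> + \<gamma> + 2 \<le> hamming x y"
    using hamming_cells[of x y] hamming_cells[of x' y] len w J c by auto
  \<comment> \<open>Odd powers are monotone on the whole line, which is needed because n - 2 *
    distance may be negative.\<close>
  have odd: "odd \<kappa>" unfolding \<kappa> by (rule odd_tuple_len)
  have "3 / (16 * (real (2 * K) + 2)) * real n ^ \<kappa> \<le>
      (real n - 2 * real (\<beta> + \<gamma>)) ^ \<kappa> - (real n - 2 * real (\<beta> + \<gamma> + 2)) ^ \<kappa>"
    unfolding \<kappa> using nj J by (intro tuple_gap) (auto simp: near_jump_def)
  also have "\<dots> \<le> (real n - 2 * real (hamming x' y)) ^ \<kappa> - (real n - 2 * real (hamming x y)) ^ \<kappa>"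
  proof (rule diff_mono; rule power_mono_odd[OF odd])
    have h': "real (hamming x' y) \<le> real (\<beta> + \<gamma>)" "real (\<beta> + \<gamma> + 2) \<le> real (hamming x y)"
      using h by (simp_all only: of_nat_le_iff)
    show "real n - 2 * real (\<beta> + \<gamma>) \<le> real n - 2 * real (hamming x' y)"
      by (intro diff_left_mono mult_left_mono h') simp
    show "real n - 2 * real (hamming x y) \<le> real n - 2 * real (\<beta> + \<gamma> + 2)"
      by (intro diff_left_mono mult_left_mono h') simp
  qed
  also have "\<dots> = 2 * (real p' - real p)"
    using positive_tuples_eq[of \<kappa> x y] positive_tuples_eq[of \<kappa> x' y] len by (simp add: p_def p'_def)
  finally have "3 / (16 * (2 * real K + 2)) * real N \<le> 2 * (real p' - real p)" by (simp add: N_def)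
  then have d: "3 / (32 * (2 * real K + 2)) * real N \<le> real p' - real p" by (simp add: field_simps)
  moreover have "0 \<le> 3 / (32 * (2 * real K + 2)) * real N" by simp
  ultimately have le: "p \<le> p'" by linarith
  have "p' \<le> N" unfolding p'_def N_def using positive_tuples_le[of \<kappa> x' y] len by simp
  from sine_mean_gap[OF N0 le this]
  have g: "sine_mean N p + real (p' - p) * (\<rho> / (8 * real N)) \<le> sine_mean N p'" .
  have "3 * tolerance = 3 / (32 * (2 * real K + 2)) * real N * (\<rho> / (8 * real N))"
    using N0 by (simp add: tolerance_def)
  also have "\<dots> \<le> real (p' - p) * (\<rho> / (8 * real N))"
    using d le \<rho> by (intro mult_right_mono) (auto simp: of_nat_diff)
  finally show ?thesis using g by (simp add: N_def p_def p'_def)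
qed

definition near_output :: "nat set \<Rightarrow> real \<Rightarrow> bool list \<Rightarrow> bool" where
  "near_output A Z y = f (SOME X. length X = n \<and> weight X = (SOME a. a \<in> A) \<and> \<bar>Z - mean_at X y\<bar> \<le> tolerance) y"

text \<open>The means of x and of the chosen X both lie within one tolerance of Z, whereas a jump
  between them would separate them by three.\<close>

lemma near_output_correct:
  assumes \<kappa>: "\<kappa> = tuple_len n (2 * K)" and len: "length x = n" "length y = n"
    and jumps: "\<And>\<alpha> \<beta> \<gamma> \<delta>. jump_at n f x y \<alpha> \<beta> \<gamma> \<delta> \<Longrightarrow> near_jump \<alpha> \<beta> \<gamma> \<delta>"
    and A: "A = {weight x}" and Z: "\<bar>Z - mean_at x y\<bar> \<le> tolerance"
  shows "near_output A Z y = f x y"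
proof -
  define X where "X = (SOME X. length X = n \<and> weight X = (SOME a. a \<in> A) \<and> \<bar>Z - mean_at X y\<bar> \<le> tolerance)"
  have "length X = n \<and> weight X = (SOME a. a \<in> A) \<and> \<bar>Z - mean_at X y\<bar> \<le> tolerance"
    unfolding X_def by (rule someI[of _ x]) (use len A Z in auto)
  then have X: "length X = n" "weight X = weight x" "\<bar>Z - mean_at X y\<bar> \<le> tolerance" using A by auto
  have tol: "tolerance > 0" using \<rho> by (simp add: tolerance_def add_nonneg_pos)
  have "f X y = f x y"
  proof (rule ccontr)
    assume "f X y \<noteq> f x y"
    then obtain \<alpha> \<beta> \<gamma> \<delta> where j: "jump n f \<alpha> \<beta> \<gamma> \<delta>" "\<alpha> + \<beta> + 1 = weight x" "\<alpha> + \<gamma> + 1 = weight y"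
      "min (cell True True x y) (cell True True X y) \<le> \<alpha>" "\<alpha> < max (cell True True x y) (cell True True X y)"
      using jump_between[OF f len X(1) X(2)[symmetric]] by metis
    have jx: "jump_at n f x y \<alpha> \<beta> \<gamma> \<delta>" using j by (simp add: jump_at_def)
    have jX: "jump_at n f X y \<alpha> \<beta> \<gamma> \<delta>" using j X by (simp add: jump_at_def)
    note nj = jumps[OF jx]
    have "\<bar>mean_at x y - mean_at X y\<bar> \<ge> 3 * tolerance"
    proof (cases "cell True True x y \<le> cell True True X y")
      case True
      then have "mean_at x y + 3 * tolerance \<le> mean_at X y"
        using j by (intro mean_gap[OF \<kappa> len(1) X(1) len(2) X(2) jx nj]) auto
      then show ?thesis by linarith
    next
      case False
      then have "mean_at X y + 3 * tolerance \<le> mean_at x y"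
        using j by (intro mean_gap[OF \<kappa> X(1) len(1) len(2) X(2)[symmetric] jX nj]) auto
      then show ?thesis by linarith
    qed
    then show False using Z X(3) tol by linarith
  qed
  then show ?thesis by (simp add: near_output_def X_def)
qed

definition matched :: "(query \<Rightarrow> bool) \<Rightarrow> bool list \<Rightarrow> bits \<Rightarrow> nat set" where
  "matched g y s = {a \<in> near_weights y. matches t (\<lambda>j. g (WeightSig j)) s a}"

definition estimate :: "(query \<Rightarrow> bool) \<Rightarrow> bool list \<Rightarrow> bits \<Rightarrow> real" where
  "estimate g y s = (\<Sum>j<J. quant q (\<lambda>i. g (Sine j i)) * sine_stat \<kappa> y s j) / real J"

lemma finitary_matched: "finitary (matched g y)"
  by (rule finitary_family[of "near_weights y" "\<lambda>a s. matches t (\<lambda>j. g (WeightSig j)) s a"])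
     (auto simp: near_weights finitary_matches matched_def)

lemma finitary_estimate: "finitary (estimate g y)"
proof -
  have "finitary (\<lambda>s. \<Sum>j<J. quant q (\<lambda>i. g (Sine j i)) * sine_stat \<kappa> y s j)"
    by (rule finitary_sum, simp, rule finitary_comp[where g = "\<lambda>v. quant q (\<lambda>i. g (Sine _ i)) * v", OF finitary_sine_stat])
  from finitary_comp[OF this, of "\<lambda>v. v / real J"] show ?thesis unfolding estimate_def[abs_def] .
qed

lemma quant_cong: "(\<And>i. i < q \<Longrightarrow> a i = b i) \<Longrightarrow> quant q a = quant q b"
  unfolding quant_def by (intro arg_cong[where f="\<lambda>A. -1 + 2 * real (card A) / real q"]) auto

text \<open>Only the sender's factor is rounded; the receiver's factor is exact and at most 1 in
  absolute value.\<close>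

lemma estimate_quantization:
  assumes q: "q > 0" and J: "J > 0"
  shows "\<bar>estimate (answered all_queries x r) y s - (\<Sum>j<J. sine_stat \<kappa> x r j * sine_stat \<kappa> y s j) / real J\<bar> \<le> 2 / real q"
proof -
  define d where "d j = (quant q (\<lambda>i. answered all_queries x r (Sine j i)) - sine_stat \<kappa> x r j) * sine_stat \<kappa> y s j" for j
  have d: "\<bar>d j\<bar> \<le> 2 / real q" if "j < J" for j
  proof -
    have "quant q (\<lambda>i. answered all_queries x r (Sine j i)) =
        quant q (\<lambda>i. sine_stat \<kappa> x r j \<ge> -1 + 2 * (real i + 1) / real q)"
      using that by (intro quant_cong) (simp add: answered_all_simps)
    then have "\<bar>quant q (\<lambda>i. answered all_queries x r (Sine j i)) - sine_stat \<kappa> x r j\<bar> \<le> 2 / real q"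
      using quant_error[OF _ _ q, of "sine_stat \<kappa> x r j"] sine_stat_bound[of \<kappa> x r j] by (simp add: abs_le_iff)
    then have "\<bar>d j\<bar> \<le> 2 / real q * 1"
      unfolding d_def abs_mult by (intro mult_mono sine_stat_bound) auto
    then show ?thesis by simp
  qed
  have "estimate (answered all_queries x r) y s - (\<Sum>j<J. sine_stat \<kappa> x r j * sine_stat \<kappa> y s j) / real J = (\<Sum>j<J. d j) / real J"
    by (simp add: estimate_def d_def left_diff_distrib sum_subtractf diff_divide_distrib)
  also have "\<bar>\<dots>\<bar> \<le> (\<Sum>j<J. 2 / real q) / real J"
    unfolding abs_divide using d by (intro divide_mono order.trans[OF sum_abs] sum_mono) (use J in auto)
  also have "\<dots> = 2 / real q" using J by simp
  finally show ?thesis .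
qed

section \<open>Assembling the protocols\<close>

definition word :: "(query \<Rightarrow> bool) \<Rightarrow> nat \<Rightarrow> bool list" where
  "word g k = map (\<lambda>l. g (Coin (k * w + l))) [0..<w]"

text \<open>If the signature tests succeed, an empty set of matches excludes every near jump; the
  value then depends on the weights alone and the simulated runs decide it.\<close>

definition bob_output :: "(query \<Rightarrow> bool) \<Rightarrow> (bool list \<Rightarrow> bool) \<Rightarrow> (bool list \<Rightarrow> bool) \<Rightarrow> (bool list \<Rightarrow> bool) \<Rightarrow>
    bool list \<Rightarrow> bits \<Rightarrow> bool" where
  "bob_output g h\<^sub>1 h\<^sub>2 h\<^sub>3 y s =
     (if g Extreme then decode_extreme f g y s
      else if matched g y s \<noteq> {} then near_output (matched g y s) (estimate g y s) y
      else majority (h\<^sub>1 y) (h\<^sub>2 y) (h\<^sub>3 y))"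

lemma finitary_bob_output: "finitary (bob_output g h\<^sub>1 h\<^sub>2 h\<^sub>3 y)"
proof (cases "g Extreme")
  case True
  then have "bob_output g h\<^sub>1 h\<^sub>2 h\<^sub>3 y = decode_extreme f g y" by (simp add: bob_output_def fun_eq_iff)
  then show ?thesis by (simp add: finitary_decode_extreme)
next
  case False
  then have "bob_output g h\<^sub>1 h\<^sub>2 h\<^sub>3 y = (\<lambda>s. if matched g y s \<noteq> {} then near_output (matched g y s) (estimate g y s) y
      else majority (h\<^sub>1 y) (h\<^sub>2 y) (h\<^sub>3 y))"
    by (simp add: bob_output_def fun_eq_iff)
  then show ?thesis
    using finitary_comp2[OF finitary_matched finitary_estimate,
      of "\<lambda>A Z. if A \<noteq> {} then near_output A Z y else majority (h\<^sub>1 y) (h\<^sub>2 y) (h\<^sub>3 y)"] by simp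
qed

text \<open>The public-coin protocol is run on one representative per weight, so that the fixed
  strings have to serve only (n + 1)^2 pairs.\<close>

definition norm_input :: "bool list \<Rightarrow> bool list" where
  "norm_input x = canonical n (weight x)"

definition one_message :: protocol where
  "one_message = answers all_queries reply (\<lambda>g.
     derand (str (word g 0)) norm_input P (\<lambda>h\<^sub>1.
     derand (str (word g 1)) norm_input P (\<lambda>h\<^sub>2.
     derand (str (word g 2)) norm_input P (\<lambda>h\<^sub>3. Bob_Outputs (bob_output g h\<^sub>1 h\<^sub>2 h\<^sub>3)))))"

text \<open>With interaction a jump may have a small column although x is not extreme. Then y is
  extreme, and Bob becomes the sender.\<close>

definition two_messages :: protocol where
  "two_messages = bob_answers support_queries reply (\<lambda>g.
     if g Extreme then Alice_Outputs (\<lambda>x r. decode_extreme (\<lambda>X Y. f Y X) g x r) else one_message)"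

lemma measurable_one_message: "measurable_protocol one_message"
  unfolding one_message_def
  by (intro measurable_answers measurable_derand finitary_reply)
     (simp add: measurable_finitary_bits finitary_bob_output)

lemma measurable_two_messages: "measurable_protocol two_messages"
  unfolding two_messages_def
  by (intro measurable_bob_answers finitary_reply)
     (simp add: measurable_one_message measurable_finitary_bits finitary_decode_extreme)

lemma one_way_one_message: "one_way P \<Longrightarrow> one_way one_message"
  unfolding one_message_def by (intro one_way_answers one_way_derand) auto

lemma cost_one_message: "cost one_message \<le> (2 + W + W * t + t + J * q + 3 * w) + 3 * (cost P + 1)"
proof -
  have "cost (derand (str (word g 0)) norm_input P (\<lambda>h\<^sub>1. derand (str (word g 1)) norm_input P (\<lambda>h\<^sub>2.
     derand (str (word g 2)) norm_input P (\<lambda>h\<^sub>3. Bob_Outputs (bob_output g h\<^sub>1 h\<^sub>2 h\<^sub>3)))))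
     \<le> cost P + 1 + (cost P + 1 + (cost P + 1 + 0))" for g
    by (intro cost_derand) simp
  then have "cost one_message \<le> length all_queries + (cost P + 1 + (cost P + 1 + (cost P + 1 + 0)))"
    unfolding one_message_def by (rule cost_answers)
  then show ?thesis by (simp add: length_queries)
qed

lemma cost_two_messages: "cost two_messages \<le> (2 + W + W * t) + cost one_message"
proof -
  have "cost two_messages \<le> length support_queries + cost one_message"
    unfolding two_messages_def by (rule cost_bob_answers) auto
  then show ?thesis by (simp add: length_queries)
qed

end

text \<open>The error budget for a non-extreme sender: 1/50 for the weight signatures, 1/50 for the
  estimate and 8954/32768 for the majority, together below 1/3. The bound on q makes the
  quantization error at most half the tolerance.\<close>

locale parameters = simulation +
  assumes \<kappa>: "\<kappa> = tuple_len n (2 * K)"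
    and t: "t > 0" "real (W * B) * exp (- real t * \<rho>\<^sup>2 / 8) \<le> 1/50"
      "real (4 * K + 2) * exp (- real t * \<rho>\<^sup>2 / 8) \<le> 1/50"
    and q: "q > 0" "4 / tolerance \<le> real q"
    and J: "J > 0" "2 * exp (- real J * (tolerance / 2)\<^sup>2 / 2) \<le> 1/50"
    and str: "\<And>a b. a \<le> n \<Longrightarrow> b \<le> n \<Longrightarrow> real (card {v\<in>cube w.
        run P (canonical n a) (canonical n b) (str v) (str v) \<noteq> f (canonical n a) (canonical n b)}) \<le> 11/32 * 2 ^ w"
begin

section \<open>Correctness of the protocols\<close>

definition bad_pairs :: "nat set \<Rightarrow> nat set \<Rightarrow> (nat \<Rightarrow> bool \<times> bool) set" where
  "bad_pairs S T = {z. \<exists>p\<in>S \<times> T.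
     matches t (\<lambda>j. fst (z (sig_pos (fst p) j))) (bob_bits z) (snd p) \<noteq> (fst p = snd p)}"

lemma bad_pairs:
  assumes "finite S" "finite T"
  shows "bad_pairs S T \<in> events"
    and "measure \<mu> (bad_pairs S T) \<le> real (card S * card T) * exp (- real t * \<rho>\<^sup>2 / 8)"
proof -
  have fin: "finitary (\<lambda>z. matches t (\<lambda>j. fst (z (sig_pos (fst p) j))) (bob_bits z) (snd p) \<noteq> (fst p = snd p))" for p
    by (rule finitary_comp[where g = "\<lambda>b. b \<noteq> (fst p = snd p)", OF finitary_matches_pair])
  show "bad_pairs S T \<in> events"
    unfolding bad_pairs_def using assms by (intro events_finitary finitary_bex fin) auto
  show "measure \<mu> (bad_pairs S T) \<le> real (card S * card T) * exp (- real t * \<rho>\<^sup>2 / 8)"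
    unfolding bad_pairs_def card_cartesian_product[symmetric] using assms
    by (intro prob_UN_le fin signature_error t(1)) auto
qed

text \<open>Comparing signatures is symmetric, so the same bad events serve when Bob is the
  sender.\<close>

lemma matches_swap:
  "matches t (\<lambda>j. snd (z (sig_pos i j))) (alice_bits z) i' = matches t (\<lambda>j. fst (z (sig_pos i' j))) (bob_bits z) i"
  unfolding matches_def by (simp add: eq_commute)

lemma one_message_correct:
  assumes len: "length x = n" "length y = n"
    and near: "\<And>\<alpha> \<beta> \<gamma> \<delta>. jump_at n f x y \<alpha> \<beta> \<gamma> \<delta> \<Longrightarrow> \<not> extreme W x \<Longrightarrow> near_jump \<alpha> \<beta> \<gamma> \<delta>"
    and small: "\<And>\<alpha> \<beta> \<gamma> \<delta>. jump_at n f x y \<alpha> \<beta> \<gamma> \<delta> \<Longrightarrow> extreme W x \<Longrightarrow> extreme B y"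
  shows "\<exists>E. E \<in> events \<and> measure \<mu> E \<le> 1/3 \<and>
    (\<forall>z. z \<notin> E \<longrightarrow> run one_message x y (alice_bits z) (bob_bits z) = f x y)"
proof -
  define g where "g z = answered all_queries x (alice_bits z)" for z :: "nat \<Rightarrow> bool \<times> bool"
  have sq: "set support_queries \<subseteq> set all_queries" by (auto simp: all_queries_def)
  have run: "\<exists>h\<^sub>1 h\<^sub>2 h\<^sub>3. run one_message x y (alice_bits z) (bob_bits z) = bob_output (g z) h\<^sub>1 h\<^sub>2 h\<^sub>3 y (bob_bits z) \<and>
      h\<^sub>1 y = run P (norm_input x) (norm_input y) (str (word (g z) 0)) (str (word (g z) 0)) \<and>
      h\<^sub>2 y = run P (norm_input x) (norm_input y) (str (word (g z) 1)) (str (word (g z) 1)) \<and>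
      h\<^sub>3 y = run P (norm_input x) (norm_input y) (str (word (g z) 2)) (str (word (g z) 2))" for z
  proof -
    let ?s = "\<lambda>k. str (word (g z) k)" and ?a = "alice_bits z" and ?b = "bob_bits z"
    let ?k3 = "\<lambda>h\<^sub>1 h\<^sub>2 h\<^sub>3. Bob_Outputs (bob_output (g z) h\<^sub>1 h\<^sub>2 h\<^sub>3)"
    let ?k2 = "\<lambda>h\<^sub>1 h\<^sub>2. derand (?s 2) norm_input P (?k3 h\<^sub>1 h\<^sub>2)"
    let ?k1 = "\<lambda>h\<^sub>1. derand (?s 1) norm_input P (?k2 h\<^sub>1)"
    have 0: "run one_message x y ?a ?b = run (derand (?s 0) norm_input P ?k1) x y ?a ?b"
      unfolding one_message_def run_answers answered_def[symmetric] g_def[symmetric] ..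
    obtain h\<^sub>1 where 1: "run (derand (?s 0) norm_input P ?k1) x y ?a ?b = run (?k1 h\<^sub>1) x y ?a ?b"
      "h\<^sub>1 y = run P (norm_input x) (norm_input y) (?s 0) (?s 0)"
      using run_derand[of "?s 0" norm_input P ?k1 x y ?a ?b] by blast
    obtain h\<^sub>2 where 2: "run (?k1 h\<^sub>1) x y ?a ?b = run (?k2 h\<^sub>1 h\<^sub>2) x y ?a ?b"
      "h\<^sub>2 y = run P (norm_input x) (norm_input y) (?s 1) (?s 1)"
      using run_derand[of "?s 1" norm_input P "?k2 h\<^sub>1" x y ?a ?b] by blast
    obtain h\<^sub>3 where 3: "run (?k2 h\<^sub>1 h\<^sub>2) x y ?a ?b = run (?k3 h\<^sub>1 h\<^sub>2 h\<^sub>3) x y ?a ?b"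
      "h\<^sub>3 y = run P (norm_input x) (norm_input y) (?s 2) (?s 2)"
      using run_derand[of "?s 2" norm_input P "?k3 h\<^sub>1 h\<^sub>2" x y ?a ?b] by blast
    have "run one_message x y ?a ?b = bob_output (g z) h\<^sub>1 h\<^sub>2 h\<^sub>3 y ?b"
      unfolding 0 1(1) 2(1) 3(1) by simp
    then show ?thesis using 1(2) 2(2) 3(2) by blast
  qed
  show ?thesis
  proof (cases "extreme W x")
    case True
    \<comment> \<open>A receiver's side of more than B elements excludes jumps, so no signature has
      to be right and the union bound covers at most W B pairs.\<close>
    define T where "T = (if card (pos (small_flip y) y) \<le> B then pos (small_flip y) y else {})"
    define E where "E = bad_pairs (support W x) T"
    have T: "finite T" "card T \<le> B" by (auto simp: T_def)
    have "measure \<mu> E \<le> real (card (support W x) * card T) * exp (- real t * \<rho>\<^sup>2 / 8)"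
      unfolding E_def by (rule bad_pairs(2)) (simp_all add: T)
    also have "\<dots> \<le> real (W * B) * exp (- real t * \<rho>\<^sup>2 / 8)"
      using card_support[OF True] T by (intro mult_right_mono of_nat_mono mult_mono) auto
    also have "\<dots> \<le> 1/3" using t(2) by linarith
    finally have Em: "measure \<mu> E \<le> 1/3" .
    have "run one_message x y (alice_bits z) (bob_bits z) = f x y" if z: "z \<notin> E" for z
    proof -
      have "decode_extreme f (answered all_queries x (alice_bits z)) y (bob_bits z) = f x y"
      proof (rule decode_extreme_correct[OF f len True sq])
        fix \<alpha> \<beta> \<gamma> \<delta> assume "jump_at n f x y \<alpha> \<beta> \<gamma> \<delta>"
        then have "extreme B y" using small True by blast
        then show "card (pos (small_flip y) y) \<le> B"
          using card_support[of B y] by (simp add: support_def small_flip_def)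
      next
        fix i i' assume "card (pos (small_flip y) y) \<le> B" "i \<in> support W x" "i' \<in> pos (small_flip y) y"
        then have "(i, i') \<in> support W x \<times> T" by (simp add: T_def)
        then show "matches t (\<lambda>j. alice_bits z (sig_pos i j)) (bob_bits z) i' = (i = i')"
          using z by (auto simp: E_def bad_pairs_def)
      qed
      moreover have "g z Extreme" using True answered_simps(1)[OF sq] by (simp add: g_def)
      ultimately show ?thesis using run[of z] by (auto simp: bob_output_def g_def)
    qed
    then show ?thesis using bad_pairs(1)[of "support W x" T] Em T unfolding E_def by (intro exI[of _ E]) (auto simp: E_def)
  next
    case False
    \<comment> \<open>An empty input has weight 0 and would be extreme.\<close>
    have n0: "length x > 0" using False by (cases x) (auto simp: extreme_def)
    define E1 where "E1 = bad_pairs {weight x} (near_weights y)"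
    define E2 where "E2 = {z. \<bar>(\<Sum>j<J. sine_stat \<kappa> x (alice_bits z) j * sine_stat \<kappa> y (bob_bits z) j) / real J - mean_at x y\<bar> \<ge> tolerance / 2}"
    define Q where "Q v = (run P (norm_input x) (norm_input y) (str v) (str v) \<noteq> f (norm_input x) (norm_input y))" for v
    define X where "X k z = Q (map (\<lambda>l. fst (z (k * w + l))) [0..<w])" for k and z :: "nat \<Rightarrow> bool \<times> bool"
    define E3 where "E3 = {z. majority (X 0 z) (X 1 z) (X 2 z)}"
    have tol: "tolerance > 0" using \<rho> by (simp add: tolerance_def add_nonneg_pos)
    have E1: "E1 \<in> events" "measure \<mu> E1 \<le> 1/50"
    proof -
      show "E1 \<in> events" unfolding E1_def by (rule bad_pairs(1)) (simp_all add: near_weights)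
      have "measure \<mu> E1 \<le> real (card {weight x} * card (near_weights y)) * exp (- real t * \<rho>\<^sup>2 / 8)"
        unfolding E1_def by (rule bad_pairs(2)) (simp_all add: near_weights)
      also have "\<dots> \<le> real (4 * K + 2) * exp (- real t * \<rho>\<^sup>2 / 8)"
        using near_weights(2)[OF len(2)] by (intro mult_right_mono of_nat_mono) auto
      finally show "measure \<mu> E1 \<le> 1/50" using t(3) by linarith
    qed
    have E2: "E2 \<in> events" "measure \<mu> E2 \<le> 1/50"
    proof -
      have "finitary (\<lambda>z. \<Sum>j<J. sine_stat \<kappa> x (alice_bits z) j * sine_stat \<kappa> y (bob_bits z) j)"
        by (rule finitary_sum, simp, rule finitary_comp2[OF finitary_alice[OF finitary_sine_stat] finitary_bob[OF finitary_sine_stat]])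
      from finitary_comp[OF this, of "\<lambda>v. \<bar>v / real J - mean_at x y\<bar> \<ge> tolerance / 2"]
      show "E2 \<in> events" unfolding E2_def by (rule events_finitary)
      have "length y = length x" using len by simp
      from estimate_error[OF n0 this _ J(1), of "tolerance / 2" \<kappa>] tol
      have "measure \<mu> E2 \<le> 2 * exp (- real J * (tolerance / 2)\<^sup>2 / 2)" by (simp add: E2_def len)
      then show "measure \<mu> E2 \<le> 1/50" using J(2) by linarith
    qed
    have wle: "weight x \<le> n" "weight y \<le> n" using weight_le_length[of x] weight_le_length[of y] len by auto
    have E3: "E3 \<in> events" "measure \<mu> E3 \<le> 8954 / 32768"
    proof -
      have fX: "finitary (X k)" for k
        unfolding X_def by (rule finitary_comp[where g = Q, OF finitary_word])
      show "E3 \<in> events" unfolding E3_def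
        by (rule events_finitary, rule finitary_family[of "{0,1,2}" X]) (auto simp: fX)
      show "measure \<mu> E3 \<le> 8954 / 32768" unfolding E3_def X_def
        by (rule majority_error) (use str[OF wle] in \<open>simp add: Q_def norm_input_def\<close>)
    qed
    define E where "E = E1 \<union> (E2 \<union> E3)"
    have "measure \<mu> E \<le> measure \<mu> E1 + (measure \<mu> E2 + measure \<mu> E3)"
      unfolding E_def using E1 E2 E3
      by (intro order.trans[OF measure_Un_le] add_left_mono measure_Un_le) auto
    also have "\<dots> \<le> 1/3" using E1 E2 E3 by linarith
    finally have Em: "measure \<mu> E \<le> 1/3" .
    have "run one_message x y (alice_bits z) (bob_bits z) = f x y" if z: "z \<notin> E" for z
    proof -
      obtain h\<^sub>1 h\<^sub>2 h\<^sub>3 where h: "run one_message x y (alice_bits z) (bob_bits z) = bob_output (g z) h\<^sub>1 h\<^sub>2 h\<^sub>3 y (bob_bits z)"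
        "h\<^sub>1 y = run P (norm_input x) (norm_input y) (str (word (g z) 0)) (str (word (g z) 0))"
        "h\<^sub>2 y = run P (norm_input x) (norm_input y) (str (word (g z) 1)) (str (word (g z) 1))"
        "h\<^sub>3 y = run P (norm_input x) (norm_input y) (str (word (g z) 2)) (str (word (g z) 2))"
        using run[of z] by blast
      have gE: "\<not> g z Extreme" using False answered_simps(1)[OF sq] by (simp add: g_def)
      have m: "matches t (\<lambda>j. g z (WeightSig j)) (bob_bits z) a = (weight x = a)" if a: "a \<in> near_weights y" for a
      proof -
        have "matches t (\<lambda>j. g z (WeightSig j)) (bob_bits z) a = matches t (\<lambda>j. fst (z (sig_pos (weight x) j))) (bob_bits z) a"
          by (intro matches_cong) (simp add: g_def answered_all_simps)
        then show ?thesis using z a by (auto simp: E_def E1_def bad_pairs_def)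
      qed
      show ?thesis
      proof (cases "weight x \<in> near_weights y")
        case True
        then have M: "matched (g z) y (bob_bits z) = {weight x}" using m by (auto simp: matched_def)
        have "\<bar>estimate (g z) y (bob_bits z) - mean_at x y\<bar> \<le> tolerance"
        proof -
          have "\<bar>(\<Sum>j<J. sine_stat \<kappa> x (alice_bits z) j * sine_stat \<kappa> y (bob_bits z) j) / real J - mean_at x y\<bar> < tolerance / 2"
            using z by (auto simp: E_def E2_def not_le)
          moreover have "2 / real q \<le> tolerance / 2"
            using q tol by (simp add: field_simps)
          moreover note estimate_quantization[OF q(1) J(1), of x "alice_bits z" y "bob_bits z", folded g_def]
          ultimately show ?thesis by linarith
        qed
        then have "near_output {weight x} (estimate (g z) y (bob_bits z)) y = f x y"
          by (intro near_output_correct[OF \<kappa> len]) (use near False in auto)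
        then show ?thesis using h(1) gE M by (simp add: bob_output_def)
      next
        case nn: False
        then have M: "matched (g z) y (bob_bits z) = {}" using m by (auto simp: matched_def)
        \<comment> \<open>A jump would be near and would put the weight of x among the
          candidates.\<close>
        have nj: "\<not> jump_at n f x y \<alpha> \<beta> \<gamma> \<delta>" for \<alpha> \<beta> \<gamma> \<delta>
          using nn near[OF _ False] near_jump_weight by blast
        have "f (norm_input x) (norm_input y) = f x y"
        proof (rule ccontr)
          assume ne: "f (norm_input x) (norm_input y) \<noteq> f x y"
          have L: "length (norm_input x) = n" "length (norm_input y) = n"
            "weight (norm_input x) = weight x" "weight (norm_input y) = weight y"
            using wle by (simp_all add: norm_input_def)
          have "cell True True (norm_input x) (norm_input y) \<noteq> cell True True x y"
            using permutation_invariant_cong[OF f L(1,2) len L(3,4)] ne by blast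
          then consider "cell True True (norm_input x) (norm_input y) < cell True True x y"
            | "cell True True x y < cell True True (norm_input x) (norm_input y)" by linarith
          then show False
          proof cases
            case 1
            then show False
              using jump_between_aux[OF f L(1,2) len L(3,4) ne 1] nj L by (metis jump_at_def)
          next
            case 2
            then show False
              using jump_between_aux[OF f len L(1,2) L(3,4)[symmetric] ne[symmetric] 2] nj by (metis jump_at_def)
          qed
        qed
        moreover have wd: "word (g z) k = map (\<lambda>l. fst (z (k * w + l))) [0..<w]" if "k < 3" for k
        proof -
          have "k * w + l < 3 * w" if "l < w" for l
          proof -
            have "k * w + l < Suc k * w" using that by simp
            also have "\<dots> \<le> 3 * w" using \<open>k < 3\<close> by (intro mult_le_mono1) simp
            finally show ?thesis .
          qed
          then show ?thesis by (simp add: word_def g_def answered_all_simps)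
        qed
        moreover have "\<not> majority (X 0 z) (X 1 z) (X 2 z)" using z by (simp add: E_def E3_def)
        ultimately have "majority (h\<^sub>1 y) (h\<^sub>2 y) (h\<^sub>3 y) = f x y"
          unfolding h X_def Q_def by (auto simp: majority_def)
        then show ?thesis using h(1) gE M by (simp add: bob_output_def)
      qed
    qed
    then show ?thesis using E1 E2 E3 Em by (intro exI[of _ E]) (auto simp: E_def)
  qed
qed

lemma two_messages_correct:
  assumes len: "length x = n" "length y = n"
    and near: "\<And>\<alpha> \<beta> \<gamma> \<delta>. jump_at n f x y \<alpha> \<beta> \<gamma> \<delta> \<Longrightarrow> \<not> extreme W x \<Longrightarrow> \<not> extreme W y \<Longrightarrow> near_jump \<alpha> \<beta> \<gamma> \<delta>"
    and small: "\<And>\<alpha> \<beta> \<gamma> \<delta>. jump_at n f x y \<alpha> \<beta> \<gamma> \<delta> \<Longrightarrow> extreme W x \<Longrightarrow> extreme B y"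
    and small': "\<And>\<alpha> \<beta> \<gamma> \<delta>. jump_at n f x y \<alpha> \<beta> \<gamma> \<delta> \<Longrightarrow> extreme W y \<Longrightarrow> extreme B x"
  shows "\<exists>E. E \<in> events \<and> measure \<mu> E \<le> 1/3 \<and>
    (\<forall>z. z \<notin> E \<longrightarrow> run two_messages x y (alice_bits z) (bob_bits z) = f x y)"
proof (cases "extreme W y")
  case False
  have "run two_messages x y r s = run one_message x y r s" for r s
    unfolding two_messages_def run_bob_answers answered_def[symmetric]
    using False answered_simps(1)[of support_queries] by simp
  moreover have "\<exists>E. E \<in> events \<and> measure \<mu> E \<le> 1/3 \<and>
      (\<forall>z. z \<notin> E \<longrightarrow> run one_message x y (alice_bits z) (bob_bits z) = f x y)"
    by (rule one_message_correct[OF len]) (use near small False in blast)+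
  ultimately show ?thesis by simp
next
  case True
  define f' where "f' = (\<lambda>X Y. f Y X)"
  have pi: "permutation_invariant n f'" using f unfolding permutation_invariant_def f'_def by metis
  have run: "run two_messages x y r s = decode_extreme f' (answered support_queries y s) x r" for r s
    unfolding two_messages_def run_bob_answers answered_def[symmetric] f'_def
    using True answered_simps(1)[of support_queries] by (simp add: support_queries_def)
  define T where "T = (if card (pos (small_flip x) x) \<le> B then pos (small_flip x) x else {})"
  define E where "E = bad_pairs T (support W y)"
  have T: "finite T" "card T \<le> B" by (auto simp: T_def)
  have "measure \<mu> E \<le> real (card T * card (support W y)) * exp (- real t * \<rho>\<^sup>2 / 8)"
    unfolding E_def by (rule bad_pairs(2)) (simp_all add: T)
  also have "\<dots> \<le> real (B * W) * exp (- real t * \<rho>\<^sup>2 / 8)"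
    using card_support[OF True] T by (intro mult_right_mono of_nat_mono mult_mono) auto
  also have "\<dots> = real (W * B) * exp (- real t * \<rho>\<^sup>2 / 8)" by (simp only: mult.commute[of B W])
  also have "\<dots> \<le> 1/3" using t(2) by linarith
  finally have Em: "measure \<mu> E \<le> 1/3" .
  have "run two_messages x y (alice_bits z) (bob_bits z) = f x y" if z: "z \<notin> E" for z
  proof -
    have "decode_extreme f' (answered support_queries y (bob_bits z)) x (alice_bits z) = f' y x"
    proof (rule decode_extreme_correct[OF pi len(2,1) True order.refl])
      fix \<alpha> \<beta> \<gamma> \<delta> assume "jump_at n f' y x \<alpha> \<beta> \<gamma> \<delta>"
      then have "jump_at n f x y \<alpha> \<gamma> \<beta> \<delta>"
        using jump_swap[OF pi] by (auto simp: jump_at_def f'_def)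
      then have "extreme B x" using small' True by blast
      then show "card (pos (small_flip x) x) \<le> B"
        using card_support[of B x] by (simp add: support_def small_flip_def)
    next
      fix i i' assume "card (pos (small_flip x) x) \<le> B" "i \<in> support W y" "i' \<in> pos (small_flip x) x"
      then have "(i', i) \<in> T \<times> support W y" by (simp add: T_def)
      then show "matches t (\<lambda>j. bob_bits z (sig_pos i j)) (alice_bits z) i' = (i = i')"
        unfolding matches_swap using z by (auto simp: E_def bad_pairs_def)
    qed
    then show ?thesis by (simp add: run f'_def)
  qed
  then show ?thesis using bad_pairs(1)[of T "support W y"] Em T by (intro exI[of _ E]) (auto simp: E_def)
qed

end

section \<open>Choice of parameters\<close>

text \<open>Large enough that two small cells in the row of ones or of zeros of x, or one small cell
  and one of size at most 144 k, make x extreme.\<close>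

definition extreme_bound :: "nat \<Rightarrow> nat" where
  "extreme_bound k = 2 * cells_bound k + 144 * k + 1"

text \<open>For extreme x one row is below \<open>extreme_bound\<close> and the other has a cell of
  size at most \<open>index_bound\<close>; the column through that cell bounds the ones or the zeros
  of y.\<close>

definition small_bound :: "nat \<Rightarrow> nat" where
  "small_bound k = extreme_bound k + index_bound k + 1"

text \<open>Chosen so that 2^(w - 5) \<ge> 300 ln (n + 1); as exp (1/150) \<le> 1.007, this covers
  (n + 1)^2 pairs of weights. The 5 accounts for the factor 32 in the number of strings.\<close>

definition coin_count :: "nat \<Rightarrow> nat" where
  "coin_count n = 5 + nat \<lceil>log 2 (300 * ln (real n + 1) + 1)\<rceil>"

lemma coin_count_large: "(real n + 1)\<^sup>2 \<le> (1007/1000) ^ (2 ^ (coin_count n - 5))"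
proof -
  define L where "L = (2::nat) ^ (coin_count n - 5)"
  have ln0: "ln (real n + 1) \<ge> 0" by simp
  have "300 * ln (real n + 1) + 1 = 2 powr (log 2 (300 * ln (real n + 1) + 1))"
    using ln0 by (simp add: add_nonneg_pos)
  also have "\<dots> \<le> 2 powr (real (coin_count n - 5))"
    by (intro powr_mono) (simp_all add: coin_count_def of_nat_ceiling)
  also have "\<dots> = real L" by (simp add: L_def powr_realpow)
  finally have L: "300 * ln (real n + 1) \<le> real L" by simp
  have "exp (1/150) \<le> 1 + 1/150 + (1/150 :: real)\<^sup>2" by (rule exp_bound) auto
  also have "\<dots> \<le> 1007/1000" by (simp add: power2_eq_square)
  finally have e: "exp (1/150) \<le> (1007/1000 :: real)" .
  have "(real n + 1)\<^sup>2 = exp (2 * ln (real n + 1))"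
    using exp_of_nat_mult[of 2 "ln (real n + 1)"] by simp
  also have "\<dots> \<le> exp (real L * (1/150))" using L by simp
  also have "\<dots> = exp (1/150) ^ L" by (rule exp_of_nat_mult)
  also have "\<dots> \<le> (1007/1000) ^ L" using e by (intro power_mono) auto
  finally show ?thesis by (simp add: L_def)
qed

lemma coin_count_bigo: "(\<lambda>n. real (3 * coin_count n)) \<in> O(\<lambda>n. ln (ln (real n)))"
proof -
  have "real (3 * coin_count n) \<le> 3 * (log 2 (300 * ln (real n + 1) + 1) + 6)" for n
  proof -
    have "log 2 (300 * ln (real n + 1) + 1) \<ge> 0" by (simp add: le_log_iff add_nonneg_pos)
    then have "real (nat \<lceil>log 2 (300 * ln (real n + 1) + 1)\<rceil>) \<le> log 2 (300 * ln (real n + 1) + 1) + 1"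
      by linarith
    then show ?thesis by (simp add: coin_count_def)
  qed
  then have "(\<lambda>n. real (3 * coin_count n)) \<in> O(\<lambda>n. 3 * (log 2 (300 * ln (real n + 1) + 1) + 6))"
    by (intro landau_o.big_mono always_eventually allI) (simp add: abs_le_iff, smt (verit) of_nat_0_le_iff)
  also have "(\<lambda>n. 3 * (log 2 (300 * ln (real n + 1) + 1) + 6)) \<in> O(\<lambda>n. ln (ln (real n)))"
    by real_asymp
  finally show ?thesis .
qed

text \<open>At most two cells are large; the six cases are the two diagonals, rows and
  columns.\<close>

lemma two_small_cells:
  assumes "min \<beta> (min \<gamma> \<delta>) \<le> c" "min \<delta> (min \<alpha> \<beta>) \<le> c" "min \<alpha> (min \<delta> \<gamma>) \<le> c" "min \<gamma> (min \<beta> \<alpha>) \<le> (c::nat)"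
  shows "\<beta> \<le> c \<and> \<gamma> \<le> c \<or> \<alpha> \<le> c \<and> \<delta> \<le> c \<or> \<alpha> \<le> c \<and> \<beta> \<le> c \<or> \<gamma> \<le> c \<and> \<delta> \<le> c \<or> \<alpha> \<le> c \<and> \<gamma> \<le> c \<or> \<beta> \<le> c \<and> \<delta> \<le> c"
  using assms by (auto simp: min_le_iff_disj)

text \<open>A small row contradicts the weight of x. A small column contradicts the weight of y, or
  in the one-way model combines with the 144 k bound on a cell of the other column into an extreme
  x. Only the diagonals remain.\<close>

lemma jump_classification:
  assumes f: "pub_cost ow n f k" and j: "jump_at n f x y \<alpha> \<beta> \<gamma> \<delta>" and len: "length x = n" "length y = n"
    and x: "\<not> extreme (extreme_bound k) x" and y: "ow \<or> \<not> extreme (extreme_bound k) y"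
  shows "\<beta> \<le> cells_bound k \<and> \<gamma> \<le> cells_bound k \<or> \<alpha> \<le> cells_bound k \<and> \<delta> \<le> cells_bound k"
proof -
  let ?c = "cells_bound k"
  have J: "jump n f \<alpha> \<beta> \<gamma> \<delta>" and w: "\<alpha> + \<beta> + 1 = weight x" "\<alpha> + \<gamma> + 1 = weight y" "\<alpha> + \<beta> + \<gamma> + \<delta> + 2 = n"
    using j by (auto simp: jump_at_def jump_def)
  have nx: "weight x > extreme_bound k" "n - weight x > extreme_bound k" using x len by (auto simp: extreme_def)
  have 1: "\<not> (\<alpha> \<le> ?c \<and> \<beta> \<le> ?c)" "\<not> (\<gamma> \<le> ?c \<and> \<delta> \<le> ?c)" using nx w by (auto simp: extreme_bound_def)
  have 2: "\<not> (\<alpha> \<le> ?c \<and> \<gamma> \<le> ?c)" "\<not> (\<beta> \<le> ?c \<and> \<delta> \<le> ?c)"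
  proof (atomize(full), cases ow)
    case True
    then have "min \<beta> \<delta> \<le> 144 * k" "min \<alpha> \<gamma> \<le> 144 * k" using jump_columns_one_way[OF _ J] f by auto
    then show "\<not> (\<alpha> \<le> ?c \<and> \<gamma> \<le> ?c) \<and> \<not> (\<beta> \<le> ?c \<and> \<delta> \<le> ?c)" using nx w by (auto simp: extreme_bound_def min_le_iff_disj)
  next
    case False
    then have "weight y > extreme_bound k" "n - weight y > extreme_bound k" using y len by (auto simp: extreme_def)
    then show "\<not> (\<alpha> \<le> ?c \<and> \<gamma> \<le> ?c) \<and> \<not> (\<beta> \<le> ?c \<and> \<delta> \<le> ?c)" using w by (auto simp: extreme_bound_def)
  qed
  show ?thesis using two_small_cells[OF jump_three_cells[OF f J]] 1 2 by blast
qed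

lemma extreme_jump_small:
  assumes f: "pub_cost ow n f k" and j: "jump_at n f x y \<alpha> \<beta> \<gamma> \<delta>" and len: "length x = n" "length y = n"
    and x: "extreme (extreme_bound k) x"
  shows "extreme (small_bound k) y"
proof -
  have J: "jump n f \<alpha> \<beta> \<gamma> \<delta>" and w: "\<alpha> + \<beta> + 1 = weight x" "\<alpha> + \<gamma> + 1 = weight y" "\<alpha> + \<beta> + \<gamma> + \<delta> + 2 = n"
    using j by (auto simp: jump_at_def jump_def)
  have "min \<gamma> \<delta> \<le> index_bound k" "min \<alpha> \<beta> \<le> index_bound k" by (rule jump_rows[OF f J])+
  then show ?thesis using x w len by (auto simp: extreme_def small_bound_def min_le_iff_disj)
qed

section \<open>The cost bound as a polynomial\<close>

definition polynomial_in :: "(real \<Rightarrow> real) \<Rightarrow> bool" where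
  "polynomial_in F \<longleftrightarrow> (\<exists>p :: real poly. \<forall>x. poly p x = F x)"

lemma polynomial_in_const: "polynomial_in (\<lambda>x. c)"
  unfolding polynomial_in_def by (intro exI[of _ "[:c:]"]) simp

lemma polynomial_in_id: "polynomial_in (\<lambda>x. x)"
  unfolding polynomial_in_def by (intro exI[of _ "[:0, 1:]"]) simp

lemma polynomial_in_add: "polynomial_in F \<Longrightarrow> polynomial_in G \<Longrightarrow> polynomial_in (\<lambda>x. F x + G x)"
  unfolding polynomial_in_def by (metis poly_add)

lemma polynomial_in_mult: "polynomial_in F \<Longrightarrow> polynomial_in G \<Longrightarrow> polynomial_in (\<lambda>x. F x * G x)"
  unfolding polynomial_in_def by (metis poly_mult)

lemma polynomial_in_power: "polynomial_in F \<Longrightarrow> polynomial_in (\<lambda>x. F x ^ m)"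
  unfolding polynomial_in_def by (metis poly_power)

lemmas polynomial_intros =
  polynomial_in_const polynomial_in_id polynomial_in_add polynomial_in_mult polynomial_in_power

context correlated
begin

definition cells_real :: "real \<Rightarrow> real" where
  "cells_real x = 54 * (x + 1) ^ 3"

definition extreme_real :: "real \<Rightarrow> real" where
  "extreme_real x = 2 * cells_real x + 144 * x + 1"

text \<open>The factor in parentheses is an exponent T with 50 times the number of comparisons at
  most exp T; the factor 8 / \<rho>^2 cancels the rate in \<open>signature_error\<close>.\<close>

definition sig_real :: "real \<Rightarrow> real" where
  "sig_real x = 8 / \<rho>\<^sup>2 * (2 * extreme_real x + 2 * x + 8)"

definition inv_tol_real :: "real \<Rightarrow> real" where
  "inv_tol_real x = 256 / \<rho> * (2 * cells_real x + 2)"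

definition sig_count :: "nat \<Rightarrow> nat" where
  "sig_count k = nat \<lceil>sig_real (real k)\<rceil>"

definition level_count :: "nat \<Rightarrow> nat" where
  "level_count k = nat \<lceil>4 * inv_tol_real (real k)\<rceil>"

text \<open>With J \<ge> 40 / tolerance^2 the Hoeffding exponent at half the tolerance is at least
  5, and 2 exp (-5) \<le> 1/50.\<close>

definition sample_count :: "nat \<Rightarrow> nat" where
  "sample_count k = nat \<lceil>40 * inv_tol_real (real k) ^ 2\<rceil>"

text \<open>The support queries count twice because in the interactive protocol both players may
  answer them; the added ones absorb the ceilings.\<close>

definition cost_real :: "real \<Rightarrow> real" where
  "cost_real x = 2 * (2 + extreme_real x + extreme_real x * (sig_real x + 1)) + (sig_real x + 1) +
     (40 * inv_tol_real x ^ 2 + 1) * (4 * inv_tol_real x + 1) + 3 * (x + 1)"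

lemma polynomial_cost: "polynomial_in cost_real"
  unfolding cost_real_def inv_tol_real_def sig_real_def extreme_real_def cells_real_def
  by (intro polynomial_intros)

lemma real_bounds:
  "real (cells_bound k) = cells_real (real k)"
  "real (extreme_bound k) = extreme_real (real k)"
  by (simp_all add: cells_bound_def cells_real_def extreme_bound_def extreme_real_def add.commute)

lemma positive_parameters:
  "cells_real (real k) \<ge> 0" "extreme_real (real k) \<ge> 1" "sig_real (real k) > 0" "inv_tol_real (real k) > 0"
proof -
  show c: "cells_real (real k) \<ge> 0" by (simp add: cells_real_def)
  show e: "extreme_real (real k) \<ge> 1" using c by (simp add: extreme_real_def)
  show "sig_real (real k) > 0" unfolding sig_real_def using \<rho> e by (intro mult_pos_pos) auto
  show "inv_tol_real (real k) > 0" unfolding inv_tol_real_def using \<rho> c by (intro mult_pos_pos) auto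
qed

lemma count_bounds:
  "sig_real (real k) \<le> real (sig_count k)" "real (sig_count k) \<le> sig_real (real k) + 1" "sig_count k > 0"
  "4 * inv_tol_real (real k) \<le> real (level_count k)" "real (level_count k) \<le> 4 * inv_tol_real (real k) + 1" "level_count k > 0"
  "40 * inv_tol_real (real k) ^ 2 \<le> real (sample_count k)" "real (sample_count k) \<le> 40 * inv_tol_real (real k) ^ 2 + 1" "sample_count k > 0"
proof -
  have *: "v \<le> real (nat \<lceil>v\<rceil>) \<and> real (nat \<lceil>v\<rceil>) \<le> v + 1 \<and> nat \<lceil>v\<rceil> > 0" if "v > 0" for v :: real
    using that by (auto simp: of_nat_ceiling)
  have p: "40 * inv_tol_real (real k) ^ 2 > 0" "4 * inv_tol_real (real k) > 0"
    using positive_parameters(4)[of k] by auto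
  show "sig_real (real k) \<le> real (sig_count k)" "real (sig_count k) \<le> sig_real (real k) + 1" "sig_count k > 0"
    using *[OF positive_parameters(3)] by (auto simp: sig_count_def)
  show "4 * inv_tol_real (real k) \<le> real (level_count k)" "real (level_count k) \<le> 4 * inv_tol_real (real k) + 1" "level_count k > 0"
    using *[OF p(2)] by (auto simp: level_count_def)
  show "40 * inv_tol_real (real k) ^ 2 \<le> real (sample_count k)" "real (sample_count k) \<le> 40 * inv_tol_real (real k) ^ 2 + 1" "sample_count k > 0"
    using *[OF p(1)] by (auto simp: sample_count_def)
qed

lemma exp_numeral_bounds: "(1850::real) \<le> exp 8" "(100::real) \<le> exp 5"
proof -
  have "- inverse (2 ^ 32) \<le> exp 1 - (5837465777 / 2147483648 :: real)"
    using e_approx_32 unfolding abs_le_iff by argo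
  then have 3: "(27/10::real) \<le> exp 1" by simp
  have "(1850::real) \<le> (27/10) ^ 8" by (simp add: power_divide)
  also have "\<dots> \<le> exp 1 ^ 8" using 3 by (intro power_mono) auto
  also have "\<dots> = exp 8" using exp_of_nat_mult[of 8 "1::real"] by simp
  finally show "(1850::real) \<le> exp 8" .
  have "(100::real) \<le> (27/10) ^ 5" by (simp add: power_divide)
  also have "\<dots> \<le> exp 1 ^ 5" using 3 by (intro power_mono) auto
  also have "\<dots> = exp 5" using exp_of_nat_mult[of 5 "1::real"] by simp
  finally show "(100::real) \<le> exp 5" .
qed

text \<open>The receiver's set may be exponential in k, but W * B \<le> 37 exp (2W + 2k), and 50 *
  37 = 1850 \<le> exp 8. So an exponent linear in W and k suffices.\<close>

lemma signature_parameters: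
  "real (extreme_bound k * small_bound k) * exp (- real (sig_count k) * \<rho>\<^sup>2 / 8) \<le> 1/50"
  "real (4 * cells_bound k + 2) * exp (- real (sig_count k) * \<rho>\<^sup>2 / 8) \<le> 1/50"
proof -
  let ?W = "real (extreme_bound k)" and ?e = "exp (- real (sig_count k) * \<rho>\<^sup>2 / 8)"
  define T where "T = 2 * ?W + 2 * real k + 8"
  have W1: "?W \<ge> 1" by (simp add: extreme_bound_def)
  have "T * (8 / \<rho>\<^sup>2) \<le> real (sig_count k)"
    using count_bounds(1)[of k] by (simp add: sig_real_def T_def real_bounds mult.commute)
  then have "T * (8 / \<rho>\<^sup>2) * (\<rho>\<^sup>2 / 8) \<le> real (sig_count k) * (\<rho>\<^sup>2 / 8)" by (intro mult_right_mono) auto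
  then have "T \<le> real (sig_count k) * \<rho>\<^sup>2 / 8" using \<rho> by simp
  then have e: "?e \<le> exp (- T)" by simp
  have ex: "?W + 1 \<le> exp ?W" by (subst add.commute) (rule exp_ge_add_one_self)
  have "(4::real) \<le> exp 2" using exp_lower_Taylor_quadratic[of 2] by simp
  then have "(4::real) ^ k \<le> exp 2 ^ k" by (intro power_mono) auto
  then have e4: "(4::real) ^ k \<le> exp (2 * real k)" by (simp add: exp_of_nat_mult[symmetric] mult.commute)
  have one: "(1::real) \<le> exp (2 * real k)" by simp
  have "real (small_bound k) = (?W + 1) + 36 * 4 ^ k" by (simp add: small_bound_def index_bound_def)
  also have "\<dots> \<le> exp ?W * exp (2 * real k) + 36 * (exp ?W * exp (2 * real k))"
  proof (intro add_mono mult_left_mono)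
    show "?W + 1 \<le> exp ?W * exp (2 * real k)"
      using mult_mono[OF ex one] W1 by simp
    have "1 * 4 ^ k \<le> exp ?W * exp (2 * real k)"
      using W1 e4 by (intro mult_mono) auto
    then show "4 ^ k \<le> exp ?W * exp (2 * real k)" by simp
  qed simp
  finally have sb: "real (small_bound k) \<le> 37 * (exp ?W * exp (2 * real k))" by simp
  have "?W * real (small_bound k) \<le> exp ?W * (37 * (exp ?W * exp (2 * real k)))"
    using ex sb W1 by (intro mult_mono) auto
  then have "50 * (?W * real (small_bound k)) \<le> 1850 * (exp ?W * exp ?W * exp (2 * real k))" by simp
  also have "\<dots> \<le> exp 8 * (exp ?W * exp ?W * exp (2 * real k))"
    using exp_numeral_bounds(1) by (intro mult_right_mono) auto
  also have "\<dots> = exp T" by (simp add: T_def exp_add[symmetric])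
  finally have main: "50 * (?W * real (small_bound k)) \<le> exp T" .
  have fin: "X * ?e \<le> 1/50" if "50 * X \<le> exp T" "0 \<le> X" for X
  proof -
    have "50 * X * ?e \<le> exp T * exp (- T)" using that e by (intro mult_mono) auto
    then show ?thesis by (simp add: exp_minus)
  qed
  show "real (extreme_bound k * small_bound k) * ?e \<le> 1/50"
    using main by (intro fin) auto
  have "4 * cells_bound k + 2 \<le> extreme_bound k * small_bound k"
  proof -
    have "4 * cells_bound k + 2 \<le> extreme_bound k * 2" by (simp add: extreme_bound_def)
    also have "\<dots> \<le> extreme_bound k * small_bound k" by (intro mult_left_mono) (simp_all add: small_bound_def extreme_bound_def)
    finally show ?thesis .
  qed
  then have "real (4 * cells_bound k + 2) \<le> real (extreme_bound k * small_bound k)" by (rule of_nat_mono)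
  then have "50 * real (4 * cells_bound k + 2) \<le> exp T" using main by simp
  then show "real (4 * cells_bound k + 2) * ?e \<le> 1/50" by (intro fin) auto
qed

lemma simulation_strings:
  assumes P: "measurable_protocol P" "computes public_randomness n f P"
  obtains str where "\<And>a b. a \<le> n \<Longrightarrow> b \<le> n \<Longrightarrow> real (card {v\<in>cube (coin_count n).
        run P (canonical n a) (canonical n b) (str v) (str v) \<noteq> f (canonical n a) (canonical n b)}) \<le> 11/32 * 2 ^ coin_count n"
proof -
  define wrong where "wrong r p = (run P (canonical n (fst p)) (canonical n (snd p)) r r \<noteq> f (canonical n (fst p)) (canonical n (snd p)))"
    for r and p :: "nat \<times> nat"
  interpret coins: prob_space coins by (rule prob_space_coins)
  have meas: "Measurable.pred coins (\<lambda>r. wrong r p)" for p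
    using measurable_run_coins[OF P(1), of "canonical n (fst p)" "canonical n (snd p)"]
    unfolding wrong_def by (cases "f (canonical n (fst p)) (canonical n (snd p))") auto
  have err: "measure coins {r\<in>space coins. wrong r p} \<le> 1/3" if "p \<in> {..n} \<times> {..n}" for p
  proof -
    have l: "length (canonical n (fst p)) = n" "length (canonical n (snd p)) = n" using that by auto
    have "{r. wrong r p} \<in> coins.events" using meas[of p] by (simp add: pred_def)
    then have "measure coins (UNIV - {r. wrong r p}) = 1 - measure coins {r. wrong r p}"
      using coins.prob_compl by simp
    moreover have "UNIV - {r. wrong r p} = {r. run P (canonical n (fst p)) (canonical n (snd p)) r r = f (canonical n (fst p)) (canonical n (snd p))}"
      by (auto simp: wrong_def)
    moreover have "measure coins {r. run P (canonical n (fst p)) (canonical n (snd p)) r r = f (canonical n (fst p)) (canonical n (snd p))} \<ge> 2/3"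
      using P(2)[unfolded computes_def, rule_format, OF l] unfolding prob_public[OF P(1)] .
    ultimately show ?thesis by simp
  qed
  have "real (card ({..n} \<times> {..n})) = (real n + 1)\<^sup>2" by (simp add: power2_eq_square algebra_simps)
  then have "real (card ({..n} \<times> {..n})) \<le> (1007/1000) ^ (2 ^ (coin_count n - 5))" using coin_count_large by simp
  then have "\<exists>str. \<forall>p\<in>{..n} \<times> {..n}. real (card {v\<in>cube (coin_count n). wrong (str v) p}) \<le> 11/32 * 2 ^ coin_count n"
    by (intro few_strings[OF prob_space_coins] meas err) (auto simp: coin_count_def)
  then obtain str where "\<And>p. p \<in> {..n} \<times> {..n} \<Longrightarrow>
      real (card {v\<in>cube (coin_count n). wrong (str v) p}) \<le> 11/32 * 2 ^ coin_count n"
    by blast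
  from this[of "(_, _)"] have "a \<le> n \<Longrightarrow> b \<le> n \<Longrightarrow>
      real (card {v\<in>cube (coin_count n). wrong (str v) (a, b)}) \<le> 11/32 * 2 ^ coin_count n" for a b
    by simp
  then show ?thesis using that[of str] unfolding wrong_def by simp
qed

text \<open>The flag chooses the protocol: in the one-way model every jump with non-extreme x is
  near whatever y is, so Bob need not speak; otherwise Bob opens.\<close>

lemma simulation_exists:
  assumes f: "pub_cost ow n f k"
  shows "\<exists>Q. (ow \<longrightarrow> one_way Q) \<and> measurable_protocol Q \<and> computes (correlated_randomness \<rho>) n f Q \<and>
    real (cost Q) \<le> cost_real (real k) + real (3 * coin_count n)"
proof -
  obtain P where P: "ow \<longrightarrow> one_way P" "measurable_protocol P" "computes public_randomness n f P" "cost P \<le> k"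
    using f unfolding pub_cost_def by auto
  have pi: "permutation_invariant n f" using f by (simp add: pub_cost_def)
  obtain str where str: "\<And>a b. a \<le> n \<Longrightarrow> b \<le> n \<Longrightarrow> real (card {v\<in>cube (coin_count n).
        run P (canonical n a) (canonical n b) (str v) (str v) \<noteq> f (canonical n a) (canonical n b)}) \<le> 11/32 * 2 ^ coin_count n"
    using simulation_strings[OF P(2,3)] by blast
  define W t B K q J where "W = extreme_bound k" and "t = sig_count k" and "B = small_bound k"
    and "K = cells_bound k" and "q = level_count k" and "J = sample_count k"
  interpret sim: simulation \<rho> n f P W t B K "tuple_len n (2 * K)" q J "coin_count n" str
    by unfold_locales (rule pi)
  have tol: "1 / sim.tolerance = inv_tol_real (real k)"
    unfolding sim.tolerance_def unfolding inv_tol_real_def K_def real_bounds by simp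
  have tpos: "sim.tolerance > 0"
    using \<rho> by (simp add: sim.tolerance_def add_nonneg_pos)
  interpret par: parameters \<rho> n f P W t B K "tuple_len n (2 * K)" q J "coin_count n" str
  proof unfold_locales
    show "0 < t" "0 < q" "0 < J" by (simp_all add: t_def q_def J_def count_bounds)
    show "real (W * B) * exp (- real t * \<rho>\<^sup>2 / 8) \<le> 1/50" "real (4 * K + 2) * exp (- real t * \<rho>\<^sup>2 / 8) \<le> 1/50"
      unfolding W_def B_def t_def K_def by (rule signature_parameters)+
    have "4 / sim.tolerance = 4 * inv_tol_real (real k)" unfolding tol[symmetric] by simp
    then show "4 / sim.tolerance \<le> real q" using count_bounds(4)[of k] by (simp add: q_def)
    have "40 * (1 / sim.tolerance)\<^sup>2 \<le> real J" using count_bounds(7)[of k] by (simp add: J_def tol)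
    then have "40 * (1 / sim.tolerance)\<^sup>2 * ((sim.tolerance / 2)\<^sup>2 / 2) \<le> real J * ((sim.tolerance / 2)\<^sup>2 / 2)"
      by (intro mult_right_mono) auto
    then have "5 \<le> real J * (sim.tolerance / 2)\<^sup>2 / 2" using tpos by (simp add: power_divide)
    then have "exp (- real J * (sim.tolerance / 2)\<^sup>2 / 2) \<le> exp (- 5)" by simp
    also have "\<dots> \<le> 1 / 100" using exp_numeral_bounds(2) by (simp add: exp_minus field_simps)
    finally show "2 * exp (- real J * (sim.tolerance / 2)\<^sup>2 / 2) \<le> 1/50" by simp
  qed (use str in auto)
  have cost1: "real (cost sim.one_message) \<le>
     (2 + extreme_real (real k) + extreme_real (real k) * (sig_real (real k) + 1)) + (sig_real (real k) + 1) +
     (40 * inv_tol_real (real k) ^ 2 + 1) * (4 * inv_tol_real (real k) + 1) + 3 * (real k + 1) + real (3 * coin_count n)"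
  proof -
    have "real (cost sim.one_message) \<le> real ((2 + W + W * t + t + J * q + 3 * coin_count n) + 3 * (cost P + 1))"
      by (rule of_nat_mono[OF sim.cost_one_message])
    also have "\<dots> = (2 + real W + real W * real t) + real t + real J * real q + 3 * (real (cost P) + 1) + real (3 * coin_count n)"
      by simp
    also have "\<dots> \<le> (2 + extreme_real (real k) + extreme_real (real k) * (sig_real (real k) + 1)) + (sig_real (real k) + 1) +
     (40 * inv_tol_real (real k) ^ 2 + 1) * (4 * inv_tol_real (real k) + 1) + 3 * (real k + 1) + real (3 * coin_count n)"
      unfolding W_def t_def J_def q_def real_bounds(2)
      using count_bounds[of k] positive_parameters[of k] P(4)
      by (intro add_mono mult_mono order.refl) auto
    finally show ?thesis .
  qed
  show ?thesis
  proof (cases ow)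
    case True
    have "computes (correlated_randomness \<rho>) n f sim.one_message"
    proof (rule computes_correlatedI[OF sim.measurable_one_message])
      fix x y :: "bool list" assume len: "length x = n" "length y = n"
      show "\<exists>E. E \<in> events \<and> measure \<mu> E \<le> 1/3 \<and> (\<forall>z. z \<notin> E \<longrightarrow> run sim.one_message x y (alice_bits z) (bob_bits z) = f x y)"
      proof (rule par.one_message_correct[OF len])
        fix \<alpha> \<beta> \<gamma> \<delta> assume j: "jump_at n f x y \<alpha> \<beta> \<gamma> \<delta>"
        show "sim.near_jump \<alpha> \<beta> \<gamma> \<delta>" if "\<not> extreme W x"
          using jump_classification[OF f j len] that True unfolding sim.near_jump_def by (simp add: W_def K_def)
        show "extreme B y" if "extreme W x"
          using extreme_jump_small[OF f j len] that by (simp add: W_def B_def)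
      qed
    qed
    moreover have "real (cost sim.one_message) \<le> cost_real (real k) + real (3 * coin_count n)"
    proof -
      have "0 \<le> extreme_real (real k) * (sig_real (real k) + 1)"
        using positive_parameters[of k] by (intro mult_nonneg_nonneg) auto
      then show ?thesis using cost1 positive_parameters[of k] unfolding cost_real_def by argo
    qed
    moreover have "one_way sim.one_message" using P(1) True by (intro sim.one_way_one_message) simp
    ultimately show ?thesis using sim.measurable_one_message by blast
  next
    case False
    have f0: "pub_cost False n f k" using f False by simp
    have "computes (correlated_randomness \<rho>) n f sim.two_messages"
    proof (rule computes_correlatedI[OF sim.measurable_two_messages])
      fix x y :: "bool list" assume len: "length x = n" "length y = n"
      show "\<exists>E. E \<in> events \<and> measure \<mu> E \<le> 1/3 \<and> (\<forall>z. z \<notin> E \<longrightarrow> run sim.two_messages x y (alice_bits z) (bob_bits z) = f x y)"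
      proof (rule par.two_messages_correct[OF len])
        fix \<alpha> \<beta> \<gamma> \<delta> assume j: "jump_at n f x y \<alpha> \<beta> \<gamma> \<delta>"
        show "sim.near_jump \<alpha> \<beta> \<gamma> \<delta>" if "\<not> extreme W x" "\<not> extreme W y"
          using jump_classification[OF f j len] that unfolding sim.near_jump_def by (simp add: W_def K_def)
        show "extreme B y" if "extreme W x"
          using extreme_jump_small[OF f j len] that by (simp add: W_def B_def)
        have "jump_at n (\<lambda>x y. f y x) y x \<alpha> \<gamma> \<beta> \<delta>"
          using j jump_swap[OF pi] by (auto simp: jump_at_def)
        then show "extreme B x" if "extreme W y"
          using extreme_jump_small[OF pub_cost_swap[OF f0] _ len(2,1)] that by (auto simp: W_def B_def)
      qed
    qed
    moreover have "real (cost sim.two_messages) \<le> cost_real (real k) + real (3 * coin_count n)"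
    proof -
      have "real (cost sim.two_messages) \<le> real ((2 + W + W * t) + cost sim.one_message)"
        by (rule of_nat_mono[OF sim.cost_two_messages])
      also have "\<dots> = (2 + real W + real W * real t) + real (cost sim.one_message)" by simp
      also have "\<dots> \<le> (2 + extreme_real (real k) + extreme_real (real k) * (sig_real (real k) + 1)) + real (cost sim.one_message)"
        unfolding W_def t_def real_bounds(2) using count_bounds[of k] positive_parameters[of k]
        by (intro add_mono mult_mono order.refl) auto
      finally show ?thesis using cost1 unfolding cost_real_def by argo
    qed
    ultimately show ?thesis using False sim.measurable_two_messages by blast
  qed
qed

end

section \<open>From optimal protocols to the complexity measures\<close>

lemma pub_cost_R: "permutation_invariant n f \<Longrightarrow> pub_cost False n f (R n f)"
proof -
  assume pi: "permutation_invariant n f"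
  have "\<exists>c P. measurable_protocol P \<and> computes public_randomness n f P \<and> cost P = c"
    using ex_one_way_protocol[OF prob_space_public_randomness] by blast
  from LeastI_ex[OF this] show ?thesis using pi unfolding pub_cost_def R_def by auto
qed

lemma pub_cost_R_one_way: "permutation_invariant n f \<Longrightarrow> pub_cost True n f (R_one_way n f)"
proof -
  assume pi: "permutation_invariant n f"
  have "\<exists>c P. one_way P \<and> measurable_protocol P \<and> computes public_randomness n f P \<and> cost P = c"
    using ex_one_way_protocol[OF prob_space_public_randomness] by blast
  from LeastI_ex[OF this] show ?thesis using pi unfolding pub_cost_def R_one_way_def by auto
qed

theorem theorem1p3:
  fixes \<rho> :: real
  assumes "0 < \<rho>" and "\<rho> < 1"
  shows "(\<exists>(p :: real poly) (g :: nat \<Rightarrow> real). g \<in> O(\<lambda>n. ln (ln (real n))) \<and>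
            (\<forall>n f. permutation_invariant n f \<longrightarrow>
               real (ISR \<rho> n f) \<le> poly p (real (R n f)) + g n)) \<and>
         (\<exists>(p :: real poly) (g :: nat \<Rightarrow> real). g \<in> O(\<lambda>n. ln (ln (real n))) \<and>
            (\<forall>n f. permutation_invariant n f \<longrightarrow>
               real (ISR_one_way \<rho> n f) \<le> poly p (real (R_one_way n f)) + g n))"
proof -
  interpret correlated \<rho> by unfold_locales (use assms in auto)
  \<comment> \<open>One polynomial and one coin term serve both claims, as the parameters depend
    only on \<rho>, k and n, and n enters the cost bound only through the coins.\<close>
  obtain p where p: "\<And>x. poly p x = cost_real x"
    using polynomial_cost unfolding polynomial_in_def by blast
  define g where "g n = real (3 * coin_count n)" for n
  have g: "g \<in> O(\<lambda>n. ln (ln (real n)))" unfolding g_def[abs_def] by (rule coin_count_bigo)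
  have 1: "real (ISR \<rho> n f) \<le> poly p (real (R n f)) + g n" if pi: "permutation_invariant n f" for n f
  proof -
    obtain Q where Q: "measurable_protocol Q" "computes (correlated_randomness \<rho>) n f Q"
      "real (cost Q) \<le> cost_real (real (R n f)) + real (3 * coin_count n)"
      using simulation_exists[OF pub_cost_R[OF pi]] by blast
    have "ISR \<rho> n f \<le> cost Q" unfolding ISR_def using Q by (intro Least_le) blast
    then show ?thesis using Q(3) by (simp add: p g_def)
  qed
  have 2: "real (ISR_one_way \<rho> n f) \<le> poly p (real (R_one_way n f)) + g n" if pi: "permutation_invariant n f" for n f
  proof -
    obtain Q where Q: "one_way Q" "measurable_protocol Q" "computes (correlated_randomness \<rho>) n f Q"
      "real (cost Q) \<le> cost_real (real (R_one_way n f)) + real (3 * coin_count n)"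
      using simulation_exists[OF pub_cost_R_one_way[OF pi]] by blast
    have "ISR_one_way \<rho> n f \<le> cost Q" unfolding ISR_one_way_def using Q by (intro Least_le) blast
    then show ?thesis using Q(4) by (simp add: p g_def)
  qed
  show ?thesis using g 1 2 by blast
qed

end
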